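(* If $2 \leq p \leq 4$, then $$\mathscr{C}_p \leq 2\sum_{n=0}^{\infty} \int_{n}^{n+2/p} \frac{\sin^2\left(\frac{p}{2}\pi(x-n)\right)}{\pi^2 x^2}\,dx.$$
   Context: $PW^p$ denotes the Paley--Wiener space of all functions $f$ in $L^p(\mathbb{R})$ that extend to an entire function of exponential type at most $\pi$. $\mathscr{C}_p$ is the smallest constant $C$ such that $|f(0)|^p\le C\|f\|_p^p$ for every $f\in PW^p$, where $\|f\|_p^p=\int_{\mathbb{R}}|f(x)|^p\,dx$. *)

theory Defs
  imports "HOL-Complex_Analysis.Complex_Analysis"
begin

definition exponential_type_le :: "(complex \<Rightarrow> complex) \<Rightarrow> real \<Rightarrow> bool" where
  "exponential_type_le F \<tau> \<longleftrightarrow>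
     (\<forall>\<epsilon>>0. \<exists>A. \<forall>z. norm (F z) \<le> A * exp ((\<tau> + \<epsilon>) * norm z))"

text \<open>The \<open>p\<close>-th power of the \<open>L\<^sup>p\<close> norm on the real line, possibly infinite.\<close>

definition Lp_norm_pow :: "real \<Rightarrow> (real \<Rightarrow> complex) \<Rightarrow> ennreal" where
  "Lp_norm_pow p f = (\<integral>\<^sup>+ x. ennreal (norm (f x) powr p) \<partial>lborel)"

definition Lp_fun :: "real \<Rightarrow> (real \<Rightarrow> complex) set" where
  "Lp_fun p = {f \<in> borel_measurable lborel. Lp_norm_pow p f < \<infinity>}"

text \<open>Elements are honest functions, namely the continuous representatives given by the
  entire extension, so that point evaluation makes sense.\<close>

definition Paley_Wiener :: "real \<Rightarrow> (real \<Rightarrow> complex) set" where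
  "Paley_Wiener p = {f \<in> Lp_fun p.
     \<exists>F. F holomorphic_on UNIV \<and> exponential_type_le F pi \<and> (\<forall>x. F (complex_of_real x) = f x)}"

text \<open>The smallest constant, as an extended nonnegative real: it is \<open>\<infinity>\<close> if no finite constant
  is admissible. The infimum is attained; see \<open>point_eval_le\<close> below.\<close>

definition point_eval_const :: "real \<Rightarrow> ennreal" where
  "point_eval_const p =
     Inf {C. \<forall>f \<in> Paley_Wiener p. ennreal (norm (f 0) powr p) \<le> C * Lp_norm_pow p f}"

lemma Paley_Wiener_continuous:
  assumes "f \<in> Paley_Wiener p"
  shows "continuous_on UNIV f"
proof -
  obtain F where F: "F holomorphic_on UNIV" "\<And>x. F (complex_of_real x) = f x"
    using assms by (auto simp: Paley_Wiener_def)
  have "continuous_on UNIV (\<lambda>x. F (complex_of_real x))"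
    by (rule continuous_on_compose2[OF holomorphic_on_imp_continuous_on[OF F(1)]])
       (auto intro!: continuous_intros)
  then show ?thesis by (simp add: F(2))
qed

lemma Paley_Wiener_eq_0:
  assumes f: "f \<in> Paley_Wiener p" and 0: "Lp_norm_pow p f = 0"
  shows "f x = 0"
proof -
  have [measurable]: "f \<in> borel_measurable lborel"
    using f by (auto simp: Paley_Wiener_def Lp_fun_def)
  have "AE x in lborel. ennreal (norm (f x) powr p) = 0"
    using 0 unfolding Lp_norm_pow_def by (subst (asm) nn_integral_0_iff_AE) auto
  then have "AE x in lborel. f x = 0"
    by eventually_elim (auto simp: ennreal_eq_0_iff powr_def split: if_splits)
  then have "AE x in lebesgue. x \<in> {x. f x = 0}"
    by (auto intro: AE_completion)
  moreover have "closed {x. f x = 0}"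
    using continuous_closed_preimage_constant[OF Paley_Wiener_continuous[OF f] closed_UNIV, of 0]
    by simp
  ultimately show ?thesis
    using mem_closed_if_AE_lebesgue by blast
qed

lemma point_eval_le:
  assumes f: "f \<in> Paley_Wiener p"
  shows "ennreal (norm (f 0) powr p) \<le> point_eval_const p * Lp_norm_pow p f"
proof (cases "Lp_norm_pow p f = 0")
  case True
  then show ?thesis using Paley_Wiener_eq_0[OF f True, of 0] by simp
next
  case False
  have fin: "Lp_norm_pow p f \<noteq> \<infinity>"
    using f by (auto simp: Paley_Wiener_def Lp_fun_def)
  have "ennreal (norm (f 0) powr p) / Lp_norm_pow p f \<le> point_eval_const p"
    unfolding point_eval_const_def
  proof (rule Inf_greatest, clarify)
    fix C assume "\<forall>f\<in>Paley_Wiener p. ennreal (norm (f 0) powr p) \<le> C * Lp_norm_pow p f"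
    with f have "ennreal (norm (f 0) powr p) \<le> C * Lp_norm_pow p f" by blast
    then show "ennreal (norm (f 0) powr p) / Lp_norm_pow p f \<le> C"
      using False fin by (metis divide_le_posI_ennreal mult.commute not_gr_zero)
  qed
  then have "ennreal (norm (f 0) powr p) / Lp_norm_pow p f * Lp_norm_pow p f
      \<le> point_eval_const p * Lp_norm_pow p f"
    by (rule mult_right_mono) simp
  then show ?thesis
    using False fin by (simp add: ennreal_divide_times ennreal_divide_self top.not_eq_extremum)
qed

end

theory Submission
  imports Defs "HOL-Real_Asymp.Real_Asymp" "HOL-Probability.Sinc_Integral"
begin

text \<open>Let \<open>c\<close> be the infimum of \<open>\<integral>|f|^p\<close> over the Paley--Wiener functions with \<open>f 0 = 1\<close>. The theorem says
  \<open>1 \<le> c B\<close>, where \<open>B\<close> is the right-hand side. By normal families the infimum is attained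
  (\<open>extremal_exists\<close>), at a function \<open>\<phi>\<close> that may be taken even and real on the real line. The proof
  extracts two facts from extremality.

  First, the position of the zeros. Varying \<open>\<phi>\<close> gives \<open>\<integral>sgn \<phi> |\<phi>|^(p-1) T = c T 0\<close> for every test
  function \<open>T\<close> of type \<open>pi\<close> (\<open>Euler_Lagrange\<close>). Any odd continuous function of \<open>cos (pi x)\<close> is
  orthogonal to all \<open>T\<close> with quadratic decay (\<open>PW_decay_orthogonal_odd_cos\<close>), since its frequencies
  are odd multiples of \<open>pi\<close>. Subtracting the two relations and using that the odd power is increasing,
  one finds \<open>T 0 > 0\<close> whenever \<open>T = \<rho> (\<phi> - B cos (pi x))\<close> with \<open>\<rho> > 0\<close> for real \<open>x \<noteq> 0\<close> (\<open>positivity\<close>).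
  A suitable rational \<open>\<rho>\<close> shows that the quotient \<open>\<phi> z / cos (pi z)\<close> takes no real value in the open
  first quadrant. Hence it maps the quadrant into the upper half-plane (\<open>quot_Im_pos\<close>) and is
  nondecreasing between the half-integers of the positive axis (\<open>quot_real_mono\<close>).

  Secondly, since \<open>\<phi>\<close> has no zeros in the upper half-plane, \<open>(\<phi> z exp (\<i> pi z)) powr (p/2)\<close> has a bounded
  branch there. Its boundary values have modulus \<open>|\<phi>| powr (p/2)\<close>, and their phase is determined by
  the sign of the quotient. Cauchy's formula with a kernel close to \<open>1/z\<close> gives
  \<open>pi \<le> \<integral>|\<phi>| powr (p/2) (sin phase)_+ / |x|\<close>, and the Cauchy--Schwarz inequality yields
  \<open>pi^2 \<le> c \<integral>(sin phase)_+^2 / x^2\<close> (\<open>lower_bound_c\<close>). Taking the positive part is legitimate because the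
  modulus is nonnegative.

  It remains to compare \<open>(sin phase)_+^2\<close> with the integrands of \<open>B\<close> on each interval \<open>(n, n + 1)\<close>. On the
  right half the comparison is pointwise. On the left half the quotient is negative on an initial
  interval, where \<open>(sin phase)_+^2\<close> is dominated by the expected bump moved to the right; the weight \<open>1/x^2\<close>
  decreases, so the integral only becomes smaller (\<open>left_half_integral_le\<close>). The hypotheses enter
  here: \<open>p \<le> 4\<close> makes the shift \<open>4/p - 1\<close> nonnegative, and \<open>p \<ge> 2\<close> makes it at most \<open>1\<close>, so that the
  sine is not positive in front of the shifted bump.\<close>

section \<open>The Phragmen--Lindelof principle\<close>

lemma holomorphic_on_UNIV_compose:
  assumes "f holomorphic_on UNIV" "g holomorphic_on UNIV"
  shows "(\<lambda>z. f (g z)) holomorphic_on UNIV"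
  using holomorphic_on_compose_gen[OF assms(2,1)] by (simp add: o_def)

text \<open>The comparison function in the Phragmen--Lindelof argument is \<open>exp (- \<delta> u powr (3/2))\<close>
  with \<open>u\<close> in the sector \<open>|arg u| \<le> pi/4\<close>. The power stays in the right half-plane there because
  \<open>3/2 * pi/4 < pi/2\<close>, and the exponent \<open>3/2\<close> exceeds the order \<open>1\<close> of the functions in question.\<close>

lemma Im_Ln_bound_quarter:
  assumes "\<bar>Im u\<bar> \<le> Re u" "u \<noteq> 0"
  shows "\<bar>Im (Ln u)\<bar> \<le> pi / 4"
proof -
  have pos: "Re u > 0" using assms by (auto simp: complex_eq_iff)
  then have lt: "\<bar>Im (Ln u)\<bar> < pi/2" using Re_Ln_pos_lt[OF assms(2)] by blast
  have "Ln (u\<^sup>2) = 2 * Ln u"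
  proof (rule Ln_unique)
    show "exp (2 * Ln u) = u\<^sup>2" using assms(2) by (simp add: exp_double)
  qed (use lt in auto)
  moreover have "0 \<le> Re (u\<^sup>2)"
    using assms(1) pos by (simp add: power2_eq_square) (metis abs_le_square_iff abs_of_pos power2_eq_square)
  then have "\<bar>Im (Ln (u\<^sup>2))\<bar> \<le> pi/2" using assms(2) by (subst Re_Ln_pos_le) auto
  ultimately show ?thesis by simp
qed

lemma Re_powr_three_halves_ge:
  assumes "\<bar>Im u\<bar> \<le> Re u" "u \<noteq> 0"
  shows "Re (u powr (3/2)) \<ge> norm u powr (3/2) * cos (3 * pi / 8)"
proof -
  have "\<bar>Im (Ln u)\<bar> \<le> pi / 4" by (rule Im_Ln_bound_quarter[OF assms])
  then have "cos (3 * pi / 8) \<le> cos \<bar>3/2 * Im (Ln u)\<bar>"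
    by (intro cos_monotone_0_pi_le) (auto simp: abs_mult)
  then have c: "cos (3 * pi / 8) \<le> cos (3/2 * Im (Ln u))" by (simp only: cos_abs_real)
  have "Re (u powr (3/2)) = exp (3/2 * Re (Ln u)) * cos (3/2 * Im (Ln u))"
    using assms(2) by (simp add: powr_def Re_exp)
  also have "exp (3/2 * Re (Ln u)) = norm u powr (3/2)"
    using assms(2) by (simp add: powr_def)
  finally show ?thesis using c by (simp add: mult_left_mono)
qed

text \<open>A quadrant has opening \<open>pi/2\<close>, and functions of order \<open>1\<close> are below its critical order \<open>2\<close>. So a
  bound on the two boundary rays propagates into the quadrant.\<close>

lemma Phragmen_Lindelof_quadrant:
  assumes hol: "G holomorphic_on UNIV" and M: "M > 0"
    and gr: "\<And>z. norm (G z) \<le> A * exp (B * norm z)"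
    and re: "\<And>x. x \<ge> 0 \<Longrightarrow> norm (G (of_real x)) \<le> M"
    and im: "\<And>y. y \<ge> 0 \<Longrightarrow> norm (G (\<i> * of_real y)) \<le> M"
    and z: "Re z \<ge> 0" "Im z \<ge> 0"
  shows "norm (G z) \<le> M"
proof -
  \<comment> \<open>The rotation by \<open>- pi/4\<close> turns the quadrant into the sector \<open>|arg| \<le> pi/4\<close>;
    adding \<open>1\<close> keeps the branch point of the power outside.\<close>
  define u where "u = (\<lambda>z::complex. 1 + Complex (1/sqrt 2) (-(1/sqrt 2)) * z)"
  define \<kappa> where "\<kappa> = cos (3 * pi / 8)"
  have \<kappa>: "\<kappa> > 0" unfolding \<kappa>_def by (rule cos_gt_zero) auto
  have u1: "\<bar>Im (u z)\<bar> \<le> Re (u z)" "Re (u z) \<ge> 1" if "Re z \<ge> 0" "Im z \<ge> 0" for z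
    using that by (auto simp: u_def abs_if field_simps)
  have u0: "u z \<noteq> 0" if "Re z \<ge> 0" "Im z \<ge> 0" for z
    using u1[OF that] by auto
  have u2: "norm (u z) \<ge> norm z" if "Re z \<ge> 0" "Im z \<ge> 0" for z
  proof -
    have "(norm (u z))\<^sup>2 = (1 + (Re z + Im z)/sqrt 2)\<^sup>2 + ((Im z - Re z)/sqrt 2)\<^sup>2"
      by (simp add: u_def cmod_power2 field_simps)
    also have "\<dots> = 1 + 2*(Re z + Im z)/sqrt 2 + ((Re z + Im z)\<^sup>2 + (Im z - Re z)\<^sup>2)/2"
      by (simp add: power2_sum power_divide add_divide_distrib)
    also have "((Re z + Im z)\<^sup>2 + (Im z - Re z)\<^sup>2)/2 = (norm z)\<^sup>2"
      unfolding cmod_power2 by (simp add: power2_eq_square algebra_simps)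
    finally have "(norm z)\<^sup>2 \<le> (norm (u z))\<^sup>2" using that by simp
    then show ?thesis by (rule power2_le_imp_le) simp
  qed
  have bound: "norm (G z) * exp (- \<delta> * Re (u z powr (3/2))) \<le> M" if \<delta>: "\<delta> > 0" for \<delta>
  proof -
    define H where "H = (\<lambda>z. G z * exp (- of_real \<delta> * u z powr (3/2)))"
    have nH: "norm (H z) = norm (G z) * exp (- \<delta> * Re (u z powr (3/2)))" for z
      by (simp add: H_def norm_mult)
    have pos: "Re (u z powr (3/2)) \<ge> norm (u z) powr (3/2) * \<kappa>" if "Re z \<ge> 0" "Im z \<ge> 0" for z
      unfolding \<kappa>_def by (rule Re_powr_three_halves_ge) (use u0 u1 that in auto)
    have ex: "eventually (\<lambda>R. \<bar>A\<bar> * exp ((\<bar>B\<bar> + 1) * R) * exp (- (\<delta> * \<kappa>) * R powr (3/2)) \<le> M) at_top"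
    proof -
      have "((\<lambda>R. \<bar>A\<bar> * exp ((\<bar>B\<bar> + 1) * R) * exp (- (\<delta> * \<kappa>) * R powr (3/2))) \<longlongrightarrow> 0) at_top"
      proof -
        define k where "k = \<delta> * \<kappa>"
        have k: "k > 0" using \<delta> \<kappa> by (simp add: k_def)
        moreover define b where "b = \<bar>B\<bar> + 1"
        moreover have b: "b > 0" by (simp add: b_def)
        ultimately have "((\<lambda>R. exp (b * R) * exp (- k * R powr (3/2))) \<longlongrightarrow> 0) at_top" by real_asymp
        then show ?thesis unfolding k_def[symmetric] b_def[symmetric]
          by (simp add: mult.assoc tendsto_mult_right_zero)
      qed
      from order_tendstoD(2)[OF this M] show ?thesis
        by (simp add: eventually_mono less_imp_le)
    qed
    obtain R where R: "R \<ge> norm z" "R > 0" "\<bar>A\<bar> * exp ((\<bar>B\<bar> + 1) * R) * exp (- (\<delta> * \<kappa>) * R powr (3/2)) \<le> M"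
      using eventually_happens[OF eventually_conj[OF ex eventually_conj[OF eventually_ge_at_top[of "norm z"] eventually_gt_at_top[of 0]]]] by auto
    define S where "S = {z::complex. Re z \<ge> 0 \<and> Im z \<ge> 0 \<and> norm z \<le> R}"
    have clS: "closed S" unfolding S_def
      by (intro closed_Collect_conj closed_Collect_le continuous_intros)
    have bS: "bounded S" unfolding S_def by (rule boundedI[of _ R]) auto
    have openI: "{z. Re z > 0 \<and> Im z > 0 \<and> norm z < R} \<subseteq> interior S"
      by (rule interior_maximal) (auto simp: S_def intro!: open_Collect_conj open_Collect_less continuous_intros)
    have notneg: "u z \<notin> \<real>\<^sub>\<le>\<^sub>0" if "Re z \<ge> 0" "Im z \<ge> 0" for z
      using u1[OF that] by (auto simp: complex_nonpos_Reals_iff)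
    have SS: "z \<in> S \<Longrightarrow> Re z \<ge> 0 \<and> Im z \<ge> 0" for z by (simp add: S_def)
    have holu: "u holomorphic_on S" unfolding u_def by (intro holomorphic_intros)
    have holH: "H holomorphic_on S" unfolding H_def
      by (intro holomorphic_intros holomorphic_on_subset[OF hol] holu) (use notneg SS in auto)
    have "norm (H z) \<le> M"
    proof (rule maximum_modulus_frontier[of H S])
      show "H holomorphic_on interior S" using holH interior_subset holomorphic_on_subset by blast
      show "continuous_on (closure S) H"
        using holH clS by (simp add: holomorphic_on_imp_continuous_on)
      show "bounded S" by (rule bS)
      show "z \<in> S" using z R by (simp add: S_def)
      fix w assume "w \<in> frontier S"
      then have wS: "w \<in> S" and "w \<notin> interior S" using clS by (auto simp: frontier_def)
      then have cs: "Re w = 0 \<or> Im w = 0 \<or> norm w = R"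
        using openI by (force simp: S_def)
      have w: "Re w \<ge> 0" "Im w \<ge> 0" "norm w \<le> R" using wS by (auto simp: S_def)
      have p0: "Re (u w powr (3/2)) \<ge> 0"
        using pos[OF w(1,2)] \<kappa> by (meson mult_nonneg_nonneg order_trans powr_ge_zero less_imp_le)
      have e1: "exp (- \<delta> * Re (u w powr (3/2))) \<le> 1" using p0 \<delta> by simp
      consider "Re w = 0" | "Im w = 0" | "norm w = R" using cs by blast
      then show "norm (H w) \<le> M"
      proof cases
        case 1
        then have "w = \<i> * of_real (Im w)" by (simp add: complex_eq_iff)
        then have "norm (G w) \<le> M" using im[OF w(2)] by metis
        then show ?thesis unfolding nH using e1 M
          by (metis mult.right_neutral mult_mono' norm_ge_zero exp_ge_zero)
      next
        case 2
        then have "w = of_real (Re w)" by (simp add: complex_eq_iff)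
        then have "norm (G w) \<le> M" using re[OF w(1)] by metis
        then show ?thesis unfolding nH using e1 M
          by (metis mult.right_neutral mult_mono' norm_ge_zero exp_ge_zero)
      next
        case 3
        have "norm (G w) \<le> \<bar>A\<bar> * exp ((\<bar>B\<bar> + 1) * R)"
        proof -
          have "norm (G w) \<le> A * exp (B * norm w)" by (rule gr)
          also have "\<dots> \<le> \<bar>A\<bar> * exp ((\<bar>B\<bar> + 1) * R)"
            using 3 R(2) by (intro mult_mono) (auto intro!: mult_right_mono)
          finally show ?thesis .
        qed
        moreover have "R powr (3/2) * \<kappa> \<le> Re (u w powr (3/2))"
          using pos[OF w(1,2)] u2[OF w(1,2)] 3 R(2) \<kappa>
          by (intro order_trans[OF mult_right_mono[OF powr_mono2] pos[OF w(1,2)]]) auto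
        then have "exp (- \<delta> * Re (u w powr (3/2))) \<le> exp (- (\<delta> * \<kappa>) * R powr (3/2))"
          using \<delta> by (simp add: mult.commute mult.left_commute)
        ultimately have "norm (H w) \<le> \<bar>A\<bar> * exp ((\<bar>B\<bar> + 1) * R) * exp (- (\<delta> * \<kappa>) * R powr (3/2))"
          unfolding nH by (intro mult_mono) auto
        then show ?thesis using R(3) by linarith
      qed
    qed
    then show ?thesis by (simp add: nH)
  qed
  have "((\<lambda>\<delta>. norm (G z) * exp (- \<delta> * Re (u z powr (3/2)))) \<longlongrightarrow> norm (G z) * exp (- 0 * Re (u z powr (3/2)))) (at_right 0)"
    by (intro tendsto_intros)
  then have lim: "((\<lambda>\<delta>. norm (G z) * exp (- \<delta> * Re (u z powr (3/2)))) \<longlongrightarrow> norm (G z)) (at_right 0)" by simp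
  show ?thesis
    by (rule tendsto_upperbound[OF lim]) (use bound in \<open>auto simp: eventually_at_right_less eventually_at intro!: exI[of _ 1]\<close>)
qed

text \<open>Multiplication by \<open>exp (\<i> a z)\<close> makes the function bounded on the imaginary axis, so both
  quadrants are covered, but only with the constant \<open>max M A\<close>. Once boundedness in the half-plane is
  known, the mild divisor \<open>1 - \<i> \<delta> z\<close> suffices to recover the sharp constant \<open>M\<close>.\<close>

lemma Phragmen_Lindelof_half_plane:
  assumes hol: "f holomorphic_on UNIV" and M: "M > 0" and a: "a > 0"
    and gr: "\<And>z. norm (f z) \<le> A * exp (a * norm z)"
    and re: "\<And>x. norm (f (of_real x)) \<le> M"
    and z: "Im z \<ge> 0"
  shows "norm (f z) \<le> M * exp (a * Im z)"
proof -
  define G where "G = (\<lambda>z. f z * exp (\<i> * of_real a * z))"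
  have nG: "norm (G z) = norm (f z) * exp (- a * Im z)" for z
    by (simp add: G_def norm_mult)
  have holG: "G holomorphic_on UNIV" unfolding G_def by (intro holomorphic_intros hol)
  \<comment> \<open>The constant \<open>A\<close> bounds \<open>G\<close> on the imaginary axis.\<close>
  define M' where "M' = max M A"
  have M': "M' > 0" "M \<le> M'" "A \<le> M'" using M by (auto simp: M'_def)
  have A0: "A \<ge> 0" using order_trans[OF norm_ge_zero gr[of 0]] by simp
  have grG: "norm (G z) \<le> A * exp ((2*a) * norm z)" for z
  proof -
    have "- Im z \<le> norm z" using abs_Im_le_cmod[of z] by linarith
    from mult_left_mono[OF this, of a] have "- a * Im z \<le> a * norm z" using a by simp
    then have "norm (G z) \<le> (A * exp (a * norm z)) * exp (a * norm z)"
      unfolding nG by (intro mult_mono gr) (auto simp: A0)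
    then show ?thesis by (simp add: exp_add[symmetric] mult.assoc)
  qed
  have onre: "norm (G (of_real x)) \<le> M" for x using re[of x] by (simp add: nG)
  have onim: "norm (G (\<i> * of_real y)) \<le> A" if "y \<ge> 0" for y
    using gr[of "\<i> * of_real y"] that by (simp add: nG norm_mult exp_minus field_simps)
  have Gb: "norm (G w) \<le> M'" if w: "Im w \<ge> 0" for w
  proof (cases "Re w \<ge> 0")
    case True
    show ?thesis
      by (rule Phragmen_Lindelof_quadrant[OF holG M'(1) grG _ _ True w])
        (use onre onim M' in \<open>meson order_trans\<close>)+
  next
    case False
    define v where "v = - \<i> * w"
    have v: "Re v \<ge> 0" "Im v \<ge> 0" "\<i> * v = w" using w False by (auto simp: v_def)
    have "norm (G (\<i> * v)) \<le> M'"
    proof (rule Phragmen_Lindelof_quadrant[where G="\<lambda>z. G (\<i> * z)", OF _ M'(1) _ _ _ v(1,2)])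
      show "(\<lambda>z. G (\<i> * z)) holomorphic_on UNIV"
        by (rule holomorphic_on_UNIV_compose[OF holG]) (intro holomorphic_intros)
      show "norm (G (\<i> * z)) \<le> A * exp ((2*a) * norm z)" for z
        using grG[of "\<i> * z"] by (simp add: norm_mult)
      show "norm (G (\<i> * complex_of_real x)) \<le> M'" if "x \<ge> 0" for x
        using onim[OF that] M' by linarith
      show "norm (G (\<i> * (\<i> * complex_of_real y))) \<le> M'" if "y \<ge> 0" for y
        using onre[of "-y"] M'(2) by (simp add: mult.assoc[symmetric])
    qed
    then show ?thesis by (simp add: v)
  qed
  have bound: "norm (G z) \<le> M * norm (1 - \<i> * of_real \<delta> * z)" if \<delta>: "\<delta> > 0" for \<delta>
  proof -
    define H where "H = (\<lambda>z. G z / (1 - \<i> * of_real \<delta> * z))"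
    have ge1: "norm (1 - \<i> * of_real \<delta> * z) \<ge> 1" "norm (1 - \<i> * of_real \<delta> * z) \<ge> \<delta> * norm z" if "Im z \<ge> 0" for z
    proof -
      have e: "(norm (1 - \<i> * of_real \<delta> * z))\<^sup>2 = 1 + 2*\<delta>*Im z + \<delta>\<^sup>2 * (norm z)\<^sup>2"
        unfolding cmod_power2 by (simp add: power2_eq_square algebra_simps)
      have "0 \<le> \<delta>\<^sup>2 * (norm z)\<^sup>2" by simp
      then have "1\<^sup>2 \<le> (norm (1 - \<i> * of_real \<delta> * z))\<^sup>2" unfolding e using \<delta> that by simp
      then show "norm (1 - \<i> * of_real \<delta> * z) \<ge> 1" by (rule power2_le_imp_le) auto
      have "(\<delta> * norm z)\<^sup>2 \<le> (norm (1 - \<i> * of_real \<delta> * z))\<^sup>2" unfolding e using \<delta> that by (simp add: power_mult_distrib)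
      then show "norm (1 - \<i> * of_real \<delta> * z) \<ge> \<delta> * norm z" by (rule power2_le_imp_le) auto
    qed
    define R where "R = max (norm z) (M' / (\<delta> * M))"
    have R: "norm z \<le> R" "M' / (\<delta> * M) \<le> R" by (auto simp: R_def)
    then have R': "M' / (\<delta> * R) \<le> M" "R > 0"
    proof -
      have "0 < M' / (\<delta> * M)" using M' M \<delta> by simp
      then show "R > 0" using R by linarith
      then show "M' / (\<delta> * R) \<le> M" using R(2) \<delta> M by (simp add: field_simps)
    qed
    define S where "S = {z::complex. Im z \<ge> 0 \<and> norm z \<le> R}"
    have clS: "closed S" unfolding S_def
      by (intro closed_Collect_conj closed_Collect_le continuous_intros)
    have bS: "bounded S" unfolding S_def by (rule boundedI[of _ R]) auto
    have openI: "{z. Im z > 0 \<and> norm z < R} \<subseteq> interior S"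
      by (rule interior_maximal) (auto simp: S_def intro!: open_Collect_conj open_Collect_less continuous_intros)
    have holH: "H holomorphic_on S" unfolding H_def
      using ge1 by (intro holomorphic_intros holomorphic_on_subset[OF holG]) (force simp: S_def)+
    have "norm (H z) \<le> M"
    proof (rule maximum_modulus_frontier[of H S])
      show "H holomorphic_on interior S" using holH interior_subset holomorphic_on_subset by blast
      show "continuous_on (closure S) H"
        using holH clS by (simp add: holomorphic_on_imp_continuous_on)
      show "bounded S" by (rule bS)
      show "z \<in> S" using z R by (simp add: S_def)
      fix w assume "w \<in> frontier S"
      then have wS: "w \<in> S" and "w \<notin> interior S" using clS by (auto simp: frontier_def)
      then have cs: "Im w = 0 \<or> norm w = R"
        using openI by (force simp: S_def)
      have w: "Im w \<ge> 0" "norm w \<le> R" using wS by (auto simp: S_def)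
      have nH: "norm (H w) = norm (G w) / norm (1 - \<i> * of_real \<delta> * w)" by (simp add: H_def norm_divide)
      consider "Im w = 0" | "norm w = R" using cs by blast
      then show "norm (H w) \<le> M"
      proof cases
        case 1
        then have "w = of_real (Re w)" by (simp add: complex_eq_iff)
        then have "norm (G w) \<le> M" using onre by metis
        then have "norm (G w) / norm (1 - \<i> * of_real \<delta> * w) \<le> M / 1"
          using ge1(1)[OF w(1)] M by (intro frac_le) auto
        then show ?thesis unfolding nH by simp
      next
        case 2
        have "norm (G w) / norm (1 - \<i> * of_real \<delta> * w) \<le> M' / (\<delta> * R)"
          using ge1(2)[OF w(1)] M' Gb[OF w(1)] 2 R'(2) \<delta> by (intro frac_le) auto
        then show ?thesis unfolding nH using R' by linarith
      qed
    qed
    then have "norm (G z) / norm (1 - \<i> * of_real \<delta> * z) \<le> M" by (simp add: H_def norm_divide)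
    then show ?thesis using ge1(1)[OF z] by (simp add: divide_le_eq split: if_splits)
  qed
  have "((\<lambda>\<delta>. M * norm (1 - \<i> * of_real \<delta> * z)) \<longlongrightarrow> M * norm (1 - \<i> * of_real 0 * z)) (at_right 0)"
    by (intro tendsto_intros)
  then have lim: "((\<lambda>\<delta>. M * norm (1 - \<i> * of_real \<delta> * z)) \<longlongrightarrow> M) (at_right 0)" by simp
  have "norm (G z) \<le> M"
    by (rule tendsto_lowerbound[OF lim]) (use bound in \<open>auto simp: eventually_at_right_less eventually_at intro!: exI[of _ 1]\<close>)
  then show ?thesis by (simp add: nG exp_minus field_simps)
qed

lemma exponential_type_bounded_on_real:
  assumes hol: "f holomorphic_on UNIV" and ty: "exponential_type_le f \<tau>" and \<tau>: "\<tau> \<ge> 0"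
    and re: "\<And>x. norm (f (of_real x)) \<le> M"
  shows "norm (f z) \<le> M * exp (\<tau> * \<bar>Im z\<bar>)"
proof -
  have *: "norm (f z) \<le> N * exp ((\<tau> + e) * \<bar>Im z\<bar>)" if N: "N > M" and e: "e > 0" for N e
  proof -
    obtain A where A: "\<And>z. norm (f z) \<le> A * exp ((\<tau> + e) * norm z)"
      using ty e unfolding exponential_type_le_def by blast
    have N0: "N > 0" using N order_trans[OF norm_ge_zero re[of 0]] by linarith
    have re': "norm (f (of_real x)) \<le> N" for x using re[of x] N by simp
    show ?thesis
    proof (cases "Im z \<ge> 0")
      case True
      then show ?thesis
        using Phragmen_Lindelof_half_plane[OF hol N0 _ A re' True] \<tau> e by simp
    next
      case False
      have "norm ((\<lambda>z. f (- z)) (- z)) \<le> N * exp ((\<tau> + e) * Im (- z))"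
      proof (rule Phragmen_Lindelof_half_plane[OF _ N0])
        show "(\<lambda>z. f (- z)) holomorphic_on UNIV"
          by (rule holomorphic_on_UNIV_compose[OF hol]) (intro holomorphic_intros)
        show "norm (f (- z)) \<le> A * exp ((\<tau> + e) * norm z)" for z using A[of "-z"] by simp
        show "norm (f (- complex_of_real x)) \<le> N" for x using re'[of "-x"] by simp
      qed (use \<tau> e False in auto)
      then show ?thesis using False by simp
    qed
  qed
  have "((\<lambda>e. (M + e) * exp ((\<tau> + e) * \<bar>Im z\<bar>)) \<longlongrightarrow> (M + 0) * exp ((\<tau> + 0) * \<bar>Im z\<bar>)) (at_right 0)"
    by (intro tendsto_intros)
  then have lim: "((\<lambda>e. (M + e) * exp ((\<tau> + e) * \<bar>Im z\<bar>)) \<longlongrightarrow> M * exp (\<tau> * \<bar>Im z\<bar>)) (at_right 0)" by simp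
  show ?thesis
    by (rule tendsto_lowerbound[OF lim]) (use * in \<open>auto simp: eventually_at intro!: exI[of _ 1]\<close>)
qed

section \<open>Pointwise bounds in Paley--Wiener spaces\<close>

lemma powr_midpoint_le:
  fixes a b p :: real
  assumes "a \<ge> 0" "b \<ge> 0" "p \<ge> 1"
  shows "((a + b) / 2) powr p \<le> (a powr p + b powr p) / 2"
proof (cases "a = 0 \<or> b = 0")
  case True
  have *: "(x / 2) powr p \<le> x powr p / 2" if "x \<ge> 0" for x :: real
  proof -
    have "2 powr 1 \<le> (2::real) powr p" using assms by (intro powr_mono) auto
    then have "x powr p / 2 powr p \<le> x powr p / 2" by (intro divide_left_mono) auto
    then show ?thesis using that by (simp add: powr_divide)
  qed
  show ?thesis using True *[of a] *[of b] assms by auto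
next
  case False
  then have "((1 - 1/2) *\<^sub>R a + (1/2) *\<^sub>R b) powr p \<le> (1 - 1/2) * a powr p + (1/2) * b powr p"
    using assms by (intro convex_onD[OF powr_convex]) auto
  then show ?thesis by (simp add: field_simps)
qed

lemma le_one_plus_powr:
  fixes a p :: real
  assumes "a \<ge> 0" "p \<ge> 1"
  shows "a \<le> 1 + a powr p"
proof (cases "a \<le> 1")
  case False
  then have "a powr 1 \<le> a powr p" using assms by (intro powr_mono) auto
  then show ?thesis using False by simp
qed (use powr_ge_zero[of a p] in linarith)

lemma exponential_type_leI:
  assumes "\<And>z. norm (f z) \<le> K * exp (pi * \<bar>Im z\<bar>)"
  shows "exponential_type_le f pi"
  unfolding exponential_type_le_def
proof (intro allI impI exI[of _ K])
  fix e :: real and z assume e: "e > 0"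
  have K: "0 \<le> K" using order_trans[OF norm_ge_zero assms[of 0]] by simp
  have "pi * \<bar>Im z\<bar> \<le> pi * norm z" using abs_Im_le_cmod[of z] by simp
  also have "\<dots> \<le> (pi + e) * norm z" using e by (simp add: mult_right_mono)
  finally have "K * exp (pi * \<bar>Im z\<bar>) \<le> K * exp ((pi + e) * norm z)"
    using K by (intro mult_left_mono) auto
  then show "norm (f z) \<le> K * exp ((pi + e) * norm z)" using assms[of z] by linarith
qed

lemma exponential_type_le_add_cmult:
  assumes "exponential_type_le f \<tau>" "exponential_type_le g \<tau>"
  shows "exponential_type_le (\<lambda>z. f z + b * g z) \<tau>"
  unfolding exponential_type_le_def
proof (intro allI impI)
  fix \<epsilon> :: real assume \<epsilon>: "\<epsilon> > 0"
  obtain A B where A: "\<And>z. norm (f z) \<le> A * exp ((\<tau> + \<epsilon>) * norm z)"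
      and B: "\<And>z. norm (g z) \<le> B * exp ((\<tau> + \<epsilon>) * norm z)"
    using assms \<epsilon> unfolding exponential_type_le_def by meson
  have "norm (f z + b * g z) \<le> (A + norm b * B) * exp ((\<tau> + \<epsilon>) * norm z)" for z
    using norm_triangle_ineq[of "f z" "b * g z"] A[of z] mult_left_mono[OF B[of z] norm_ge_zero[of b]]
    by (simp add: norm_mult algebra_simps)
  then show "\<exists>A. \<forall>z. norm (f z + b * g z) \<le> A * exp ((\<tau> + \<epsilon>) * norm z)" by blast
qed

lemma isCont_entire: "f holomorphic_on UNIV \<Longrightarrow> isCont f z"
  using holomorphic_on_imp_continuous_on continuous_on_eq_continuous_at[OF open_UNIV] by blast

lemma tendsto_Complex_of_real:
  "((\<lambda>e. Complex x e) \<longlongrightarrow> of_real x) (at_right 0)"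
proof -
  have "((\<lambda>e. Complex x e) \<longlongrightarrow> Complex x 0) (at_right 0)" by (intro tendsto_intros)
  then show ?thesis by (simp only: complex_of_real_def)
qed

lemma continuous_on_real_axis:
  assumes "f holomorphic_on UNIV"
  shows "continuous_on S (\<lambda>x. f (complex_of_real x))"
  by (rule continuous_on_compose2[OF holomorphic_on_imp_continuous_on[OF assms]]) (auto intro!: continuous_intros)

lemma measurable_real_axis:
  assumes "f holomorphic_on UNIV"
  shows "(\<lambda>x. f (complex_of_real x)) \<in> borel_measurable borel"
  by (intro borel_measurable_continuous_onI continuous_on_real_axis assms)

text \<open>A bound on \<open>\<integral>|f|^p\<close> controls the averages \<open>P (x + d) - P x\<close> over short intervals, where \<open>P\<close> is a
  primitive of \<open>f\<close>. These averages are entire of the same type and bounded on the line, hence bounded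
  near the line, and so is their derivative \<open>f (x + d) - f x\<close>. Since \<open>|f|\<close> cannot be large on a whole
  unit interval, \<open>f\<close> is bounded on the line. That the constant depends on \<open>c\<close>
  alone makes minimising sequences locally bounded.\<close>

lemma Nikolskii_bound:
  fixes f :: "complex \<Rightarrow> complex"
  assumes hol: "f holomorphic_on UNIV" and ty: "exponential_type_le f pi" and p: "p \<ge> 1"
    and int: "integrable lborel (\<lambda>x. norm (f (of_real x)) powr p)"
    and c: "(\<integral>x. norm (f (of_real x)) powr p \<partial>lborel) \<le> c"
  shows "norm (f z) \<le> (1 + c) * (1 + exp pi) * exp (pi * \<bar>Im z\<bar>)"
proof -
  have c0: "c \<ge> 0" by (rule order_trans[OF _ c]) simp
  obtain P where P: "\<And>z. (P has_field_derivative f z) (at z)"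
    using holomorphic_convex_primitive'[OF convex_UNIV open_UNIV hol] by auto
  have holP: "P holomorphic_on UNIV" using P by (auto simp: holomorphic_on_def field_differentiable_def intro: has_field_derivative_at_within)
  define D where "D = (\<lambda>d z. P (z + of_real d) - P z)"
  have holD: "D d holomorphic_on UNIV" for d unfolding D_def
    by (intro holomorphic_intros holomorphic_on_UNIV_compose[OF holP]) 
  have derD: "(D d has_field_derivative (f (z + of_real d) - f z)) (at z)" for d z
    unfolding D_def by (auto intro!: derivative_eq_intros DERIV_chain'[OF _ P, THEN DERIV_cong] P)
  have tyD: "exponential_type_le (D d) pi" if d: "0 \<le> d" "d \<le> 1" for d
    unfolding exponential_type_le_def
  proof (intro allI impI)
    fix e :: real assume e: "e > 0"
    obtain A where A: "\<And>z. norm (f z) \<le> A * exp ((pi + e) * norm z)"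
      using ty e unfolding exponential_type_le_def by blast
    have A0: "A \<ge> 0" using order_trans[OF norm_ge_zero A[of 0]] by simp
    have "norm (D d z) \<le> (A * exp (pi + e)) * exp ((pi + e) * norm z)" for z
    proof -
      have "norm (P (z + of_real d) - P z) \<le> (A * exp ((pi + e) * (norm z + 1))) * norm (z + of_real d - z)"
      proof (rule field_differentiable_bound[of "cball z 1" P f])
        fix w assume w: "w \<in> cball z 1"
        show "(P has_field_derivative f w) (at w within cball z 1)"
          using P by (rule has_field_derivative_at_within)
        have "norm w \<le> norm z + 1" using w norm_triangle_ineq2[of w z] by (simp add: dist_norm norm_minus_commute)
        then have "A * exp ((pi + e) * norm w) \<le> A * exp ((pi + e) * (norm z + 1))"
          using A0 e pi_gt_zero by (auto intro!: mult_left_mono add_nonneg_nonneg)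
        then show "norm (f w) \<le> A * exp ((pi + e) * (norm z + 1))" using A[of w] by linarith
      qed (use d in \<open>auto simp: dist_norm\<close>)
      also have "\<dots> \<le> (A * exp ((pi + e) * (norm z + 1))) * 1"
        using d A0 by (intro mult_left_mono) auto
      finally show ?thesis by (simp add: D_def exp_add[symmetric] algebra_simps)
    qed
    then show "\<exists>A. \<forall>z. norm (D d z) \<le> A * exp ((pi + e) * norm z)" by blast
  qed
  have boundD: "norm (D d (of_real x)) \<le> 1 + c" if d: "0 \<le> d" "d \<le> 1" for d x
  proof -
    define I where "I = (\<lambda>t. indicator {x..x+d} t :: real)"
    have cont: "continuous_on {x..x+d} (\<lambda>t. f (of_real t))" by (rule continuous_on_real_axis[OF hol])
    have vd: "((\<lambda>t. P (of_real t)) has_vector_derivative f (of_real t)) (at t within {x..x+d})" for t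
      using has_vector_derivative_real_field[OF P[of "of_real t"]] by (rule has_vector_derivative_at_within)
    have "(\<integral>t. I t *\<^sub>R f (of_real t) \<partial>lborel) = P (of_real (x+d)) - P (of_real x)"
      unfolding I_def by (rule integral_FTC_atLeastAtMost) (use d vd cont in auto)
    then have "norm (D d (of_real x)) = norm (\<integral>t. I t *\<^sub>R f (of_real t) \<partial>lborel)" by (simp add: D_def)
    also have "\<dots> \<le> (\<integral>t. norm (I t *\<^sub>R f (of_real t)) \<partial>lborel)" by (rule integral_norm_bound)
    also have "\<dots> \<le> (\<integral>t. I t + norm (f (of_real t)) powr p \<partial>lborel)"
    proof (rule integral_mono)
      have "integrable lborel (\<lambda>t. I t *\<^sub>R f (of_real t))"
        using borel_integrable_atLeastAtMost'[OF cont] unfolding set_integrable_def I_def .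
      then show "integrable lborel (\<lambda>t. norm (I t *\<^sub>R f (of_real t)))" by (rule integrable_norm)
      have "integrable lborel I" unfolding I_def
        by (rule integrable_real_indicator) (auto simp: emeasure_lborel_Icc_eq)
      then show "integrable lborel (\<lambda>t. I t + norm (f (of_real t)) powr p)" using int by (rule Bochner_Integration.integrable_add)
      show "norm (I t *\<^sub>R f (of_real t)) \<le> I t + norm (f (of_real t)) powr p" for t
        using le_one_plus_powr[OF norm_ge_zero p, of "f (of_real t)"] by (auto simp: I_def indicator_def)
    qed
    also have "\<dots> = d + (\<integral>x. norm (f (of_real x)) powr p \<partial>lborel)"
      using d int unfolding I_def by (subst Bochner_Integration.integral_add) auto
    finally show ?thesis using d c by linarith
  qed
  have D_all: "norm (D d z) \<le> (1 + c) * exp (pi * \<bar>Im z\<bar>)" if d: "0 \<le> d" "d \<le> 1" for d z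
    by (rule exponential_type_bounded_on_real[OF holD tyD]) (use d boundD in auto)
  have diff: "norm (f (of_real x + of_real d) - f (of_real x)) \<le> (1 + c) * exp pi" if d: "0 \<le> d" "d \<le> 1" for d x
  proof -
    have "norm ((deriv ^^ 1) (D d) (of_real x)) \<le> fact 1 * ((1 + c) * exp pi) / 1 ^ 1"
    proof (rule Cauchy_inequality)
      show "D d holomorphic_on ball (of_real x) 1" using holD holomorphic_on_subset by blast
      show "continuous_on (cball (of_real x) 1) (D d)" using holD holomorphic_on_imp_continuous_on holomorphic_on_subset by blast
      fix w :: complex assume w: "norm (of_real x - w) = 1"
      have "\<bar>Im w\<bar> \<le> 1" using abs_Im_le_cmod[of "of_real x - w"] w by simp
      then have "(1 + c) * exp (pi * \<bar>Im w\<bar>) \<le> (1 + c) * exp pi" using c0 by (intro mult_left_mono) auto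
      then show "norm (D d w) \<le> (1 + c) * exp pi" using D_all[OF d, of w] by linarith
    qed simp
    then show ?thesis using DERIV_imp_deriv[OF derD] by simp
  qed
  have small: "\<exists>d. 0 \<le> d \<and> d \<le> 1 \<and> norm (f (of_real x + of_real d)) \<le> 1 + c" for x
  proof (rule ccontr)
    assume "\<nexists>d. 0 \<le> d \<and> d \<le> 1 \<and> norm (f (of_real x + of_real d)) \<le> 1 + c"
    then have big: "norm (f (of_real t)) > 1 + c" if "t \<in> {x..x+1}" for t
      using that by (auto simp: not_le dest!: spec[of _ "t - x"])
    have "(\<integral>t. (1 + c) * indicator {x..x+1} t \<partial>lborel) \<le> (\<integral>t. norm (f (of_real t)) powr p \<partial>lborel)"
    proof (rule integral_mono)
      fix t
      show "(1 + c) * indicator {x..x+1} t \<le> norm (f (of_real t)) powr p"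
      proof (cases "t \<in> {x..x+1}")
        case True
        then have a: "1 + c < norm (f (of_real t))" using big by blast
        have "norm (f (of_real t)) powr 1 \<le> norm (f (of_real t)) powr p"
          using a c0 p by (intro powr_mono) auto
        then have "1 + c \<le> norm (f (of_real t)) powr p" using a by simp
        then show ?thesis using True by simp
      qed simp
    qed (use int in auto)
    then show False using c by simp
  qed
  have onre: "norm (f (of_real x)) \<le> (1 + c) * (1 + exp pi)" for x
  proof -
    obtain d where d: "0 \<le> d" "d \<le> 1" "norm (f (of_real x + of_real d)) \<le> 1 + c" using small by blast
    have "norm (f (of_real x)) \<le> norm (f (of_real x + of_real d)) + norm (f (of_real x + of_real d) - f (of_real x))"
      using norm_triangle_ineq4[of "f (of_real x + of_real d)" "f (of_real x + of_real d) - f (of_real x)"] by simp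
    also have "\<dots> \<le> (1 + c) + (1 + c) * exp pi" using diff[OF d(1,2)] d(3) by (intro add_mono)
    finally show ?thesis by (simp add: algebra_simps)
  qed
  show ?thesis by (rule exponential_type_bounded_on_real[OF hol ty]) (use onre in auto)
qed

section \<open>The extremal function\<close>

lemma Lp_midpoint_le:
  fixes g h :: "complex \<Rightarrow> complex"
  assumes g: "g holomorphic_on UNIV" and h: "h holomorphic_on UNIV" and p: "p \<ge> 1"
    and ig: "integrable lborel (\<lambda>x. norm (g (of_real x)) powr p)"
    and ih: "integrable lborel (\<lambda>x. norm (h (of_real x)) powr p)"
    and cg: "(\<integral>x. norm (g (of_real x)) powr p \<partial>lborel) \<le> c"
    and ch: "(\<integral>x. norm (h (of_real x)) powr p \<partial>lborel) \<le> c"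
  shows "integrable lborel (\<lambda>x. norm ((g (of_real x) + h (of_real x)) / 2) powr p)"
    and "(\<integral>x. norm ((g (of_real x) + h (of_real x)) / 2) powr p \<partial>lborel) \<le> c"
proof -
  have pw: "norm ((g (of_real x) + h (of_real x)) / 2) powr p
      \<le> (norm (g (of_real x)) powr p + norm (h (of_real x)) powr p) / 2" for x
  proof -
    have "norm ((g (of_real x) + h (of_real x)) / 2) powr p \<le> ((norm (g (of_real x)) + norm (h (of_real x))) / 2) powr p"
      using p by (intro powr_mono2) (auto simp: norm_divide norm_triangle_ineq divide_right_mono)
    also have "\<dots> \<le> (norm (g (of_real x)) powr p + norm (h (of_real x)) powr p) / 2"
      by (rule powr_midpoint_le) (use p in auto)
    finally show ?thesis .
  qed
  have i2: "integrable lborel (\<lambda>x. (norm (g (of_real x)) powr p + norm (h (of_real x)) powr p) / 2)"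
    using ig ih by auto
  have [measurable]: "(\<lambda>x. g (complex_of_real x)) \<in> borel_measurable borel" "(\<lambda>x. h (complex_of_real x)) \<in> borel_measurable borel"
    by (intro measurable_real_axis g h)+
  show i1: "integrable lborel (\<lambda>x. norm ((g (of_real x) + h (of_real x)) / 2) powr p)"
    by (rule Bochner_Integration.integrable_bound[OF i2]) (use pw in auto)
  have "(\<integral>x. norm ((g (of_real x) + h (of_real x)) / 2) powr p \<partial>lborel)
     \<le> (\<integral>x. (norm (g (of_real x)) powr p + norm (h (of_real x)) powr p) / 2 \<partial>lborel)"
    by (rule integral_mono[OF i1 i2 pw])
  also have "\<dots> = ((\<integral>x. norm (g (of_real x)) powr p \<partial>lborel) + (\<integral>x. norm (h (of_real x)) powr p \<partial>lborel)) / 2"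
    using ig ih by simp
  also have "\<dots> \<le> c" using add_mono[OF cg ch] by simp
  finally show "(\<integral>x. norm ((g (of_real x) + h (of_real x)) / 2) powr p \<partial>lborel) \<le> c" .
qed

text \<open>A minimiser of \<open>\<integral>|f|^p\<close> among the functions of the Paley--Wiener space with value \<open>1\<close> at the
  origin, normalised to be even and real on the real line. The smallest constant in the point
  evaluation inequality is \<open>1/c\<close>.\<close>

locale extremal =
  fixes p c :: real and \<phi> :: "complex \<Rightarrow> complex"
  assumes p2: "2 \<le> p"
    and hol: "\<phi> holomorphic_on UNIV"
    and real: "\<phi> (cnj z) = cnj (\<phi> z)"
    and even: "\<phi> (- z) = \<phi> z"
    and at_0: "\<phi> 0 = 1"
    and growth: "\<exists>K. \<forall>z. norm (\<phi> z) \<le> K * exp (pi * \<bar>Im z\<bar>)"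
    and integrable: "integrable lborel (\<lambda>x. norm (\<phi> (of_real x)) powr p)"
    and c_def: "c = (\<integral>x. norm (\<phi> (of_real x)) powr p \<partial>lborel)"
    and minimal: "\<lbrakk>f holomorphic_on UNIV; exponential_type_le f pi; f 0 = 1;
        integrable lborel (\<lambda>x. norm (f (of_real x)) powr p)\<rbrakk>
      \<Longrightarrow> c \<le> (\<integral>x. norm (f (of_real x)) powr p \<partial>lborel)"

text \<open>A minimising sequence is locally bounded, so Montel's theorem gives a limit, and Fatou's lemma shows
  that nothing is lost. Averaging over the reflections \<open>z \<mapsto> - z\<close> and \<open>z \<mapsto> cnj z\<close> does not increase
  the norm because \<open>t powr p\<close> is convex.\<close>

lemma extremal_exists:
  assumes p: "2 \<le> p" and f: "f holomorphic_on UNIV" "exponential_type_le f pi" "f 0 = 1"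
    and fi: "integrable lborel (\<lambda>x. norm (f (of_real x)) powr p)"
  shows "\<exists>c \<phi>. extremal p c \<phi>"
proof -
  have p1: "p \<ge> 1" using p by simp
  define J where "J = (\<lambda>f::complex \<Rightarrow> complex. \<integral>x. norm (f (of_real x)) powr p \<partial>lborel)"
  define adm where "adm = {f. f holomorphic_on UNIV \<and> exponential_type_le f pi \<and> f 0 = 1 \<and>
        integrable lborel (\<lambda>x. norm (f (of_real x)) powr p)}"
  define c where "c = Inf (J ` adm)"
  have bdd: "bdd_below (J ` adm)" by (rule bdd_belowI[of _ 0]) (auto simp: J_def)
  have ne: "J ` adm \<noteq> {}" using f fi by (auto simp: adm_def)
  have min: "c \<le> J f" if "f \<in> adm" for f
    unfolding c_def using that bdd by (auto intro: cInf_lower)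
  have "\<exists>f. f \<in> adm \<and> J f < c + 1 / real (Suc n)" for n
  proof -
    have "Inf (J ` adm) < c + 1 / real (Suc n)" by (simp add: c_def)
    then show ?thesis using cInf_lessD[OF ne] by blast
  qed
  then obtain F where F: "\<And>n. F n \<in> adm" "\<And>n. J (F n) < c + 1 / real (Suc n)" by metis
  define K where "K = (1 + (c + 1)) * (1 + exp pi)"
  have JF: "J (F n) \<le> c + 1" for n
  proof -
    have "1 / real (Suc n) \<le> 1" by simp
    then show ?thesis using F(2)[of n] by linarith
  qed
  have Fb: "norm (F n z) \<le> K * exp (pi * \<bar>Im z\<bar>)" for n z
    unfolding K_def using F(1)[of n] JF[of n] by (intro Nikolskii_bound[OF _ _ p1]) (auto simp: adm_def J_def)
  define fam where "fam = {h. h holomorphic_on UNIV \<and> (\<forall>z. norm (h z) \<le> K * exp (pi * \<bar>Im z\<bar>))}"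
  have K0: "K \<ge> 0" using order_trans[OF norm_ge_zero Fb[of 0 0]] by simp
  obtain g r where g: "g holomorphic_on UNIV" "strict_mono (r :: nat \<Rightarrow> nat)"
      and lim: "\<And>x. (\<lambda>n. F (r n) x) \<longlonglongrightarrow> g x"
  proof (rule Montel[of UNIV fam F])
    show "\<exists>B. \<forall>h\<in>fam. \<forall>z\<in>T. norm (h z) \<le> B" if T: "compact T" for T
    proof -
      obtain R where R: "\<And>z. z \<in> T \<Longrightarrow> norm z \<le> R" using compact_imp_bounded[OF T] by (auto simp: bounded_iff)
      have "norm (h z) \<le> K * exp (pi * R)" if "h \<in> fam" "z \<in> T" for h z
      proof -
        have "K * exp (pi * \<bar>Im z\<bar>) \<le> K * exp (pi * R)"
          using R[OF that(2)] abs_Im_le_cmod[of z] K0 by (intro mult_left_mono) auto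
        moreover have "norm (h z) \<le> K * exp (pi * \<bar>Im z\<bar>)" using that(1) by (simp add: fam_def)
        ultimately show ?thesis by (rule order_trans[rotated])
      qed
      then show ?thesis by blast
    qed
    show "range F \<subseteq> fam" using F Fb by (auto simp: fam_def adm_def)
  qed (auto simp: fam_def)
  have gb: "norm (g z) \<le> K * exp (pi * \<bar>Im z\<bar>)" for z
    by (rule tendsto_upperbound[OF tendsto_norm[OF lim[of z]]]) (auto simp: Fb)
  have g0: "g 0 = 1"
    using lim[of 0] F(1) by (simp add: adm_def LIMSEQ_const_iff)
  have mF[measurable]: "(\<lambda>x. F n (complex_of_real x)) \<in> borel_measurable borel" for n
    using F(1)[of n] by (intro measurable_real_axis) (auto simp: adm_def)
  have mg[measurable]: "(\<lambda>x. g (complex_of_real x)) \<in> borel_measurable borel"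
    by (intro measurable_real_axis g)
  have nnF: "(\<integral>\<^sup>+x. ennreal (norm (F n (of_real x)) powr p) \<partial>lborel) = ennreal (J (F n))" for n
    unfolding J_def using F(1)[of n] by (intro nn_integral_eq_integral) (auto simp: adm_def)
  have "(\<integral>\<^sup>+x. ennreal (norm (g (of_real x)) powr p) \<partial>lborel)
      = (\<integral>\<^sup>+x. liminf (\<lambda>n. ennreal (norm (F (r n) (of_real x)) powr p)) \<partial>lborel)"
  proof (rule nn_integral_cong)
    fix x
    have "(\<lambda>n. ennreal (norm (F (r n) (of_real x)) powr p)) \<longlonglongrightarrow> ennreal (norm (g (of_real x)) powr p)"
      using p by (intro tendsto_ennrealI tendsto_powr2 tendsto_norm lim tendsto_const) auto
    then show "ennreal (norm (g (of_real x)) powr p) = liminf (\<lambda>n. ennreal (norm (F (r n) (of_real x)) powr p))"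
      by (intro lim_imp_Liminf[symmetric]) auto
  qed
  also have "\<dots> \<le> liminf (\<lambda>n. \<integral>\<^sup>+x. ennreal (norm (F (r n) (of_real x)) powr p) \<partial>lborel)"
    by (rule nn_integral_liminf) auto
  also have "\<dots> = liminf (\<lambda>n. ennreal (J (F (r n))))" by (simp add: nnF)
  also have "\<dots> \<le> liminf (\<lambda>n. ennreal (c + 1 / real (Suc n)))"
  proof (rule Liminf_mono, rule always_eventually, rule allI)
    fix n
    have "1 / real (Suc (r n)) \<le> 1 / real (Suc n)" using seq_suble[OF g(2), of n] by (intro divide_left_mono) auto
    then show "ennreal (J (F (r n))) \<le> ennreal (c + 1 / real (Suc n))"
      using F(2)[of "r n"] by (intro ennreal_leI) linarith
  qed
  also have "\<dots> = ennreal c"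
  proof -
    have "(\<lambda>n. c + 1 / real (Suc n)) \<longlonglongrightarrow> c + 0" by (intro tendsto_intros LIMSEQ_Suc lim_1_over_n)
    then have "(\<lambda>n. ennreal (c + 1 / real (Suc n))) \<longlonglongrightarrow> ennreal c" by (intro tendsto_ennrealI) simp
    then show ?thesis by (simp add: lim_imp_Liminf)
  qed
  finally have nng: "(\<integral>\<^sup>+x. ennreal (norm (g (of_real x)) powr p) \<partial>lborel) \<le> ennreal c" .
  have ig: "integrable lborel (\<lambda>x. norm (g (of_real x)) powr p)"
    by (rule integrableI_nonneg) (use nng in \<open>auto simp: less_top[symmetric] top_unique\<close>)
  have c0: "c \<ge> 0" unfolding c_def by (rule cInf_greatest[OF ne]) (auto simp: J_def)
  have Jg: "J g \<le> c"
    using nng c0 unfolding J_def by (subst (asm) nn_integral_eq_integral[OF ig]) auto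
  define g1 where "g1 = (\<lambda>z. (g z + g (- z)) / 2)"
  have h1: "(\<lambda>z. g (- z)) holomorphic_on UNIV"
    by (rule holomorphic_on_UNIV_compose[OF g(1)]) (intro holomorphic_intros)
  have i1: "integrable lborel (\<lambda>x. norm (g (- of_real x)) powr p)"
    using lborel_integrable_real_affine[OF ig, of "-1" 0] by simp
  have J1: "(\<integral>x. norm (g (- of_real x)) powr p \<partial>lborel) = J g"
    unfolding J_def using lborel_integral_real_affine[of "-1" "\<lambda>x. norm (g (of_real x)) powr p" 0] by simp
  have g1h: "g1 holomorphic_on UNIV" unfolding g1_def by (intro holomorphic_intros g(1) h1) auto
  have g1i: "integrable lborel (\<lambda>x. norm (g1 (of_real x)) powr p)" and g1J: "J g1 \<le> c"
    using Lp_midpoint_le[OF g(1) h1 p1 ig i1, of c] Jg J1 unfolding J_def g1_def by simp_all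
  have g1b: "norm (g1 z) \<le> K * exp (pi * \<bar>Im z\<bar>)" for z
    using norm_triangle_ineq[of "g z" "g (-z)"] gb[of z] gb[of "-z"] by (simp add: g1_def norm_divide)
  define \<phi> where "\<phi> = (\<lambda>z. (g1 z + cnj (g1 (cnj z))) / 2)"
  have h2: "(\<lambda>z. cnj (g1 (cnj z))) holomorphic_on UNIV"
    using holomorphic_on_compose_cnj_cnj[of g1 UNIV] holomorphic_on_subset[OF g1h] by (simp add: o_def)
  have \<phi>h: "\<phi> holomorphic_on UNIV" unfolding \<phi>_def by (intro holomorphic_intros g1h h2) auto
  have \<phi>i: "integrable lborel (\<lambda>x. norm (\<phi> (of_real x)) powr p)" and \<phi>J: "J \<phi> \<le> c"
    using Lp_midpoint_le[OF g1h h2 p1 g1i, of c] g1i g1J unfolding J_def \<phi>_def by simp_all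
  have \<phi>b: "norm (\<phi> z) \<le> K * exp (pi * \<bar>Im z\<bar>)" for z
    using norm_triangle_ineq[of "g1 z" "cnj (g1 (cnj z))"] g1b[of z] g1b[of "cnj z"] by (simp add: \<phi>_def norm_divide)
  have \<phi>0: "\<phi> 0 = 1" by (simp add: \<phi>_def g1_def g0)
  have "\<phi> \<in> adm" using \<phi>h \<phi>0 \<phi>i exponential_type_leI[OF \<phi>b] by (simp add: adm_def)
  then have cJ: "c = J \<phi>" using min \<phi>J by force
  have "extremal p c \<phi>"
  proof
    show "\<phi> (cnj z) = cnj (\<phi> z)" for z by (simp add: \<phi>_def add.commute)
    show "\<phi> (- z) = \<phi> z" for z by (simp add: \<phi>_def g1_def add.commute)
    show "c \<le> (\<integral>x. norm (f (of_real x)) powr p \<partial>lborel)"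
      if "f holomorphic_on UNIV" "exponential_type_le f pi" "f 0 = 1"
        "integrable lborel (\<lambda>x. norm (f (of_real x)) powr p)" for f
      using min[of f] that by (simp add: adm_def J_def)
  qed (use p \<phi>h \<phi>0 \<phi>i \<phi>b cJ in \<open>auto simp: J_def\<close>)
  then show ?thesis by blast
qed

section \<open>Cauchy's formula in the upper half-plane\<close>

lemma integrable_inverse_1_plus_sq: "integrable lborel (\<lambda>x::real. 1 / (1 + x\<^sup>2))"
  using integrable_inverse_1_plus_square unfolding set_integrable_def
  unfolding inverse_eq_divide by simp

lemma contour_integral_horizontal:
  assumes c: "continuous_on (closed_segment (Complex (-R) e) (Complex R e)) f" and R: "R > 0"
  shows "contour_integral (linepath (Complex (-R) e) (Complex R e)) f = integral {-R..R} (\<lambda>x. f (Complex x e))"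
    and "(\<lambda>x. f (Complex x e)) integrable_on {-R..R}"
proof -
  define I where "I = contour_integral (linepath (Complex (-R) e) (Complex R e)) f"
  have "(f has_contour_integral I) (linepath (Complex (-R) e) (Complex R e))"
    unfolding I_def by (intro has_contour_integral_integral contour_integrable_continuous_linepath c)
  then have "((\<lambda>t. f (linepath (Complex (-R) e) (Complex R e) t) * (Complex R e - Complex (-R) e)) has_integral I) {0..1}"
    by (subst (asm) has_contour_integral_linepath)
  moreover have "Complex R e - Complex (-R) e = of_real (2 * R)" by (simp add: complex_eq_iff)
  moreover have "linepath (Complex (-R) e) (Complex R e) t = Complex (2 * R * t - R) e" for t
    by (simp add: linepath_def complex_eq_iff algebra_simps)
  ultimately have "((\<lambda>t. f (Complex (2 * R * t - R) e) * of_real (2 * R)) has_integral I) {0..1}" by simp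
  then have H: "((\<lambda>t. f (Complex (2 * R * t - R) e) * of_real (2 * R) * of_real (1 / (2 * R))) has_integral I * of_real (1 / (2*R))) {0..1}"
    by (rule has_integral_mult_left)
  have e1: "(\<lambda>t. f (Complex (2 * R * t - R) e) * of_real (2 * R) * of_real (1 / (2 * R))) = (\<lambda>t. f (Complex ((2 * R) *\<^sub>R t + (- R)) e))"
    using R by (auto simp: fun_eq_iff)
  have e2: "I * of_real (1 / (2*R)) = I /\<^sub>R (2*R) ^ DIM(real)"
    unfolding scaleR_conv_of_real by (simp add: field_simps)
  have I': "((\<lambda>t. f (Complex ((2 * R) *\<^sub>R t + (- R)) e)) has_integral I /\<^sub>R (2*R) ^ DIM(real)) {0..1}"
    using H unfolding e1 e2 .
  have box: "cbox ((- R - - R) /\<^sub>R (2*R)) ((R - - R) /\<^sub>R (2*R)) = {0..1}"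
    using R by simp
  have fin: "((\<lambda>x. f (Complex x e)) has_integral I) {-R..R}"
    using has_integral_affinity_iff[where m="2*R" and c="-R" and a="-R" and b=R and f="\<lambda>x. f (Complex x e)" and I=I] R I'
    unfolding box by simp
  show "contour_integral (linepath (Complex (-R) e) (Complex R e)) f = integral {-R..R} (\<lambda>x. f (Complex x e))"
    unfolding I_def[symmetric] by (rule integral_unique[OF fin, symmetric])
  show "(\<lambda>x. f (Complex x e)) integrable_on {-R..R}"
    by (rule has_integral_integrable[OF fin])
qed

text \<open>One majorant for all horizontal lines whose distance to \<open>w\<close> is at least \<open>d\<close>; it serves both for
  the passage to infinite rectangles and for the passage to the real line.\<close>

lemma Cauchy_kernel_bound:
  fixes w :: complex and d x e C :: real
  assumes d: "0 < d" "d \<le> \<bar>e - Im w\<bar>" and C: "C \<ge> 0"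
    and g: "norm g \<le> C / (1 + \<bar>x\<bar>)"
  shows "norm (g / (Complex x e - w)) \<le> C * ((1 + \<bar>Re w\<bar>) / d + 1) / (1 + x\<^sup>2)"
proof -
  define k where "k = (1 + \<bar>Re w\<bar>) / d + 1"
  have k: "k > 0" unfolding k_def using d by (intro add_nonneg_pos divide_nonneg_pos) auto
  have a: "\<bar>x - Re w\<bar> \<le> norm (Complex x e - w)" using abs_Re_le_cmod[of "Complex x e - w"] by simp
  have b: "d \<le> norm (Complex x e - w)" using abs_Im_le_cmod[of "Complex x e - w"] d by simp
  have "1 + \<bar>x\<bar> \<le> (1 + \<bar>Re w\<bar>) * 1 + \<bar>x - Re w\<bar>" unfolding mult_1_right by linarith
  also have "\<dots> \<le> (1 + \<bar>Re w\<bar>) * (norm (Complex x e - w) / d) + norm (Complex x e - w)"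
    using a b d by (intro add_mono mult_left_mono) auto
  also have "\<dots> = k * norm (Complex x e - w)" by (simp add: k_def algebra_simps)
  finally have c: "1 + \<bar>x\<bar> \<le> k * norm (Complex x e - w)" .
  have n0: "norm (Complex x e - w) > 0" using b d by linarith
  have "norm (g / (Complex x e - w)) = norm g / norm (Complex x e - w)" by (simp add: norm_divide)
  also have "\<dots> \<le> (C / (1 + \<bar>x\<bar>)) / ((1 + \<bar>x\<bar>) / k)"
  proof (rule frac_le)
    show "(1 + \<bar>x\<bar>) / k \<le> norm (Complex x e - w)" using c k by (simp add: divide_le_eq mult.commute)
  qed (use g C k in auto)
  also have "\<dots> = C * k / (1 + \<bar>x\<bar>)\<^sup>2" by (simp add: power2_eq_square)
  also have "\<dots> \<le> C * k / (1 + x\<^sup>2)"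
  proof (rule divide_left_mono)
    show "1 + x\<^sup>2 \<le> (1 + \<bar>x\<bar>)\<^sup>2" by (simp add: power2_sum)
    show "0 < (1 + \<bar>x\<bar>)\<^sup>2 * (1 + x\<^sup>2)" by (intro mult_pos_pos zero_less_power add_pos_nonneg) auto
  qed (use C k in auto)
  finally show ?thesis by (simp add: k_def)
qed

lemma Cauchy_formula_horizontal_line:
  fixes G :: "complex \<Rightarrow> complex"
  assumes hol: "G holomorphic_on {z. Im z > 0}"
    and b: "\<And>z. Im z > 0 \<Longrightarrow> norm (G z) \<le> C / (1 + norm z)"
    and e: "0 < e" "e < Im w"
  shows "integrable lborel (\<lambda>x. G (Complex x e) / (Complex x e - w))"
    and "(\<integral>x. G (Complex x e) / (Complex x e - w) \<partial>lborel) = 2 * pi * \<i> * G w"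
proof -
  define h where "h = (\<lambda>z. G z / (z - w))"
  define d where "d = Im w - e"
  have d: "d > 0" using e by (simp add: d_def)
  have C0: "C \<ge> 0"
  proof -
    have "0 \<le> C / (1 + norm \<i>)" by (rule order_trans[OF norm_ge_zero b]) auto
    then show ?thesis by simp
  qed
  define k where "k = C * ((1 + \<bar>Re w\<bar>) / d + 1)"
  have op: "open {z. Im z > 0}" by (intro open_Collect_less continuous_intros)
  have contG: "continuous_on {z. Im z > 0} G" by (rule holomorphic_on_imp_continuous_on[OF hol])
  have conth: "continuous_on {z. Im z > 0 \<and> z \<noteq> w} h" unfolding h_def
    by (intro continuous_intros continuous_on_subset[OF contG]) auto
  have contl: "continuous_on UNIV (\<lambda>x. h (Complex x e))"
    by (rule continuous_on_compose2[OF conth]) (use e in \<open>auto intro!: continuous_intros simp: Complex_eq\<close>)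
  have hb: "norm (h (Complex x e)) \<le> k * (1 / (1 + x\<^sup>2))" for x
  proof -
    have "norm (G (Complex x e)) \<le> C / (1 + norm (Complex x e))" using b e by simp
    also have "\<dots> \<le> C / (1 + \<bar>x\<bar>)"
      using abs_Re_le_cmod[of "Complex x e"] C0 by (intro divide_left_mono) (auto intro!: mult_pos_pos add_pos_nonneg)
    finally have "norm (h (Complex x e)) \<le> C * ((1 + \<bar>Re w\<bar>) / d + 1) / (1 + x\<^sup>2)"
      unfolding h_def by (intro Cauchy_kernel_bound) (use d C0 in \<open>auto simp: d_def\<close>)
    then show ?thesis by (simp add: k_def)
  qed
  have meas: "(\<lambda>x. h (Complex x e)) \<in> borel_measurable lborel"
    using borel_measurable_continuous_onI[OF contl] by simp
  have dom: "integrable lborel (\<lambda>x. k * (1 / (1 + x\<^sup>2)) :: real)" by (intro integrable_mult_right integrable_inverse_1_plus_sq)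
  show inth: "integrable lborel (\<lambda>x. G (Complex x e) / (Complex x e - w))"
  proof (rule Bochner_Integration.integrable_bound[OF dom])
    show "AE x in lborel. norm (G (Complex x e) / (Complex x e - w)) \<le> norm (k * (1 / (1 + x\<^sup>2)))"
      using hb unfolding h_def real_norm_def by (intro AE_I2 order_trans[OF _ abs_ge_self]) blast
  qed (use meas in \<open>simp add: h_def\<close>)
  have trunc: "norm (integral {-R..R} (\<lambda>x. h (Complex x e)) - 2 * pi * \<i> * G w) \<le> 4 * C / (R - norm w)"
    if R: "R > norm w + 1" for R
  proof -
    have R0: "R > 0" "norm w < R" "R > 1" using R norm_ge_zero[of w] by linarith+
    define a1 a2 a3 a4 where "a1 = Complex (-R) e" "a2 = Complex R e" "a3 = Complex R (e + R)" "a4 = Complex (-R) (e + R)"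
    have wbox: "w \<in> box a1 a3"
      using R0 e abs_Re_le_cmod[of w] abs_Im_le_cmod[of w] by (auto simp: in_box_complex_iff a1_a2_a3_a4_def)
    have img: "path_image (rectpath a1 a3) \<subseteq> {z. Im z > 0} - {w}"
    proof -
      have "path_image (rectpath a1 a3) \<subseteq> cbox a1 a3"
        by (rule path_image_rectpath_subset_cbox) (use R0 in \<open>auto simp: a1_a2_a3_a4_def\<close>)
      moreover have "w \<notin> path_image (rectpath a1 a3)"
        using path_image_rectpath_inter_box[of a1 a3] wbox R0 by (auto simp: a1_a2_a3_a4_def)
      ultimately show ?thesis using e by (auto simp: in_cbox_complex_iff a1_a2_a3_a4_def)
    qed
    have w0: "Im w > 0" using e by simp
    have "(h has_contour_integral (2 * pi * \<i> * winding_number (rectpath a1 a3) w * G w)) (rectpath a1 a3)"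
      unfolding h_def
      by (rule Cauchy_integral_formula_convex_simple[OF convex_halfspace_Im_gt hol])
         (use img w0 op in \<open>auto simp: interior_open\<close>)
    then have CI: "(h has_contour_integral (2 * pi * \<i> * G w)) (rectpath a1 a3)"
      using winding_number_rectpath[OF wbox] by simp
    have rp: "rectpath a1 a3 = linepath a1 a2 +++ linepath a2 a3 +++ linepath a3 a4 +++ linepath a4 a1"
      by (simp add: rectpath_def Let_def a1_a2_a3_a4_def)
    have pim: "path_image (rectpath a1 a3) = closed_segment a1 a2 \<union> closed_segment a2 a3 \<union> closed_segment a3 a4 \<union> closed_segment a4 a1"
      unfolding rp by (simp add: path_image_join Un_assoc)
    have segs: "continuous_on (closed_segment a1 a2) h" "continuous_on (closed_segment a2 a3) h"
       "continuous_on (closed_segment a3 a4) h" "continuous_on (closed_segment a4 a1) h"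
      by (rule continuous_on_subset[OF conth]; use img pim in auto)+
    have ci: "h contour_integrable_on linepath a1 a2" "h contour_integrable_on linepath a2 a3"
       "h contour_integrable_on linepath a3 a4" "h contour_integrable_on linepath a4 a1"
      using segs by (auto intro: contour_integrable_continuous_linepath)
    have sum: "contour_integral (linepath a1 a2) h + (contour_integral (linepath a2 a3) h +
        (contour_integral (linepath a3 a4) h + contour_integral (linepath a4 a1) h)) = 2 * pi * \<i> * G w"
      using contour_integral_unique[OF CI] ci unfolding rp
      by (simp add: contour_integrable_joinI)
    have hor: "contour_integral (linepath a1 a2) h = integral {-R..R} (\<lambda>x. h (Complex x e))"
      using contour_integral_horizontal[of R e h] segs(1) R0 by (simp add: a1_a2_a3_a4_def)
    have far: "norm (h z) \<le> C / R / (R - norm w)" if z: "norm z \<ge> R" "Im z > 0" for z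
    proof -
      have "norm (G z) \<le> C / (1 + norm z)" by (rule b[OF z(2)])
      also have "\<dots> \<le> C / R" using z R0 C0 by (intro divide_left_mono) (auto intro!: mult_pos_pos add_pos_nonneg)
      finally have 1: "norm (G z) \<le> C / R" .
      have 2: "R - norm w \<le> norm (z - w)" using norm_triangle_ineq2[of z w] z by linarith
      show ?thesis unfolding h_def norm_divide using 1 2 R0 C0 by (intro frac_le) auto
    qed
    have B0: "0 \<le> C / R / (R - norm w)" using C0 R0 by simp
    have n23: "norm (contour_integral (linepath a2 a3) h) \<le> C / R / (R - norm w) * norm (a3 - a2)"
    proof (rule contour_integral_bound_linepath[OF ci(2) B0])
      fix z assume "z \<in> closed_segment a2 a3"
      then have "Re z = R" "Im z \<in> {e..e+R}" using R0
        by (auto simp: a1_a2_a3_a4_def closed_segment_same_Re closed_segment_eq_real_ivl)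
      then show "norm (h z) \<le> C / R / (R - norm w)"
        using abs_Re_le_cmod[of z] e R0 by (intro far) auto
    qed
    have n34: "norm (contour_integral (linepath a3 a4) h) \<le> C / R / (R - norm w) * norm (a4 - a3)"
    proof (rule contour_integral_bound_linepath[OF ci(3) B0])
      fix z assume "z \<in> closed_segment a3 a4"
      then have "Im z = e + R" using R0
        by (auto simp: a1_a2_a3_a4_def closed_segment_same_Im)
      then show "norm (h z) \<le> C / R / (R - norm w)"
        using abs_Im_le_cmod[of z] e R0 by (intro far) auto
    qed
    have n41: "norm (contour_integral (linepath a4 a1) h) \<le> C / R / (R - norm w) * norm (a1 - a4)"
    proof (rule contour_integral_bound_linepath[OF ci(4) B0])
      fix z assume "z \<in> closed_segment a4 a1"
      then have "Re z = -R" "Im z \<in> {e..e+R}" using R0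
        by (auto simp: a1_a2_a3_a4_def closed_segment_same_Re closed_segment_eq_real_ivl)
      then show "norm (h z) \<le> C / R / (R - norm w)"
        using abs_Re_le_cmod[of z] e R0 by (intro far) auto
    qed
    have "a3 - a2 = \<i> * of_real R" "a4 - a3 = of_real (- (2 * R))" "a1 - a4 = \<i> * of_real (- R)"
      by (simp_all add: a1_a2_a3_a4_def complex_eq_iff)
    then have l: "norm (a3 - a2) = R" "norm (a4 - a3) = 2 * R" "norm (a1 - a4) = R"
      using R0 by (simp_all only: norm_mult norm_of_real norm_ii)
    have "integral {-R..R} (\<lambda>x. h (Complex x e)) - 2 * pi * \<i> * G w
        = - (contour_integral (linepath a2 a3) h + (contour_integral (linepath a3 a4) h + contour_integral (linepath a4 a1) h))"
      using sum hor by (simp add: algebra_simps)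
    then have "norm (integral {-R..R} (\<lambda>x. h (Complex x e)) - 2 * pi * \<i> * G w)
      \<le> norm (contour_integral (linepath a2 a3) h) + (norm (contour_integral (linepath a3 a4) h) + norm (contour_integral (linepath a4 a1) h))"
      by (simp only: norm_minus_cancel) (rule order_trans[OF norm_triangle_ineq add_left_mono[OF norm_triangle_ineq]])
    also have "\<dots> \<le> C / R / (R - norm w) * R + (C / R / (R - norm w) * (2 * R) + C / R / (R - norm w) * R)"
      using n23 n34 n41 unfolding l by (intro add_mono)
    also have "\<dots> = 4 * (C / R / (R - norm w) * R)" by algebra
    also have "C / R / (R - norm w) * R = C / (R - norm w)" using R0 by simp
    also have "4 * (C / (R - norm w)) = 4 * C / (R - norm w)" by simp
    finally show ?thesis .
  qed
  have lim1: "(\<lambda>n. integral {- real n..real n} (\<lambda>x. h (Complex x e))) \<longlonglongrightarrow> 2 * pi * \<i> * G w"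
  proof (rule Lim_null_comparison[THEN LIM_zero_cancel])
    have "(\<lambda>n. 1 / (real n - norm w)) \<longlonglongrightarrow> 0" by real_asymp
    from tendsto_mult_right_zero[OF this, of "4 * C"]
    show "(\<lambda>n. 4 * C / (real n - norm w)) \<longlonglongrightarrow> 0" by simp
    show "\<forall>\<^sub>F n in sequentially. norm (integral {- real n..real n} (\<lambda>x. h (Complex x e)) - 2 * pi * \<i> * G w) \<le> 4 * C / (real n - norm w)"
      using eventually_gt_at_top[of "nat \<lceil>norm w + 1\<rceil>"]
      by eventually_elim (rule trunc, linarith)
  qed
  have lim2: "(\<lambda>n. \<integral>x. indicator {- real n..real n} x *\<^sub>R h (Complex x e) \<partial>lborel) \<longlonglongrightarrow> (\<integral>x. h (Complex x e) \<partial>lborel)"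
  proof (rule integral_dominated_convergence[OF meas _ dom])
    show "AE x in lborel. (\<lambda>n. indicat_real {- real n..real n} x *\<^sub>R h (Complex x e)) \<longlonglongrightarrow> h (Complex x e)"
    proof (rule AE_I2, rule tendsto_eventually)
      fix x :: real
      show "\<forall>\<^sub>F n in sequentially. indicat_real {- real n..real n} x *\<^sub>R h (Complex x e) = h (Complex x e)"
        using eventually_ge_at_top[of "nat \<lceil>\<bar>x\<bar>\<rceil>"] 
      proof eventually_elim
        case (elim n)
        then have "x \<in> {- real n..real n}" by (simp add: nat_le_iff) linarith
        then show ?case by simp
      qed
    qed
    show "AE x in lborel. norm (indicat_real {- real n..real n} x *\<^sub>R h (Complex x e)) \<le> k * (1 / (1 + x\<^sup>2))" for n
      by (intro AE_I2 order_trans[OF _ hb]) (simp add: indicator_def)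
  qed (use meas in auto)
  have eq: "(\<integral>x. indicator {- real n..real n} x *\<^sub>R h (Complex x e) \<partial>lborel) = integral {- real n..real n} (\<lambda>x. h (Complex x e))" for n
    using set_borel_integral_eq_integral(2)[OF borel_integrable_atLeastAtMost'[OF continuous_on_subset[OF contl subset_UNIV]]]
    by (simp add: set_lebesgue_integral_def)
  have "(\<integral>x. h (Complex x e) \<partial>lborel) = 2 * pi * \<i> * G w"
    by (rule LIMSEQ_unique[OF lim2[unfolded eq] lim1])
  then show "(\<integral>x. G (Complex x e) / (Complex x e - w) \<partial>lborel) = 2 * pi * \<i> * G w"
    by (simp add: h_def)
qed

text \<open>Limits along almost all vertical lines suffice, by dominated convergence. This allows
  boundary values whose phase is only known outside a null set.\<close>

lemma Cauchy_formula_boundary: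
  fixes G :: "complex \<Rightarrow> complex" and g :: "real \<Rightarrow> complex"
  assumes hol: "G holomorphic_on {z. Im z > 0}"
    and b: "\<And>z. Im z > 0 \<Longrightarrow> norm (G z) \<le> C / (1 + norm z)"
    and lim: "AE x in lborel. ((\<lambda>e. G (Complex x e)) \<longlongrightarrow> g x) (at_right 0)"
    and meas[measurable]: "g \<in> borel_measurable borel"
    and w: "Im w > 0"
  shows "(\<integral>x. g x / (of_real x - w) \<partial>lborel) = 2 * pi * \<i> * G w"
proof -
  define E where "E = (\<lambda>n::nat. Im w / 2 / real (Suc n))"
  define d where "d = Im w / 2"
  have d: "d > 0" using w by (simp add: d_def)
  have C0: "C \<ge> 0"
  proof -
    have "0 \<le> C / (1 + norm \<i>)" by (rule order_trans[OF norm_ge_zero b]) auto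
    then show ?thesis by simp
  qed
  have E: "E n > 0" "E n \<le> Im w / 2" for n using w by (auto simp: E_def divide_le_eq mult_le_cancel_left1)
  have E0: "E \<longlonglongrightarrow> 0" unfolding E_def
    using tendsto_mult_right_zero[OF LIMSEQ_Suc[OF lim_1_over_n], of "Im w / 2"] by simp
  have Er: "filterlim E (at_right 0) sequentially"
    using E0 E(1) by (auto simp: filterlim_at intro!: always_eventually less_imp_neq[THEN not_sym])
  define k where "k = C * ((1 + \<bar>Re w\<bar>) / d + 1)"
  have eq: "(\<integral>x. G (Complex x (E n)) / (Complex x (E n) - w) \<partial>lborel) = 2 * pi * \<i> * G w" for n
    using E[of n] w by (intro Cauchy_formula_horizontal_line(2)[OF hol b]) auto
  have int: "integrable lborel (\<lambda>x. G (Complex x (E n)) / (Complex x (E n) - w))" for n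
    using E[of n] w by (intro Cauchy_formula_horizontal_line(1)[OF hol b]) auto
  have "(\<lambda>n. \<integral>x. G (Complex x (E n)) / (Complex x (E n) - w) \<partial>lborel) \<longlonglongrightarrow> (\<integral>x. g x / (of_real x - w) \<partial>lborel)"
  proof (rule integral_dominated_convergence[where w="\<lambda>x. k * (1 / (1 + x\<^sup>2))"])
    show "AE x in lborel. (\<lambda>n. G (Complex x (E n)) / (Complex x (E n) - w)) \<longlonglongrightarrow> g x / (of_real x - w)"
      using lim
    proof eventually_elim
      case (elim x)
      have "(\<lambda>n. G (Complex x (E n))) \<longlonglongrightarrow> g x" by (rule filterlim_compose[OF elim Er])
      moreover have "(\<lambda>n. Complex x (E n)) \<longlonglongrightarrow> Complex x 0" by (intro tendsto_intros E0)
      ultimately show ?case using w by (intro tendsto_intros) (auto simp: Complex_eq complex_eq_iff)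
    qed
    show "AE x in lborel. norm (G (Complex x (E n)) / (Complex x (E n) - w)) \<le> k * (1 / (1 + x\<^sup>2))" for n
    proof (rule AE_I2)
      fix x
      have "norm (G (Complex x (E n))) \<le> C / (1 + norm (Complex x (E n)))" using b E by simp
      also have "\<dots> \<le> C / (1 + \<bar>x\<bar>)"
        using abs_Re_le_cmod[of "Complex x (E n)"] C0 by (intro divide_left_mono) (auto intro!: mult_pos_pos add_pos_nonneg)
      finally have "norm (G (Complex x (E n)) / (Complex x (E n) - w)) \<le> C * ((1 + \<bar>Re w\<bar>) / d + 1) / (1 + x\<^sup>2)"
        by (intro Cauchy_kernel_bound) (use d C0 E[of n] w in \<open>auto simp: d_def\<close>)
      then show "norm (G (Complex x (E n)) / (Complex x (E n) - w)) \<le> k * (1 / (1 + x\<^sup>2))" by (simp add: k_def)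
    qed
    show "integrable lborel (\<lambda>x. k * (1 / (1 + x\<^sup>2)) :: real)" by (intro integrable_mult_right integrable_inverse_1_plus_sq)
    show "(\<lambda>x. G (Complex x (E n)) / (Complex x (E n) - w)) \<in> borel_measurable lborel" for n
      using int borel_measurable_integrable by blast
  qed simp
  then show ?thesis unfolding eq by (simp add: LIMSEQ_const_iff)
qed

section \<open>Orthogonality to odd functions of the cosine\<close>

text \<open>Entire functions of exponential type \<open>pi\<close> that decay on the real line like \<open>|x| ^ (- k)\<close>. The
  estimate is imposed on the whole plane, so that dividing out a zero raises \<open>k\<close> by one.\<close>

definition PW_decay :: "nat \<Rightarrow> (complex \<Rightarrow> complex) \<Rightarrow> bool" where
  "PW_decay k f \<longleftrightarrow> f holomorphic_on UNIV \<and>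
     (\<exists>C. \<forall>z. norm (f z) * (1 + norm z) ^ k \<le> C * exp (pi * \<bar>Im z\<bar>))"

lemma PW_decay_holomorphic: "PW_decay k f \<Longrightarrow> f holomorphic_on UNIV"
  by (simp add: PW_decay_def)

lemma PW_decayE:
  assumes "PW_decay k f"
  obtains C where "C \<ge> 0" "\<And>z. norm (f z) * (1 + norm z) ^ k \<le> C * exp (pi * \<bar>Im z\<bar>)"
proof -
  obtain C where C: "\<And>z. norm (f z) * (1 + norm z) ^ k \<le> C * exp (pi * \<bar>Im z\<bar>)"
    using assms by (auto simp: PW_decay_def)
  have "0 \<le> norm (f 0) * (1 + norm (0::complex)) ^ k" by simp
  also have "\<dots> \<le> C" using C[of 0] by simp
  finally show ?thesis using C that by blast
qed

lemma PW_decay_divide: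
  assumes f: "PW_decay k f" and a: "f a = 0"
  obtains g where "PW_decay (Suc k) g" "\<And>z. f z = (z - a) * g z"
proof -
  obtain C where C: "C \<ge> 0" "\<And>z. norm (f z) * (1 + norm z) ^ k \<le> C * exp (pi * \<bar>Im z\<bar>)"
    using PW_decayE[OF f] by blast
  define g where "g = (\<lambda>z. if z = a then deriv f a else (f z - f a) / (z - a))"
  have hg: "g holomorphic_on UNIV" unfolding g_def
    by (rule pole_lemma_open[OF PW_decay_holomorphic[OF f] open_UNIV])
  have fg: "f z = (z - a) * g z" for z by (simp add: g_def a)
  have "continuous_on (cball a 1) (\<lambda>z. norm (g z) * (1 + norm z) ^ Suc k)"
    by (intro continuous_intros holomorphic_on_imp_continuous_on[OF holomorphic_on_subset[OF hg]]) auto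
  then have "bounded ((\<lambda>z. norm (g z) * (1 + norm z) ^ Suc k) ` cball a 1)"
    by (intro compact_imp_bounded compact_continuous_image) auto
  then obtain B where B': "\<forall>y\<in>(\<lambda>z. norm (g z) * (1 + norm z) ^ Suc k) ` cball a 1. norm y \<le> B"
    unfolding bounded_iff by blast
  have B: "\<bar>norm (g z) * (1 + norm z) ^ Suc k\<bar> \<le> B" if "z \<in> cball a 1" for z
    using bspec[OF B' imageI[OF that]] unfolding real_norm_def .
  have B0: "B \<ge> 0" by (rule order_trans[OF abs_ge_zero B[of a]]) simp
  have "norm (g z) * (1 + norm z) ^ Suc k \<le> (C * (2 + norm a) + B) * exp (pi * \<bar>Im z\<bar>)" for z
  proof (cases "z \<in> cball a 1")
    case True
    have "norm (g z) * (1 + norm z) ^ Suc k \<le> B * 1" using B[OF True] by simp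
    also have "\<dots> \<le> (C * (2 + norm a) + B) * exp (pi * \<bar>Im z\<bar>)"
      using C(1) B0 by (intro mult_mono) auto
    finally show ?thesis .
  next
    case False
    then have 1: "norm (z - a) > 1" by (simp add: dist_norm norm_minus_commute)
    have "1 + norm z \<le> 1 + norm a + norm (z - a)" using norm_triangle_ineq[of a "z - a"] by simp
    also have "\<dots> \<le> (1 + norm a) * norm (z - a) + norm (z - a)"
      using mult_left_mono[of 1 "norm (z - a)" "1 + norm a"] 1 by simp
    also have "\<dots> = (2 + norm a) * norm (z - a)" by (simp add: algebra_simps)
    finally have le: "1 + norm z \<le> (2 + norm a) * norm (z - a)" .
    have "norm (g z) * (1 + norm z) ^ Suc k = norm (g z) * (1 + norm z) ^ k * (1 + norm z)" by simp
    also have "\<dots> \<le> norm (g z) * (1 + norm z) ^ k * ((2 + norm a) * norm (z - a))"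
      using le by (intro mult_left_mono) auto
    also have "\<dots> = (norm (f z) * (1 + norm z) ^ k) * (2 + norm a)"
      by (simp add: fg[of z] norm_mult mult_ac)
    also have "\<dots> \<le> (C * exp (pi * \<bar>Im z\<bar>)) * (2 + norm a)"
      using C(2) by (intro mult_right_mono) auto
    also have "\<dots> = (C * (2 + norm a)) * exp (pi * \<bar>Im z\<bar>)" by simp
    also have "\<dots> \<le> (C * (2 + norm a) + B) * exp (pi * \<bar>Im z\<bar>)" using B0 by (intro mult_right_mono) auto
    finally show ?thesis .
  qed
  then have "PW_decay (Suc k) g" using hg unfolding PW_decay_def by blast
  then show ?thesis using fg that by blast
qed

lemma PW_decay_times_ident:
  assumes "PW_decay (Suc k) f"
  shows "PW_decay k (\<lambda>z. z * f z)"
proof -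
  obtain C where C: "C \<ge> 0" "\<And>z. norm (f z) * (1 + norm z) ^ Suc k \<le> C * exp (pi * \<bar>Im z\<bar>)"
    using PW_decayE[OF assms] by blast
  have "norm (z * f z) * (1 + norm z) ^ k \<le> C * exp (pi * \<bar>Im z\<bar>)" for z
  proof -
    have "norm z * (norm (f z) * (1 + norm z) ^ k) \<le> (1 + norm z) * (norm (f z) * (1 + norm z) ^ k)"
      by (intro mult_right_mono) auto
    then show ?thesis using C(2)[of z] by (simp add: norm_mult mult_ac)
  qed
  then show ?thesis unfolding PW_decay_def
    using PW_decay_holomorphic[OF assms] by (auto intro!: holomorphic_intros)
qed

lemma PW_decay_diff:
  assumes "PW_decay k f" "PW_decay k g"
  shows "PW_decay k (\<lambda>z. f z - g z)"
proof -
  obtain C where C: "C \<ge> 0" "\<And>z. norm (f z) * (1 + norm z) ^ k \<le> C * exp (pi * \<bar>Im z\<bar>)"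
    using PW_decayE[OF assms(1)] by blast
  obtain D where D: "D \<ge> 0" "\<And>z. norm (g z) * (1 + norm z) ^ k \<le> D * exp (pi * \<bar>Im z\<bar>)"
    using PW_decayE[OF assms(2)] by blast
  have "norm (f z - g z) * (1 + norm z) ^ k \<le> (C + D) * exp (pi * \<bar>Im z\<bar>)" for z
  proof -
    have "norm (f z - g z) * (1 + norm z) ^ k \<le> (norm (f z) + norm (g z)) * (1 + norm z) ^ k"
      by (intro mult_right_mono norm_triangle_ineq4) auto
    then show ?thesis using C(2)[of z] D(2)[of z] by (simp add: algebra_simps)
  qed
  then show ?thesis unfolding PW_decay_def
    using PW_decay_holomorphic[OF assms(1)] PW_decay_holomorphic[OF assms(2)] by (auto intro!: holomorphic_intros)
qed

lemma PW_decay_cmult: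
  assumes "PW_decay k f"
  shows "PW_decay k (\<lambda>z. b * f z)"
proof -
  obtain C where C: "C \<ge> 0" "\<And>z. norm (f z) * (1 + norm z) ^ k \<le> C * exp (pi * \<bar>Im z\<bar>)"
    using PW_decayE[OF assms] by blast
  have "norm (b * f z) * (1 + norm z) ^ k \<le> (norm b * C) * exp (pi * \<bar>Im z\<bar>)" for z
    using mult_left_mono[OF C(2)[of z] norm_ge_zero[of b]] by (simp add: norm_mult mult_ac)
  then show ?thesis unfolding PW_decay_def
    using PW_decay_holomorphic[OF assms] by (auto intro!: holomorphic_intros)
qed

lemma PW_decay_reflect:
  assumes "PW_decay k f"
  shows "PW_decay k (\<lambda>z. f (- z))"
proof -
  obtain C where C: "C \<ge> 0" "\<And>z. norm (f z) * (1 + norm z) ^ k \<le> C * exp (pi * \<bar>Im z\<bar>)"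
    using PW_decayE[OF assms] by blast
  have "norm (f (- z)) * (1 + norm z) ^ k \<le> C * exp (pi * \<bar>Im z\<bar>)" for z
    using C(2)[of "-z"] by simp
  moreover have "(\<lambda>z. f (- z)) holomorphic_on UNIV"
    by (rule holomorphic_on_UNIV_compose[OF PW_decay_holomorphic[OF assms]]) (intro holomorphic_intros)
  ultimately show ?thesis unfolding PW_decay_def by blast
qed

lemma norm_cos_pi_le: "norm (cos (of_real pi * z)) \<le> exp (pi * \<bar>Im z\<bar>)"
proof -
  have "norm (cos (of_real pi * z)) = norm (exp (\<i> * (of_real pi * z)) + exp (- (\<i> * (of_real pi * z)))) / 2"
    by (simp add: cos_exp_eq norm_divide)
  also have "\<dots> \<le> (exp (- (pi * Im z)) + exp (pi * Im z)) / 2"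
    by (intro divide_right_mono order_trans[OF norm_triangle_ineq]) auto
  also have "\<dots> \<le> (exp (pi * \<bar>Im z\<bar>) + exp (pi * \<bar>Im z\<bar>)) / 2"
    by (intro divide_right_mono add_mono) (auto simp: abs_if)
  finally show ?thesis by simp
qed

lemma PW_decay_cos: "PW_decay 0 (\<lambda>z. cos (of_real pi * z))"
  unfolding PW_decay_def using norm_cos_pi_le
  by (auto intro!: holomorphic_intros exI[of _ 1])

lemma PW_decay_exponential_type:
  assumes "PW_decay k f"
  shows "exponential_type_le f pi"
proof -
  obtain C where C: "C \<ge> 0" "\<And>z. norm (f z) * (1 + norm z) ^ k \<le> C * exp (pi * \<bar>Im z\<bar>)"
    using PW_decayE[OF assms] by blast
  have "norm (f z) \<le> C * exp (pi * \<bar>Im z\<bar>)" for z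
  proof -
    have "norm (f z) * 1 \<le> norm (f z) * (1 + norm z) ^ k"
      by (intro mult_left_mono one_le_power) auto
    then show ?thesis using C(2)[of z] by simp
  qed
  then show ?thesis by (rule exponential_type_leI)
qed

lemma PW_decay_2_real_bound:
  assumes "PW_decay 2 f"
  obtains C where "C \<ge> 0" "\<And>x. norm (f (of_real x)) \<le> C * (1 / (1 + x\<^sup>2))"
proof -
  obtain C where C: "C \<ge> 0" "\<And>z. norm (f z) * (1 + norm z) ^ 2 \<le> C * exp (pi * \<bar>Im z\<bar>)"
    using PW_decayE[OF assms] by blast
  have "norm (f (of_real x)) \<le> C * (1 / (1 + x\<^sup>2))" for x
  proof -
    have pos: "1 + x\<^sup>2 > 0" by (simp add: add_pos_nonneg)
    have "norm (f (of_real x)) * (1 + x\<^sup>2) \<le> norm (f (of_real x)) * (1 + \<bar>x\<bar>)\<^sup>2"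
      by (intro mult_left_mono) (auto simp: power2_sum)
    also have "\<dots> \<le> C" using C(2)[of "of_real x"] by simp
    finally show ?thesis using pos by (simp add: pos_le_divide_eq)
  qed
  then show ?thesis using C(1) that by blast
qed

lemma PW_decay_2_integrable:
  assumes "PW_decay 2 f"
  shows "integrable lborel (\<lambda>x. f (of_real x))"
    and "p \<ge> 1 \<Longrightarrow> integrable lborel (\<lambda>x. norm (f (of_real x)) powr p)"
proof -
  obtain C where C: "C \<ge> 0" "\<And>x. norm (f (of_real x)) \<le> C * (1 / (1 + x\<^sup>2))"
    using PW_decay_2_real_bound[OF assms] by blast
  have [measurable]: "(\<lambda>x. f (complex_of_real x)) \<in> borel_measurable borel"
    by (intro measurable_real_axis PW_decay_holomorphic[OF assms])
  have dom: "integrable lborel (\<lambda>x. D * (1 / (1 + x\<^sup>2)) :: real)" for D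
    by (intro integrable_mult_right integrable_inverse_1_plus_sq)
  show "integrable lborel (\<lambda>x. f (of_real x))"
    by (rule Bochner_Integration.integrable_bound[OF dom[of C]])
      (use C in \<open>auto intro!: AE_I2\<close>)
  assume p: "p \<ge> 1"
  show "integrable lborel (\<lambda>x. norm (f (of_real x)) powr p)"
  proof (rule Bochner_Integration.integrable_bound[OF dom[of "C powr p"]])
    show "AE x in lborel. norm (norm (f (of_real x)) powr p) \<le> norm (C powr p * (1 / (1 + x\<^sup>2)))"
    proof (rule AE_I2)
      fix x :: real
      have u: "0 < 1 / (1 + x\<^sup>2)" "1 / (1 + x\<^sup>2) \<le> 1" by (auto simp: add_pos_nonneg)
      have "norm (f (of_real x)) powr p \<le> (C * (1 / (1 + x\<^sup>2))) powr p"
        using C p by (intro powr_mono2) auto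
      also have "\<dots> = C powr p * (1 / (1 + x\<^sup>2)) powr p" by (rule powr_mult)
      also have "\<dots> \<le> C powr p * (1 / (1 + x\<^sup>2)) powr 1" using u p
        by (intro mult_left_mono powr_mono') auto
      also have "\<dots> = C powr p * (1 / (1 + x\<^sup>2))" using u by simp
      finally show "norm (norm (f (of_real x)) powr p) \<le> norm (C powr p * (1 / (1 + x\<^sup>2)))" by simp
    qed
  qed simp
qed

text \<open>The Fourier transform of such a function lives on \<open>[- pi, pi]\<close> and vanishes at the end points: for
  \<open>l \<ge> pi\<close> the integrand extends to the upper half-plane with decay, and Cauchy's formula for
  \<open>f z * exp (\<i> l z) * (z - \<i>)\<close> at its zero \<open>\<i>\<close> gives the integral.\<close>

lemma PW_decay_orthogonal_exp:
  assumes f: "PW_decay 2 f" and l: "\<bar>l\<bar> \<ge> pi"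
  shows "(\<integral>x. f (of_real x) * exp (\<i> * of_real (l * x)) \<partial>lborel) = 0"
proof -
  have *: "(\<integral>x. f (of_real x) * exp (\<i> * of_real (l * x)) \<partial>lborel) = 0" if f: "PW_decay 2 f" and l: "l \<ge> pi" for f l
  proof -
    obtain C where C: "C \<ge> 0" "\<And>z. norm (f z) * (1 + norm z) ^ 2 \<le> C * exp (pi * \<bar>Im z\<bar>)"
      using PW_decayE[OF f] by blast
    note hf = PW_decay_holomorphic[OF f]
    define G where "G = (\<lambda>z. f z * exp (\<i> * of_real l * z) * (z - \<i>))"
    have hG: "G holomorphic_on UNIV" unfolding G_def by (intro holomorphic_intros hf)
    have "(\<integral>x. G (of_real x) / (of_real x - \<i>) \<partial>lborel) = 2 * pi * \<i> * G \<i>"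
    proof (rule Cauchy_formula_boundary)
      show "G holomorphic_on {z. Im z > 0}" using hG holomorphic_on_subset by blast
      show "norm (G z) \<le> C / (1 + norm z)" if z: "Im z > 0" for z
      proof -
        have n: "1 + norm z > 0" by (simp add: add_pos_nonneg)
        have "exp (pi * Im z) * exp (- (l * Im z)) \<le> 1"
          using l z by (simp add: exp_add[symmetric] mult_right_mono)
        have "norm (G z) * (1 + norm z) = norm (f z) * exp (- (l * Im z)) * norm (z - \<i>) * (1 + norm z)"
          by (simp add: G_def norm_mult)
        also have "\<dots> \<le> norm (f z) * exp (- (l * Im z)) * (1 + norm z) * (1 + norm z)"
          using norm_triangle_ineq4[of z \<i>] by (intro mult_right_mono mult_left_mono) auto
        also have "\<dots> = (norm (f z) * (1 + norm z)^2) * exp (- (l * Im z))" by (simp add: power2_eq_square)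
        also have "\<dots> \<le> (C * exp (pi * Im z)) * exp (- (l * Im z))"
          using C(2)[of z] z by (intro mult_right_mono) auto
        also have "\<dots> = C * (exp (pi * Im z) * exp (- (l * Im z)))" by simp
        also have "\<dots> \<le> C * 1" by (intro mult_left_mono) (fact, fact C(1))
        finally show ?thesis using n by (simp add: pos_le_divide_eq)
      qed
      show "AE x in lborel. ((\<lambda>e. G (Complex x e)) \<longlongrightarrow> G (of_real x)) (at_right 0)"
        by (intro AE_I2 isCont_tendsto_compose[OF isCont_entire[OF hG] tendsto_Complex_of_real])
      show "(\<lambda>x. G (of_real x)) \<in> borel_measurable borel" by (rule measurable_real_axis[OF hG])
    qed auto
    moreover have "G (of_real x) / (of_real x - \<i>) = f (of_real x) * exp (\<i> * of_real (l * x))" for x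
    proof -
      have "of_real x - \<i> \<noteq> 0" by (simp add: complex_eq_iff)
      then show ?thesis by (simp add: G_def mult.assoc)
    qed
    ultimately show ?thesis by (simp add: G_def)
  qed
  show ?thesis
  proof (cases "l \<ge> pi")
    case True
    then show ?thesis using *[OF f] by simp
  next
    case False
    then have "(\<integral>x. f (- of_real x) * exp (\<i> * of_real ((-l) * x)) \<partial>lborel) = 0"
      using *[OF PW_decay_reflect[OF f], of "-l"] l by (simp add: abs_if split: if_splits)
    moreover have "(\<integral>x. f (of_real x) * exp (\<i> * of_real (l * x)) \<partial>lborel)
       = (\<integral>x. f (- of_real x) * exp (\<i> * of_real ((-l) * x)) \<partial>lborel)"
      using lborel_integral_real_affine[of "-1" "\<lambda>x. f (of_real x) * exp (\<i> * of_real (l * x))" 0] by simp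
    ultimately show ?thesis by simp
  qed
qed

lemma exp_ix_integrable:
  assumes "integrable lborel (\<lambda>x. f x :: complex)"
  shows "integrable lborel (\<lambda>x. f x * exp (\<i> * of_real (l * x)))"
proof (rule Bochner_Integration.integrable_bound[OF assms])
  have [measurable]: "f \<in> borel_measurable borel" using borel_measurable_integrable[OF assms] by simp
  have "continuous_on UNIV (\<lambda>x. exp (\<i> * of_real (l * x)))" by (intro continuous_intros)
  then have [measurable]: "(\<lambda>x. exp (\<i> * of_real (l * x))) \<in> borel_measurable borel" by (rule borel_measurable_continuous_onI)
  show "(\<lambda>x. f x * exp (\<i> * of_real (l * x))) \<in> borel_measurable lborel" by measurable
qed (auto simp: norm_mult)

text \<open>An odd power of \<open>cos (pi x)\<close> contains only odd multiples of the frequency \<open>pi\<close>.\<close>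

lemma PW_decay_orthogonal_cos_odd_power:
  assumes f: "PW_decay 2 f" and n: "odd n"
  shows "(\<integral>x. f (of_real x) * of_real (cos (pi * x) ^ n) \<partial>lborel) = 0"
proof -
  have exp: "complex_of_real (cos (pi * x) ^ n)
     = (\<Sum>k\<le>n. of_nat (n choose k) / 2 ^ n * exp (\<i> * of_real ((2 * real k - real n) * pi * x)))" for x
  proof -
    have a: "complex_of_real (cos (pi * x)) = (exp (\<i> * of_real (pi * x)) + exp (- (\<i> * of_real (pi * x)))) / 2"
      by (simp add: cos_of_real[symmetric] cos_exp_eq)
    have "complex_of_real (cos (pi * x) ^ n) = (exp (\<i> * of_real (pi * x)) + exp (- (\<i> * of_real (pi * x)))) ^ n / 2 ^ n"
      by (simp only: of_real_power a power_divide)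
    also have "\<dots> = (\<Sum>k\<le>n. of_nat (n choose k) / 2 ^ n * (exp (\<i> * of_real (pi * x)) ^ k * exp (- (\<i> * of_real (pi * x))) ^ (n - k)))"
      by (simp add: binomial_ring sum_divide_distrib mult_ac)
    also have "\<dots> = (\<Sum>k\<le>n. of_nat (n choose k) / 2 ^ n * exp (\<i> * of_real ((2 * real k - real n) * pi * x)))"
    proof (rule sum.cong[OF refl])
      fix k assume "k \<in> {..n}"
      then have k: "k \<le> n" by simp
      have "exp (\<i> * of_real (pi * x)) ^ k * exp (- (\<i> * of_real (pi * x))) ^ (n - k)
         = exp (of_nat k * (\<i> * of_real (pi * x)) + of_nat (n - k) * (- (\<i> * of_real (pi * x))))"
        by (simp only: exp_add exp_of_nat_mult)
      also have "of_nat k * (\<i> * of_real (pi * x)) + of_nat (n - k) * (- (\<i> * of_real (pi * x)))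
          = \<i> * of_real ((2 * real k - real n) * pi * x)"
        using k by (simp add: of_nat_diff algebra_simps)
      finally show "of_nat (n choose k) / 2 ^ n * (exp (\<i> * of_real (pi * x)) ^ k * exp (- (\<i> * of_real (pi * x))) ^ (n - k))
         = of_nat (n choose k) / 2 ^ n * exp (\<i> * of_real ((2 * real k - real n) * pi * x))" by simp
    qed
    finally show ?thesis .
  qed
  note fi = PW_decay_2_integrable(1)[OF f]
  have "(\<integral>x. f (of_real x) * of_real (cos (pi * x) ^ n) \<partial>lborel)
     = (\<integral>x. (\<Sum>k\<le>n. of_nat (n choose k) / 2 ^ n * (f (of_real x) * exp (\<i> * of_real ((2 * real k - real n) * pi * x)))) \<partial>lborel)"
    unfolding exp by (simp add: sum_distrib_left mult_ac)
  also have "\<dots> = (\<Sum>k\<le>n. \<integral>x. of_nat (n choose k) / 2 ^ n * (f (of_real x) * exp (\<i> * of_real ((2 * real k - real n) * pi * x))) \<partial>lborel)"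
    by (intro Bochner_Integration.integral_sum integrable_mult_right exp_ix_integrable fi)
  also have "\<dots> = (\<Sum>k\<le>n. of_nat (n choose k) / 2 ^ n * (\<integral>x. f (of_real x) * exp (\<i> * of_real ((2 * real k - real n) * pi * x)) \<partial>lborel))"
    by (intro sum.cong refl integral_mult_right_zero)
  also have "\<dots> = 0"
  proof (rule sum.neutral, rule ballI)
    fix k assume "k \<in> {..n}"
    have "2 * int k - int n \<noteq> 0" using n by presburger
    then have "\<bar>2 * int k - int n\<bar> \<ge> 1" by linarith
    then have "real_of_int \<bar>2 * int k - int n\<bar> \<ge> 1" by linarith
    then have "\<bar>2 * real k - real n\<bar> \<ge> 1" by simp
    then have "\<bar>(2 * real k - real n) * pi\<bar> \<ge> pi" by (simp add: abs_mult)
    from PW_decay_orthogonal_exp[OF f this]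
    show "of_nat (n choose k) / 2 ^ n * (\<integral>x. f (of_real x) * exp (\<i> * of_real ((2 * real k - real n) * pi * x)) \<partial>lborel) = 0"
      by simp
  qed
  finally show ?thesis .
qed

text \<open>By the Weierstrass theorem \<open>v\<close> is a uniform limit of polynomials, and their odd parts converge to
  \<open>v\<close> as well.\<close>

lemma PW_decay_orthogonal_odd_cos:
  fixes v :: "real \<Rightarrow> real"
  assumes f: "PW_decay 2 f" and v: "continuous_on {-1..1} v" and odd: "\<And>u. v (- u) = - v u"
  shows "(\<integral>x. f (of_real x) * of_real (v (cos (pi * x))) \<partial>lborel) = 0"
    and "integrable lborel (\<lambda>x. f (of_real x) * of_real (v (cos (pi * x))))"
proof -
  note fi = PW_decay_2_integrable(1)[OF f]
  have cc: "cos (pi * x) \<in> {-1..1}" for x by simp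
  have int: "integrable lborel (\<lambda>x. f (of_real x) * of_real (w (cos (pi * x))))"
    and bnd: "\<lbrakk>\<And>u. u \<in> {-1..1} \<Longrightarrow> \<bar>w u\<bar> \<le> M\<rbrakk> \<Longrightarrow> norm (\<integral>x. f (of_real x) * of_real (w (cos (pi * x))) \<partial>lborel) \<le> M * (\<integral>x. norm (f (of_real x)) \<partial>lborel)"
    if w: "continuous_on {-1..1} w" for w :: "real \<Rightarrow> real" and M
  proof -
    have "continuous_on UNIV (\<lambda>x. w (cos (pi * x)))"
      by (rule continuous_on_compose2[OF w]) (auto intro!: continuous_intros)
    then have [measurable]: "(\<lambda>x. w (cos (pi * x))) \<in> borel_measurable borel" by (rule borel_measurable_continuous_onI)
    have [measurable]: "(\<lambda>x. f (complex_of_real x)) \<in> borel_measurable borel"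
      using borel_measurable_integrable[OF fi] by simp
    have "bounded (w ` {-1..1})" by (intro compact_imp_bounded compact_continuous_image w) auto
    then obtain D where D': "\<forall>y\<in>w ` {-1..1}. norm y \<le> D" unfolding bounded_iff by blast
    have D: "\<bar>w u\<bar> \<le> D" if "u \<in> {-1..1}" for u
      using bspec[OF D' imageI[OF that]] unfolding real_norm_def .
    have D0: "D \<ge> 0" using D[of 0] by auto
    show i: "integrable lborel (\<lambda>x. f (of_real x) * of_real (w (cos (pi * x))))"
    proof (rule Bochner_Integration.integrable_bound[OF integrable_mult_right[OF fi, of "of_real D"]])
      show "AE x in lborel. norm (f (of_real x) * of_real (w (cos (pi * x)))) \<le> norm (of_real D * f (of_real x))"
      proof (rule AE_I2)
        fix x
        have "norm (f (of_real x)) * \<bar>w (cos (pi * x))\<bar> \<le> norm (f (of_real x)) * D"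
          using D[OF cc] by (intro mult_left_mono) auto
        then show "norm (f (of_real x) * of_real (w (cos (pi * x)))) \<le> norm (of_real D * f (of_real x))"
          using D0 by (simp add: norm_mult mult.commute)
      qed
    qed simp
    assume M: "\<And>u. u \<in> {-1..1} \<Longrightarrow> \<bar>w u\<bar> \<le> M"
    have "norm (\<integral>x. f (of_real x) * of_real (w (cos (pi * x))) \<partial>lborel) \<le> (\<integral>x. norm (f (of_real x) * of_real (w (cos (pi * x)))) \<partial>lborel)"
      by (rule integral_norm_bound)
    also have "\<dots> \<le> (\<integral>x. M * norm (f (of_real x)) \<partial>lborel)"
    proof (rule integral_mono)
      show "integrable lborel (\<lambda>x. norm (f (of_real x) * of_real (w (cos (pi * x)))))" using i by (rule integrable_norm)
      show "integrable lborel (\<lambda>x. M * norm (f (of_real x)))" using fi by (intro integrable_mult_right integrable_norm)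
      fix x
      have "norm (f (of_real x)) * \<bar>w (cos (pi * x))\<bar> \<le> norm (f (of_real x)) * M"
        using M[OF cc] by (intro mult_left_mono) auto
      then show "norm (f (of_real x) * of_real (w (cos (pi * x)))) \<le> M * norm (f (of_real x))"
        by (simp add: norm_mult mult.commute)
    qed
    finally show "norm (\<integral>x. f (of_real x) * of_real (w (cos (pi * x))) \<partial>lborel) \<le> M * (\<integral>x. norm (f (of_real x)) \<partial>lborel)" by simp
  qed
  show "integrable lborel (\<lambda>x. f (of_real x) * of_real (v (cos (pi * x))))" by (rule int[OF v])
  define N where "N = (\<integral>x. norm (f (of_real x)) \<partial>lborel)"
  have small: "norm (\<integral>x. f (of_real x) * of_real (v (cos (pi * x))) \<partial>lborel) \<le> e * N" if e: "e > 0" for e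
  proof -
    obtain g where g: "real_polynomial_function g" "\<And>u. u \<in> {-1..1} \<Longrightarrow> \<bar>v u - g u\<bar> < e"
      using Stone_Weierstrass_real_polynomial_function[OF _ v e] by auto
    obtain a n where an: "g = (\<lambda>u. \<Sum>i\<le>n. a i * u ^ i)"
      using g(1) by (auto simp: real_polynomial_function_iff_sum)
    \<comment> \<open>the odd part of \<open>g\<close>\<close>
    define h where "h = (\<lambda>u. \<Sum>i | i \<le> n \<and> odd i. a i * u ^ i)"
    have h: "h u = (g u - g (- u)) / 2" for u
    proof -
      have "g u - g (- u) = (\<Sum>i\<le>n. if odd i then 2 * (a i * u ^ i) else 0)"
        unfolding an by (subst sum_subtractf[symmetric]) (intro sum.cong refl, auto simp: power_minus_odd power_minus_even)
      also have "\<dots> = (\<Sum>i | i \<le> n \<and> odd i. 2 * (a i * u ^ i))"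
        by (subst sum.inter_filter[symmetric]) (auto intro!: sum.cong)
      also have "\<dots> = 2 * h u" by (simp add: h_def sum_distrib_left)
      finally show ?thesis by simp
    qed
    have close: "\<bar>v u - h u\<bar> \<le> e" if "u \<in> {-1..1}" for u
    proof -
      have "-u \<in> {-1..1}" using that by auto
      from g(2)[OF that] g(2)[OF this] show ?thesis unfolding h odd by (simp add: abs_if field_simps split: if_splits)
    qed
    have ch: "continuous_on {-1..1} h" unfolding h_def by (intro continuous_intros)
    have cp: "continuous_on {-1..1} (\<lambda>u::real. u ^ i)" for i :: nat by (intro continuous_intros)
    have "(\<integral>x. f (of_real x) * of_real (h (cos (pi * x))) \<partial>lborel)
       = (\<integral>x. (\<Sum>i | i \<le> n \<and> odd i. of_real (a i) * (f (of_real x) * of_real (cos (pi * x) ^ i))) \<partial>lborel)"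
      by (simp add: h_def sum_distrib_left mult_ac)
    also have "\<dots> = (\<Sum>i | i \<le> n \<and> odd i. \<integral>x. of_real (a i) * (f (of_real x) * of_real (cos (pi * x) ^ i)) \<partial>lborel)"
      by (intro Bochner_Integration.integral_sum integrable_mult_right int cp)
    also have "\<dots> = (\<Sum>i | i \<le> n \<and> odd i. of_real (a i) * (\<integral>x. f (of_real x) * of_real (cos (pi * x) ^ i) \<partial>lborel))"
      by (intro sum.cong refl integral_mult_right_zero)
    also have "\<dots> = 0"
      by (rule sum.neutral) (use PW_decay_orthogonal_cos_odd_power[OF f] in auto)
    finally have z: "(\<integral>x. f (of_real x) * of_real (h (cos (pi * x))) \<partial>lborel) = 0" .
    have "(\<integral>x. f (of_real x) * of_real (v (cos (pi * x))) \<partial>lborel) = (\<integral>x. f (of_real x) * of_real (v (cos (pi * x))) \<partial>lborel)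
       - (\<integral>x. f (of_real x) * of_real (h (cos (pi * x))) \<partial>lborel)" using z by simp
    also have "\<dots> = (\<integral>x. f (of_real x) * of_real (v (cos (pi * x))) - f (of_real x) * of_real (h (cos (pi * x))) \<partial>lborel)"
      by (rule Bochner_Integration.integral_diff[symmetric]) (intro int v ch)+
    also have "\<dots> = (\<integral>x. f (of_real x) * of_real ((\<lambda>u. v u - h u) (cos (pi * x))) \<partial>lborel)"
      by (simp add: right_diff_distrib)
    finally have eq: "(\<integral>x. f (of_real x) * of_real (v (cos (pi * x))) \<partial>lborel) = (\<integral>x. f (of_real x) * of_real ((\<lambda>u. v u - h u) (cos (pi * x))) \<partial>lborel)" .
    show ?thesis unfolding eq N_def
      by (rule bnd[of "\<lambda>u. v u - h u"]) (use v ch close in \<open>auto intro!: continuous_intros\<close>)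
  qed
  have N0: "N \<ge> 0" by (simp add: N_def)
  have "norm (\<integral>x. f (of_real x) * of_real (v (cos (pi * x))) \<partial>lborel) \<le> 0"
  proof (rule field_le_epsilon)
    fix e :: real assume e: "e > 0"
    have "norm (\<integral>x. f (of_real x) * of_real (v (cos (pi * x))) \<partial>lborel) \<le> e / (N + 1) * N"
      using e N0 by (intro small) auto
    also have "\<dots> \<le> e" using e N0 by (simp add: field_simps)
    finally show "norm (\<integral>x. f (of_real x) * of_real (v (cos (pi * x))) \<partial>lborel) \<le> 0 + e" by simp
  qed
  then show "(\<integral>x. f (of_real x) * of_real (v (cos (pi * x))) \<partial>lborel) = 0" by simp
qed

section \<open>The Euler--Lagrange equation\<close>

text \<open>The odd extension of the power function; \<open>p * sgn_powr (p - 1)\<close> is the derivative of \<open>|y| powr p\<close>.\<close>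

definition sgn_powr :: "real \<Rightarrow> real \<Rightarrow> real" where
  "sgn_powr q y = sgn y * \<bar>y\<bar> powr q"

lemma sgn_powr_minus: "sgn_powr q (- y) = - sgn_powr q y"
  by (simp add: sgn_powr_def sgn_minus)

lemma abs_sgn_powr: "\<bar>sgn_powr q y\<bar> = \<bar>y\<bar> powr q"
  by (auto simp: sgn_powr_def abs_mult abs_sgn_eq)

lemma sgn_powr_times_self: "sgn_powr (p - 1) y * y = \<bar>y\<bar> powr p"
proof (cases "y = 0")
  case False
  have "\<bar>y\<bar> powr p = \<bar>y\<bar> powr (p - 1) * \<bar>y\<bar> powr 1" by (simp only: powr_add[symmetric]) simp
  then show ?thesis using False by (simp add: sgn_powr_def abs_if sgn_if)
qed (simp add: sgn_powr_def)

lemma sgn_powr_strict_mono: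
  assumes "q > 0" "x < y"
  shows "sgn_powr q x < sgn_powr q y"
proof -
  consider "x \<ge> 0" | "x < 0" "y > 0" | "x < 0" "y \<le> 0" by linarith
  then show ?thesis
  proof cases
    case 1
    then show ?thesis using assms by (auto simp: sgn_powr_def sgn_if intro!: powr_less_mono2)
  next
    case 2
    then have "(- x) powr q > 0" "y powr q > 0" by auto
    then have "- ((- x) powr q) < y powr q" by linarith
    then show ?thesis using 2 by (simp add: sgn_powr_def)
  next
    case 3
    then have "(- y) powr q < (- x) powr q" using assms by (intro powr_less_mono2) auto
    then show ?thesis using 3 assms by (auto simp: sgn_powr_def sgn_if)
  qed
qed

lemma sgn_powr_monotone_product:
  assumes "q > 0"
  shows "(x - y) * (sgn_powr q x - sgn_powr q y) \<ge> 0"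
    and "(x - y) * (sgn_powr q x - sgn_powr q y) = 0 \<longleftrightarrow> x = y"
proof -
  have *: "(x - y) * (sgn_powr q x - sgn_powr q y) > 0" if "x \<noteq> y"
    using sgn_powr_strict_mono[OF assms, of x y] sgn_powr_strict_mono[OF assms, of y x] that
    by (cases "x < y") (auto intro: mult_neg_neg mult_pos_pos)
  show "(x - y) * (sgn_powr q x - sgn_powr q y) \<ge> 0"
    and "(x - y) * (sgn_powr q x - sgn_powr q y) = 0 \<longleftrightarrow> x = y"
    using * by (cases "x = y"; force)+
qed

lemma DERIV_abs_powr:
  assumes p: "p > 1"
  shows "((\<lambda>y. \<bar>y\<bar> powr p) has_real_derivative p * sgn_powr (p - 1) y) (at y)"
proof -
  consider "y > 0" | "y < 0" | "y = 0" by linarith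
  then show ?thesis
  proof cases
    case 1
    have d: "((\<lambda>y. y powr p) has_real_derivative p * y powr (p - 1)) (at y)"
      using has_real_derivative_powr[OF 1] by simp
    have ev: "\<forall>\<^sub>F z in nhds y. z powr p = \<bar>z\<bar> powr p"
      using eventually_nhds_in_open[of "{0<..}" y] 1 by (auto elim!: eventually_mono)
    have "((\<lambda>y. \<bar>y\<bar> powr p) has_real_derivative p * y powr (p - 1)) (at y)"
      by (rule DERIV_cong_ev[OF refl ev refl, THEN iffD1, OF d])
    then show ?thesis using 1 by (simp add: sgn_powr_def)
  next
    case 2
    have d: "((\<lambda>y. (- y) powr p) has_real_derivative p * (- y) powr (p - 1) * (- 1)) (at y)"
      by (rule DERIV_chain2[OF has_real_derivative_powr]) (use 2 in \<open>auto intro!: derivative_eq_intros\<close>)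
    have ev: "\<forall>\<^sub>F z in nhds y. (- z) powr p = \<bar>z\<bar> powr p"
      using eventually_nhds_in_open[of "{..<0}" y] 2 by (auto elim!: eventually_mono)
    have "((\<lambda>y. \<bar>y\<bar> powr p) has_real_derivative p * (- y) powr (p - 1) * (- 1)) (at y)"
      by (rule DERIV_cong_ev[OF refl ev refl, THEN iffD1, OF d])
    then show ?thesis using 2 by (simp add: sgn_powr_def)
  next
    case 3
    have "((\<lambda>h. \<bar>h\<bar> powr (p - 1)) \<longlongrightarrow> \<bar>0\<bar> powr (p - 1)) (at (0::real))"
      using p by (intro tendsto_powr2 tendsto_intros) auto
    then have l: "((\<lambda>h. \<bar>h\<bar> powr (p - 1)) \<longlongrightarrow> 0) (at (0::real))" by simp
    have "((\<lambda>h. (\<bar>0 + h\<bar> powr p - \<bar>0\<bar> powr p) / h) \<longlongrightarrow> 0) (at (0::real))"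
    proof (rule Lim_null_comparison[OF _ l])
      have "norm ((\<bar>0 + h\<bar> powr p - \<bar>0\<bar> powr p) / h) \<le> \<bar>h\<bar> powr (p - 1)" for h :: real
        by (cases "h = 0") (simp_all add: powr_diff)
      then show "\<forall>\<^sub>F h in at 0. norm ((\<bar>0 + h\<bar> powr p - \<bar>0\<bar> powr p) / h) \<le> \<bar>h\<bar> powr (p - 1)"
        by (intro always_eventually allI)
    qed
    then have "((\<lambda>y. \<bar>y\<bar> powr p) has_real_derivative 0) (at 0)" by (simp add: DERIV_def)
    then show ?thesis using 3 by (simp add: sgn_powr_def)
  qed
qed

lemma continuous_on_sgn_powr:
  assumes "q > 0"
  shows "continuous_on S (sgn_powr q)"
proof -
  have "isCont (sgn_powr q) y" for y
  proof (cases "y = 0")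
    case True
    have "((\<lambda>h. \<bar>h\<bar> powr q) \<longlongrightarrow> \<bar>0\<bar> powr q) (at (0::real))"
      using assms by (intro tendsto_powr2 tendsto_intros) auto
    then have l: "((\<lambda>h. \<bar>h\<bar> powr q) \<longlongrightarrow> 0) (at (0::real))" by simp
    have "(sgn_powr q \<longlongrightarrow> 0) (at 0)"
      by (rule Lim_null_comparison[OF _ l]) (auto simp: abs_sgn_powr)
    then show ?thesis using True by (simp add: isCont_def sgn_powr_def)
  next
    case False
    then have "isCont (\<lambda>y. sgn y * \<bar>y\<bar> powr q) y" by (intro continuous_intros isCont_sgn) auto
    then show ?thesis by (simp add: sgn_powr_def[abs_def])
  qed
  then show ?thesis by (simp add: continuous_at_imp_continuous_on)
qed

lemma abs_powr_increment_le:
  fixes a h p :: real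
  assumes p: "p > 1"
  shows "\<bar>\<bar>a + h\<bar> powr p - \<bar>a\<bar> powr p\<bar> \<le> p * (\<bar>a\<bar> + \<bar>h\<bar>) powr (p - 1) * \<bar>h\<bar>"
proof -
  have "norm (\<bar>a + h\<bar> powr p - \<bar>a\<bar> powr p) \<le> (p * (\<bar>a\<bar> + \<bar>h\<bar>) powr (p - 1)) * norm (a + h - a)"
  proof (rule field_differentiable_bound[of "closed_segment a (a + h)" "\<lambda>y. \<bar>y\<bar> powr p" "\<lambda>y. p * sgn_powr (p - 1) y"])
    fix y assume "y \<in> closed_segment a (a + h)"
    then have y: "\<bar>y\<bar> \<le> \<bar>a\<bar> + \<bar>h\<bar>" by (auto simp: closed_segment_eq_real_ivl split: if_splits)
    show "((\<lambda>y. \<bar>y\<bar> powr p) has_real_derivative p * sgn_powr (p - 1) y) (at y within closed_segment a (a + h))"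
      by (rule has_field_derivative_at_within[OF DERIV_abs_powr[OF p]])
    have "\<bar>y\<bar> powr (p - 1) \<le> (\<bar>a\<bar> + \<bar>h\<bar>) powr (p - 1)" using y p by (intro powr_mono2) auto
    then show "norm (p * sgn_powr (p - 1) y) \<le> p * (\<bar>a\<bar> + \<bar>h\<bar>) powr (p - 1)"
      using p by (simp add: abs_mult abs_sgn_powr)
  qed auto
  then show ?thesis by simp
qed

lemma sum_powr_le:
  fixes a b p :: real
  assumes "a \<ge> 0" "b \<ge> 0" "p \<ge> 1"
  shows "(a + b) powr p \<le> 2 powr p * (a powr p + b powr p)"
proof -
  have "(a + b) powr p = 2 powr p * ((a + b) / 2) powr p" by (simp add: powr_divide)
  also have "\<dots> \<le> 2 powr p * ((a powr p + b powr p) / 2)"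
    by (intro mult_left_mono powr_midpoint_le assms) auto
  also have "\<dots> \<le> 2 powr p * (a powr p + b powr p)"
    by (intro mult_left_mono) auto
  finally show ?thesis .
qed

context extremal
begin

lemma real_on_reals: "\<phi> (of_real x) = of_real (Re (\<phi> (of_real x)))"
  using real[of "of_real x"] by (simp add: complex_eq_iff)

lemma norm_on_reals: "norm (\<phi> (of_real x)) = \<bar>Re (\<phi> (of_real x))\<bar>"
  by (subst real_on_reals) (rule norm_of_real)

lemma PW_decay_extremal: "PW_decay 0 \<phi>"
  using hol growth by (simp add: PW_decay_def)

lemma p1: "p > 1" "p \<ge> 1" using p2 by auto

text \<open>If \<open>T 0 = 0\<close>, every \<open>\<phi> + e T\<close> competes with \<open>\<phi>\<close>, so the difference quotients of \<open>\<integral>|\<phi> + e T|^p\<close>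
  at \<open>e = 0\<close> are nonnegative for \<open>e > 0\<close>.\<close>

lemma Euler_Lagrange_aux:
  assumes T: "T holomorphic_on UNIV" "exponential_type_le T pi"
    and re: "\<And>x. T (of_real x) = of_real (t x)" and T0: "T 0 = 0"
    and Ti: "integrable lborel (\<lambda>x. norm (T (of_real x)) powr p)"
  shows "integrable lborel (\<lambda>x. sgn_powr (p - 1) (Re (\<phi> (of_real x))) * t x)"
    and "(\<integral>x. sgn_powr (p - 1) (Re (\<phi> (of_real x))) * t x \<partial>lborel) \<ge> 0"
proof -
  define r where "r = (\<lambda>x. Re (\<phi> (of_real x)))"
  have nr: "norm (\<phi> (of_real x)) = \<bar>r x\<bar>" for x by (simp add: r_def norm_on_reals)
  have nt: "norm (T (of_real x)) = \<bar>t x\<bar>" for x by (simp add: re)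
  have t_eq: "t = (\<lambda>x. Re (T (of_real x)))" by (simp add: re)
  have mT[measurable]: "(\<lambda>x. T (complex_of_real x)) \<in> borel_measurable borel" by (rule measurable_real_axis[OF T(1)])
  have m\<phi>[measurable]: "(\<lambda>x. \<phi> (complex_of_real x)) \<in> borel_measurable borel" by (rule measurable_real_axis[OF hol])
  have mt[measurable]: "t \<in> borel_measurable borel" unfolding t_eq by measurable
  have mr[measurable]: "r \<in> borel_measurable borel" unfolding r_def by measurable
  have ri: "integrable lborel (\<lambda>x. \<bar>r x\<bar> powr p)" using integrable by (simp add: nr)
  have ti: "integrable lborel (\<lambda>x. \<bar>t x\<bar> powr p)" using Ti by (simp add: nt)
  define D where "D = (\<lambda>x. p * (2 powr p * (\<bar>r x\<bar> powr p + \<bar>t x\<bar> powr p)))"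
  have Di: "integrable lborel D" unfolding D_def using ri ti by (intro integrable_mult_right Bochner_Integration.integrable_add)
  have est: "\<bar>(\<bar>r x + e * t x\<bar> powr p - \<bar>r x\<bar> powr p) / e\<bar> \<le> D x" if e: "0 < e" "e \<le> 1" for e x
  proof -
    have "\<bar>e * t x\<bar> \<le> \<bar>t x\<bar>" using e by (simp add: abs_mult mult_left_le_one_le)
    have "\<bar>\<bar>r x + e * t x\<bar> powr p - \<bar>r x\<bar> powr p\<bar> \<le> p * (\<bar>r x\<bar> + \<bar>e * t x\<bar>) powr (p - 1) * \<bar>e * t x\<bar>"
      by (rule abs_powr_increment_le[OF p1(1)])
    also have "\<dots> \<le> p * (\<bar>r x\<bar> + \<bar>t x\<bar>) powr (p - 1) * \<bar>e * t x\<bar>"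
      using p1 \<open>\<bar>e * t x\<bar> \<le> \<bar>t x\<bar>\<close> by (intro mult_right_mono mult_left_mono powr_mono2) auto
    finally have "\<bar>(\<bar>r x + e * t x\<bar> powr p - \<bar>r x\<bar> powr p) / e\<bar> \<le> p * (\<bar>r x\<bar> + \<bar>t x\<bar>) powr (p - 1) * \<bar>t x\<bar>"
      using e by (simp add: abs_mult divide_le_eq mult_ac)
    also have "\<dots> \<le> p * (\<bar>r x\<bar> + \<bar>t x\<bar>) powr (p - 1) * (\<bar>r x\<bar> + \<bar>t x\<bar>)"
      using p1 by (intro mult_left_mono) auto
    also have "\<dots> = p * (\<bar>r x\<bar> + \<bar>t x\<bar>) powr p"
      using powr_mult_base[of "\<bar>r x\<bar> + \<bar>t x\<bar>" "p - 1"] by (simp add: mult_ac)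
    also have "\<dots> \<le> D x" unfolding D_def using p1 by (intro mult_left_mono sum_powr_le) auto
    finally show ?thesis .
  qed
  define s where "s = (\<lambda>n x. (\<bar>r x + 1 / real (Suc n) * t x\<bar> powr p - \<bar>r x\<bar> powr p) / (1 / real (Suc n)))"
  have smeas: "s n \<in> borel_measurable lborel" for n unfolding s_def by measurable
  have sgnmeas[measurable]: "sgn_powr q \<in> borel_measurable borel" for q unfolding sgn_powr_def[abs_def] by measurable
  have sbound: "\<bar>s n x\<bar> \<le> D x" for n x unfolding s_def by (rule est) auto
  have slim: "(\<lambda>n. s n x) \<longlonglongrightarrow> p * sgn_powr (p - 1) (r x) * t x" for x
  proof -
    have d: "((\<lambda>e. \<bar>r x + e * t x\<bar> powr p) has_real_derivative p * sgn_powr (p - 1) (r x + 0 * t x) * t x) (at 0)"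
    proof (rule DERIV_chain2[OF DERIV_abs_powr[OF p1(1)]])
      show "((\<lambda>e. r x + e * t x) has_real_derivative t x) (at 0)"
        by (auto intro!: derivative_eq_intros)
    qed
    have "((\<lambda>e. (\<bar>r x + e * t x\<bar> powr p - \<bar>r x\<bar> powr p) / e) \<longlongrightarrow> p * sgn_powr (p - 1) (r x) * t x) (at 0)"
      using d by (simp add: DERIV_def)
    moreover have "filterlim (\<lambda>n. 1 / real (Suc n)) (at 0) sequentially"
      using LIMSEQ_Suc[OF lim_1_over_n] by (auto simp: filterlim_at intro!: always_eventually)
    ultimately show ?thesis unfolding s_def by (rule filterlim_compose)
  qed
  have lim: "(\<lambda>n. \<integral>x. s n x \<partial>lborel) \<longlonglongrightarrow> (\<integral>x. p * sgn_powr (p - 1) (r x) * t x \<partial>lborel)"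
    by (rule integral_dominated_convergence[OF _ smeas Di]) (use slim sbound in \<open>auto intro!: AE_I2\<close>)
  have li: "integrable lborel (\<lambda>x. p * sgn_powr (p - 1) (r x) * t x)"
    by (rule integrable_dominated_convergence[OF _ smeas Di]) (use slim sbound in \<open>auto intro!: AE_I2\<close>)
  have "integrable lborel (\<lambda>x. (1 / p) * (p * sgn_powr (p - 1) (r x) * t x))" using li by (rule integrable_mult_right)
  then show "integrable lborel (\<lambda>x. sgn_powr (p - 1) (Re (\<phi> (of_real x))) * t x)"
    using p1 by (simp add: r_def)
  have pos: "(\<integral>x. s n x \<partial>lborel) \<ge> 0" for n
  proof -
    define e where "e = 1 / real (Suc n)"
    have e: "0 < e" "e \<le> 1" by (auto simp: e_def)
    define f where "f = (\<lambda>z. \<phi> z + of_real e * T z)"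
    have fr: "f (of_real x) = of_real (r x + e * t x)" for x by (simp add: f_def r_def real_on_reals[symmetric] re)
    have nf: "norm (f (of_real x)) = \<bar>r x + e * t x\<bar>" for x unfolding fr by (rule norm_of_real)
    have si: "integrable lborel (s n)"
      by (rule Bochner_Integration.integrable_bound[OF Di smeas]) (use order_trans[OF sbound abs_ge_self] in \<open>auto intro!: AE_I2\<close>)
    have eq: "\<bar>r x + e * t x\<bar> powr p = e * s n x + \<bar>r x\<bar> powr p" for x
      using e unfolding s_def e_def[symmetric] by simp
    have fi: "integrable lborel (\<lambda>x. \<bar>r x + e * t x\<bar> powr p)"
      unfolding eq using si ri by (intro Bochner_Integration.integrable_add integrable_mult_right)
    have ft: "exponential_type_le f pi" unfolding f_def
      by (rule exponential_type_le_add_cmult[OF PW_decay_exponential_type[OF PW_decay_extremal] T(2)])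
    have "c \<le> (\<integral>x. norm (f (of_real x)) powr p \<partial>lborel)"
    proof (rule minimal[OF _ ft])
      show "f holomorphic_on UNIV" unfolding f_def by (intro holomorphic_intros hol T(1))
      show "f 0 = 1" by (simp add: f_def at_0 T0)
    qed (use fi in \<open>simp add: nf\<close>)
    also have "\<dots> = e * (\<integral>x. s n x \<partial>lborel) + (\<integral>x. \<bar>r x\<bar> powr p \<partial>lborel)"
      unfolding nf eq using si ri by (subst Bochner_Integration.integral_add) auto
    also have "(\<integral>x. \<bar>r x\<bar> powr p \<partial>lborel) = c" by (simp add: c_def nr)
    finally show ?thesis using e by (simp add: zero_le_mult_iff)
  qed
  have "(\<integral>x. p * sgn_powr (p - 1) (r x) * t x \<partial>lborel) \<ge> 0"
    by (rule tendsto_lowerbound[OF lim]) (use pos in auto)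
  moreover have "(\<integral>x. p * sgn_powr (p - 1) (r x) * t x \<partial>lborel) = p * (\<integral>x. sgn_powr (p - 1) (r x) * t x \<partial>lborel)"
    by (simp add: mult.assoc)
  ultimately show "(\<integral>x. sgn_powr (p - 1) (Re (\<phi> (of_real x))) * t x \<partial>lborel) \<ge> 0"
    using p1 by (simp add: r_def zero_le_mult_iff)
qed

text \<open>The case \<open>T 0 = 0\<close>, applied to both signs of \<open>T - T 0 * \<phi>\<close>.\<close>

lemma Euler_Lagrange:
  assumes T: "T holomorphic_on UNIV" "exponential_type_le T pi"
    and re: "\<And>x. T (of_real x) = of_real (t x)"
    and Ti: "integrable lborel (\<lambda>x. norm (T (of_real x)) powr p)"
  shows "integrable lborel (\<lambda>x. sgn_powr (p - 1) (Re (\<phi> (of_real x))) * t x)"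
    and "(\<integral>x. sgn_powr (p - 1) (Re (\<phi> (of_real x))) * t x \<partial>lborel) = c * t 0"
proof -
  define r where "r = (\<lambda>x. Re (\<phi> (of_real x)))"
  define S where "S = (\<lambda>z. T z - of_real (t 0) * \<phi> z)"
  have T0: "T 0 = of_real (t 0)" using re[of 0] by simp
  have Sre: "S (of_real x) = of_real (t x - t 0 * r x)" for x
    by (simp add: S_def re r_def real_on_reals[symmetric])
  have Sh: "S holomorphic_on UNIV" unfolding S_def by (intro holomorphic_intros T hol)
  have S0: "S 0 = 0" by (simp add: S_def T0 at_0)
  have "exponential_type_le (\<lambda>z. T z + - of_real (t 0) * \<phi> z) pi"
    by (rule exponential_type_le_add_cmult[OF T(2) PW_decay_exponential_type[OF PW_decay_extremal]])
  then have St: "exponential_type_le S pi" by (simp add: S_def)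
  have mT[measurable]: "(\<lambda>x. T (complex_of_real x)) \<in> borel_measurable borel" by (rule measurable_real_axis[OF T(1)])
  have m\<phi>[measurable]: "(\<lambda>x. \<phi> (complex_of_real x)) \<in> borel_measurable borel" by (rule measurable_real_axis[OF hol])
  have Si: "integrable lborel (\<lambda>x. norm (S (of_real x)) powr p)"
  proof (rule Bochner_Integration.integrable_bound)
    show "integrable lborel (\<lambda>x. 2 powr p * (norm (T (of_real x)) powr p + \<bar>t 0\<bar> powr p * norm (\<phi> (of_real x)) powr p))"
      using Ti integrable by (intro integrable_mult_right Bochner_Integration.integrable_add)
    show "AE x in lborel. norm (norm (S (of_real x)) powr p) \<le> norm (2 powr p * (norm (T (of_real x)) powr p + \<bar>t 0\<bar> powr p * norm (\<phi> (of_real x)) powr p))"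
    proof (rule AE_I2)
      fix x
      have "norm (S (of_real x)) powr p \<le> (norm (T (of_real x)) + \<bar>t 0\<bar> * norm (\<phi> (of_real x))) powr p"
        unfolding S_def using norm_triangle_ineq4[of "T x" "of_real (t 0) * \<phi> x"] p1
        by (intro powr_mono2) (simp_all add: norm_mult)
      also have "\<dots> \<le> 2 powr p * (norm (T (of_real x)) powr p + (\<bar>t 0\<bar> * norm (\<phi> (of_real x))) powr p)"
        using p1 by (intro sum_powr_le) auto
      finally show "norm (norm (S (of_real x)) powr p) \<le> norm (2 powr p * (norm (T (of_real x)) powr p + \<bar>t 0\<bar> powr p * norm (\<phi> (of_real x)) powr p))"
        by (simp add: powr_mult)
    qed
    show "(\<lambda>x. norm (S (of_real x)) powr p) \<in> borel_measurable lborel" unfolding S_def by measurable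
  qed
  note A = Euler_Lagrange_aux[OF Sh St Sre S0 Si]
  have Sh': "(\<lambda>z. - S z) holomorphic_on UNIV" using Sh by (intro holomorphic_intros)
  have St': "exponential_type_le (\<lambda>z. - S z) pi" using St by (simp add: exponential_type_le_def)
  have Sre': "- S (of_real x) = of_real (- (t x - t 0 * r x))" for x by (simp only: Sre of_real_minus)
  have "(\<integral>x. sgn_powr (p - 1) (r x) * (- (t x - t 0 * r x)) \<partial>lborel) \<ge> 0"
    unfolding r_def by (rule Euler_Lagrange_aux(2)[OF Sh' St' Sre'[unfolded r_def]]) (use S0 Si in simp_all)
  then have "(\<integral>x. - (sgn_powr (p - 1) (r x) * (t x - t 0 * r x)) \<partial>lborel) \<ge> 0"
    by (simp only: mult_minus_right)
  then have zero: "(\<integral>x. sgn_powr (p - 1) (r x) * (t x - t 0 * r x) \<partial>lborel) = 0"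
    using A(2) by (simp add: r_def)
  have i1: "integrable lborel (\<lambda>x. sgn_powr (p - 1) (r x) * (t x - t 0 * r x))" using A(1) by (simp add: r_def)
  have i2: "integrable lborel (\<lambda>x. t 0 * \<bar>r x\<bar> powr p)"
    using integrable by (intro integrable_mult_right) (simp add: r_def norm_on_reals)
  have eq: "sgn_powr (p - 1) (r x) * t x = sgn_powr (p - 1) (r x) * (t x - t 0 * r x) + t 0 * \<bar>r x\<bar> powr p" for x
    by (simp add: sgn_powr_times_self[symmetric] algebra_simps)
  have "integrable lborel (\<lambda>x. sgn_powr (p - 1) (r x) * t x)"
    unfolding eq using i1 i2 by (rule Bochner_Integration.integrable_add)
  then show "integrable lborel (\<lambda>x. sgn_powr (p - 1) (Re (\<phi> (of_real x))) * t x)"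
    by (simp add: r_def)
  have "(\<integral>x. sgn_powr (p - 1) (r x) * t x \<partial>lborel) = 0 + t 0 * (\<integral>x. \<bar>r x\<bar> powr p \<partial>lborel)"
    unfolding eq by (subst Bochner_Integration.integral_add[OF i1 i2]) (simp add: zero)
  then show "(\<integral>x. sgn_powr (p - 1) (Re (\<phi> (of_real x))) * t x \<partial>lborel) = c * t 0"
    by (simp add: r_def c_def norm_on_reals)
qed

end

section \<open>The quotient by the cosine\<close>

lemma AE_eq_continuous_imp_eq:
  fixes f g :: "real \<Rightarrow> real"
  assumes ae: "AE x in lborel. f x = g x" and f: "continuous_on UNIV f" and g: "continuous_on UNIV g"
  shows "f x = g x"
proof -
  have "closed {x. f x = g x}" using f g by (intro closed_Collect_eq)
  moreover have "AE x in lebesgue. x \<in> {x. f x = g x}" using ae by (auto intro: AE_completion)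
  ultimately show ?thesis using mem_closed_if_AE_lebesgue by blast
qed

lemma AE_neq_lborel: "AE x in lborel. x \<noteq> (a::real)"
proof -
  have "{a} \<in> null_sets lborel" by auto
  from AE_not_in[OF this] show ?thesis by simp
qed

text \<open>Translation by the period shows that the integral over \<open>[-1, 0)\<close> would vanish.\<close>

lemma not_integrable_abs_cos_powr:
  assumes i: "integrable lborel (\<lambda>x. \<bar>cos (pi * x)\<bar> powr p)"
  shows False
proof -
  define f where "f = (\<lambda>x. \<bar>cos (pi * x)\<bar> powr p)"
  have f1: "f (1 + x) = f x" for x by (simp add: f_def algebra_simps)
  have fi: "integrable lborel f" using i by (simp add: f_def)
  have mf[measurable]: "f \<in> borel_measurable borel" using borel_measurable_integrable[OF fi] by simp
  have ia: "integrable lborel (\<lambda>x. f x * indicator {a..} x)" for a :: real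
    by (rule Bochner_Integration.integrable_bound[OF fi]) (auto simp: indicator_def f_def)
  have "(\<integral>x. f x * indicator {0..} x \<partial>lborel) = (\<integral>x. f (1 + 1 * x) * indicator {0..} (1 + 1 * x) \<partial>lborel)"
    by (subst lborel_integral_real_affine[of 1 _ 1]) auto
  also have "\<dots> = (\<integral>x. f x * indicator {-1..} x \<partial>lborel)"
    by (intro Bochner_Integration.integral_cong refl) (auto simp: f1 indicator_def)
  finally have "(\<integral>x. f x * indicator {-1..} x - f x * indicator {0..} x \<partial>lborel) = 0"
    using ia by (subst Bochner_Integration.integral_diff) auto
  then have "AE x in lborel. f x * indicator {-1..} x - f x * indicator {0..} x = 0"
    using ia by (subst (asm) integral_nonneg_eq_0_iff_AE) (auto simp: indicator_def f_def intro!: Bochner_Integration.integrable_diff)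
  then have "AE x in lborel. x \<notin> {-1/2<..<0::real}"
  proof eventually_elim
    case (elim x)
    show ?case
    proof
      assume x: "x \<in> {-1/2<..<0}"
      have "cos (pi * x) > 0" using x mult_strict_left_mono[of "-1/2" x pi] mult_strict_left_mono[of x 0 pi]
        by (intro cos_gt_zero_pi) auto
      then have "f x > 0" by (simp add: f_def)
      then show False using elim x by (auto simp: indicator_def)
    qed
  qed
  then have "{-1/2<..<0::real} \<in> null_sets lborel"
    by (subst AE_iff_null_sets) auto
  then show False by (simp add: null_sets_def)
qed

context extremal
begin

lemma continuous_extremal: "continuous_on UNIV (\<lambda>x. Re (\<phi> (of_real x)))"
  by (intro continuous_intros continuous_on_real_axis hol)

lemma c_pos: "c > 0"
proof -
  have "c \<ge> 0" by (simp add: c_def)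
  moreover have "c \<noteq> 0"
  proof
    assume "c = 0"
    then have "AE x in lborel. norm (\<phi> (of_real x)) powr p = 0"
      unfolding c_def using integrable by (subst (asm) integral_nonneg_eq_0_iff_AE) auto
    then have "AE x in lborel. Re (\<phi> (of_real x)) = 0" by eventually_elim (auto simp: norm_on_reals)
    from AE_eq_continuous_imp_eq[OF this continuous_extremal, of 0] show False by (simp add: at_0)
  qed
  ultimately show ?thesis by simp
qed

text \<open>The functions \<open>\<phi>\<close> and \<open>B cos (pi x)\<close> both become "high-pass" after applying the odd power
  \<open>sgn_powr (p - 1)\<close>: tested against \<open>T\<close>, the first gives \<open>c * T 0\<close> and the second gives \<open>0\<close>. If \<open>T\<close> is
  a positive multiple of \<open>\<phi> - B cos (pi x)\<close> off the origin, monotonicity of the odd power makes the difference of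
  the two integrals positive, unless \<open>\<phi>\<close> is a cosine, which is not in \<open>L^p\<close>.\<close>

lemma positivity:
  assumes T: "PW_decay 2 T" and re: "\<And>x. T (of_real x) = of_real (t x)"
    and \<rho>: "\<And>x. x \<noteq> 0 \<Longrightarrow> \<rho> x > 0"
    and t: "\<And>x. x \<noteq> 0 \<Longrightarrow> t x = \<rho> x * (Re (\<phi> (of_real x)) - B * cos (pi * x))"
  shows "t 0 > 0"
proof (rule ccontr)
  assume "\<not> t 0 > 0"
  then have ct: "c * t 0 \<le> 0" using c_pos by (simp add: mult_le_0_iff)
  define r where "r = (\<lambda>x. Re (\<phi> (of_real x)))"
  have p1': "p - 1 > 0" using p2 by simp
  note EL = Euler_Lagrange[OF PW_decay_holomorphic[OF T] PW_decay_exponential_type[OF T] re PW_decay_2_integrable(2)[OF T p1(2)]]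
  have cv: "continuous_on {-1..1} (\<lambda>u. sgn_powr (p - 1) (B * u))"
    by (rule continuous_on_compose2[OF continuous_on_sgn_powr[OF p1', of UNIV]]) (auto intro!: continuous_intros)
  have od: "sgn_powr (p - 1) (B * - u) = - sgn_powr (p - 1) (B * u)" for u
    by (simp add: sgn_powr_minus)
  note OR = PW_decay_orthogonal_odd_cos[OF T cv od]
  have e: "T (of_real x) * of_real (sgn_powr (p - 1) (B * cos (pi * x))) = of_real (t x * sgn_powr (p - 1) (B * cos (pi * x)))" for x
    by (simp add: re)
  have O1: "(\<integral>x. t x * sgn_powr (p - 1) (B * cos (pi * x)) \<partial>lborel) = 0"
    using OR(1) unfolding e integral_complex_of_real by simp
  have O2: "integrable lborel (\<lambda>x. t x * sgn_powr (p - 1) (B * cos (pi * x)))"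
    using OR(2) unfolding e complex_of_real_integrable_eq .
  define d where "d = (\<lambda>x. sgn_powr (p - 1) (r x) * t x - t x * sgn_powr (p - 1) (B * cos (pi * x)))"
  have di: "integrable lborel d" unfolding d_def r_def by (intro Bochner_Integration.integrable_diff EL(1) O2)
  have dI: "(\<integral>x. d x \<partial>lborel) = c * t 0"
    unfolding d_def r_def by (subst Bochner_Integration.integral_diff[OF EL(1) O2]) (simp add: EL(2) O1)
  have d_eq: "d x = \<rho> x * ((r x - B * cos (pi * x)) * (sgn_powr (p - 1) (r x) - sgn_powr (p - 1) (B * cos (pi * x))))" if "x \<noteq> 0" for x
    unfolding d_def r_def t[OF that] by (simp add: algebra_simps)
  have dpos: "AE x in lborel. 0 \<le> d x"
    using AE_neq_lborel[of 0]
  proof eventually_elim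
    case (elim x)
    then show ?case using \<rho>[OF elim] sgn_powr_monotone_product(1)[OF p1'] by (simp add: d_eq)
  qed
  have "(\<integral>x. d x \<partial>lborel) = 0" using integral_nonneg_AE[OF dpos] dI ct by linarith
  then have "AE x in lborel. d x = 0" using integral_nonneg_eq_0_iff_AE[OF di dpos] by simp
  then have "AE x in lborel. r x = B * cos (pi * x)"
    using AE_neq_lborel[of 0]
  proof eventually_elim
    case (elim x)
    then show ?case using \<rho>[OF elim(2)] sgn_powr_monotone_product(2)[OF p1', of "r x" "B * cos (pi * x)"] d_eq[OF elim(2)] by auto
  qed
  then have eq: "r x = B * cos (pi * x)" for x
    unfolding r_def by (rule AE_eq_continuous_imp_eq) (auto intro!: continuous_extremal continuous_intros)
  have "B = 1" using eq[of 0] by (simp add: r_def at_0)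
  then have "norm (\<phi> (of_real x)) = \<bar>cos (pi * x)\<bar>" for x using eq[of x] by (simp add: norm_on_reals r_def)
  then show False using integrable not_integrable_abs_cos_powr[of p] by simp
qed

text \<open>Its zeros are the points where the quotient of \<open>\<phi>\<close> by \<open>cos (pi z)\<close> takes the value \<open>B\<close>.\<close>

definition level :: "real \<Rightarrow> complex \<Rightarrow> complex" where
  "level B z = \<phi> z - of_real B * cos (of_real pi * z)"

lemma PW_decay_level: "PW_decay 0 (level B)"
  unfolding level_def[abs_def] by (intro PW_decay_diff PW_decay_extremal PW_decay_cmult PW_decay_cos)

lemma level_even: "level B (- z) = level B z"
  by (simp add: level_def even)

lemma level_cnj: "level B (cnj z) = cnj (level B z)"
  by (simp add: level_def real cnj_cos)

lemma level_on_reals: "level B (of_real x) = of_real (Re (\<phi> (of_real x)) - B * cos (pi * x))"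
  unfolding level_def by (subst real_on_reals) (simp add: cos_of_real[symmetric])

text \<open>By symmetry a zero \<open>z0\<close> in the open quadrant comes with the zeros \<open>- z0\<close>, \<open>cnj z0\<close> and \<open>- cnj z0\<close>.
  Dividing by all four leaves room for a factor \<open>z^2\<close>, and
  \<open>T z = z^2 * level B z / ((z^2 - z0^2) * (z^2 - cnj z0^2))\<close> vanishes at the origin, although it is a
  positive multiple of \<open>\<phi> - B cos (pi x)\<close> at all other real points. This contradicts \<open>positivity\<close>.\<close>

lemma level_nonzero_in_quadrant:
  assumes z: "Re z0 > 0" "Im z0 > 0"
  shows "level B z0 \<noteq> 0"
proof
  assume g0: "level B z0 = 0"
  define w where "w = cnj z0"
  have ne: "z0 \<noteq> - z0" "z0 \<noteq> w" "z0 \<noteq> - w" "w \<noteq> - z0" "w \<noteq> - w"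
    using z by (auto simp: w_def complex_eq_iff)
  have z1: "level B (- z0) = 0" "level B w = 0" "level B (- w) = 0"
    using g0 by (simp_all add: w_def level_even level_cnj)
  obtain g1 where g1: "PW_decay (Suc 0) g1" "\<And>z. level B z = (z - z0) * g1 z"
    using PW_decay_divide[OF PW_decay_level g0] by blast
  have a1: "g1 (- z0) = 0" using g1(2)[of "- z0"] z1(1) ne(1) by auto
  obtain g2 where g2: "PW_decay (Suc (Suc 0)) g2" "\<And>z. g1 z = (z - (- z0)) * g2 z"
    using PW_decay_divide[OF g1(1) a1] by blast
  have a2: "g2 w = 0" using g1(2)[of w] g2(2)[of w] z1(2) ne by (auto simp: eq_neg_iff_add_eq_0)
  obtain g3 where g3: "PW_decay (Suc (Suc (Suc 0))) g3" "\<And>z. g2 z = (z - w) * g3 z"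
    using PW_decay_divide[OF g2(1) a2] by blast
  have a3: "g3 (- w) = 0"
    using g1(2)[of "- w"] g2(2)[of "- w"] g3(2)[of "- w"] z1(3) ne by (auto simp: eq_neg_iff_add_eq_0)
  obtain g4 where g4: "PW_decay (Suc (Suc (Suc (Suc 0)))) g4" "\<And>z. g3 z = (z - (- w)) * g4 z"
    using PW_decay_divide[OF g3(1) a3] by blast
  define T where "T = (\<lambda>z. z * (z * g4 z))"
  have T: "PW_decay 2 T" unfolding T_def numeral_2_eq_2
    by (intro PW_decay_times_ident g4(1))
  define k where "k = (\<lambda>x. (norm ((of_real x)\<^sup>2 - z0\<^sup>2))\<^sup>2)"
  have kpos: "k x > 0" for x
  proof -
    have "Im (z0\<^sup>2) \<noteq> 0" using z by (simp add: power2_eq_square)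
    then have "(of_real x)\<^sup>2 - z0\<^sup>2 \<noteq> 0" by (metis Im_complex_of_real eq_iff_diff_eq_0 of_real_power)
    then show ?thesis by (simp add: k_def)
  qed
  have lev: "level B (of_real x) = of_real (k x) * g4 (of_real x)" for x
  proof -
    have "level B (of_real x) = ((of_real x)\<^sup>2 - z0\<^sup>2) * ((of_real x)\<^sup>2 - w\<^sup>2) * g4 (of_real x)"
      by (simp add: g1(2) g2(2) g3(2) g4(2) power2_eq_square algebra_simps)
    also have "(of_real x)\<^sup>2 - w\<^sup>2 = cnj ((of_real x)\<^sup>2 - z0\<^sup>2)" by (simp add: w_def)
    also have "((of_real x)\<^sup>2 - z0\<^sup>2) * cnj ((of_real x)\<^sup>2 - z0\<^sup>2) = of_real (k x)"
      unfolding k_def by (rule complex_norm_square[symmetric])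
    finally show ?thesis .
  qed
  define \<rho> where "\<rho> = (\<lambda>x. x\<^sup>2 / k x)"
  define t where "t = (\<lambda>x. \<rho> x * (Re (\<phi> (of_real x)) - B * cos (pi * x)))"
  have "t 0 > 0"
  proof (rule positivity[OF T, where \<rho> = \<rho> and B = B])
    show "T (of_real x) = of_real (t x)" for x
    proof -
      have "g4 (of_real x) = level B (of_real x) / of_real (k x)" using kpos[of x] by (simp add: lev)
      then have "T (of_real x) = of_real (x\<^sup>2) * (level B (of_real x) / of_real (k x))"
        by (simp add: T_def power2_eq_square)
      also have "\<dots> = of_real (t x)" unfolding level_on_reals t_def \<rho>_def by simp
      finally show ?thesis .
    qed
    show "\<rho> x > 0" if "x \<noteq> 0" for x using that kpos[of x] by (simp add: \<rho>_def)
  qed (simp add: t_def)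
  then show False by (simp add: t_def \<rho>_def)
qed

text \<open>Here the positivity principle is applied to \<open>(\<phi> z - cos (pi z)) / z^2\<close>. It says that the quotient
  of \<open>\<phi>\<close> by the cosine has a strict local minimum at the origin along the real line.\<close>

lemma second_order_at_0:
  obtains T \<tau> where "T holomorphic_on UNIV" "\<And>z. \<phi> z = cos (of_real pi * z) + z\<^sup>2 * T z" "T 0 = of_real \<tau>" "\<tau> > 0"
proof -
  have g0: "level 1 0 = 0" by (simp add: level_def at_0)
  obtain g1 where g1: "PW_decay (Suc 0) g1" "\<And>z. level 1 z = (z - 0) * g1 z"
    using PW_decay_divide[OF PW_decay_level g0] by blast
  note h1 = PW_decay_holomorphic[OF g1(1)]
  have odd: "g1 (- z) = - g1 z" if "z \<noteq> 0" for z
    using g1(2)[of z] g1(2)[of "-z"] level_even[of 1 z] that by (simp add: eq_neg_iff_add_eq_0 add.commute flip: distrib_left)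
  have "g1 0 = - g1 0"
  proof (rule tendsto_unique[of "at (0::complex)"])
    have c0: "isCont g1 0" by (rule isCont_entire[OF h1])
    then show "(g1 \<longlongrightarrow> g1 0) (at 0)" by (simp add: isCont_def)
    have "((\<lambda>z. - g1 (- z)) \<longlongrightarrow> - g1 (- 0)) (at 0)"
      using c0 by (intro tendsto_intros isCont_tendsto_compose[of _ g1]) auto
    moreover have "\<forall>\<^sub>F z in at 0. - g1 (- z) = g1 z" using odd by (auto simp: eventually_at_filter)
    ultimately show "(g1 \<longlongrightarrow> - g1 0) (at 0)" by (simp add: filterlim_cong)
  qed simp
  then have a1: "g1 0 = 0" by (simp add: equal_neg_zero)
  obtain T where T: "PW_decay (Suc (Suc 0)) T" "\<And>z. g1 z = (z - 0) * T z"
    using PW_decay_divide[OF g1(1) a1] by blast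
  have T2: "PW_decay 2 T" using T(1) by (simp add: numeral_2_eq_2)
  have lev: "level 1 z = z\<^sup>2 * T z" for z by (simp add: g1(2) T(2) power2_eq_square)
  have Treal: "T (of_real x) = of_real ((Re (\<phi> (of_real x)) - 1 * cos (pi * x)) / x\<^sup>2)" if "x \<noteq> 0" for x
    using level_on_reals[of 1 x] lev[of "of_real x"] that by (simp add: field_simps)
  define t where "t = (\<lambda>x. Re (T (of_real x)))"
  have im: "Im (T (of_real x)) = 0" for x
  proof (rule AE_eq_continuous_imp_eq[of "\<lambda>x. Im (T (of_real x))" "\<lambda>x. 0"])
    show "AE x in lborel. Im (T (of_real x)) = 0"
      using AE_neq_lborel[of 0] by eventually_elim (simp add: Treal)
    show "continuous_on UNIV (\<lambda>x. Im (T (of_real x)))"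
      by (intro continuous_intros continuous_on_real_axis PW_decay_holomorphic[OF T(1)])
  qed auto
  have Tt: "T (of_real x) = of_real (t x)" for x using im[of x] by (simp add: t_def complex_eq_iff)
  have "t 0 > 0"
  proof (rule positivity[OF T2 Tt])
    show "0 < 1 / x\<^sup>2" if "x \<noteq> 0" for x :: real using that by simp
    show "t x = 1 / x\<^sup>2 * (Re (\<phi> (of_real x)) - 1 * cos (pi * x))" if "x \<noteq> 0" for x
      using Treal[OF that] by (simp add: t_def)
  qed
  moreover have "\<phi> z = cos (of_real pi * z) + z\<^sup>2 * T z" for z using lev[of z] by (simp add: level_def algebra_simps)
  ultimately show ?thesis using that[of T "t 0"] PW_decay_holomorphic[OF T(1)] Tt[of 0] by simp
qed

text \<open>At a zero \<open>\<i> y\<close> the function \<open>\<phi> z / (z^2 + y^2)\<close> is an admissible test function. The Euler--Lagrange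
  equation then says that \<open>1 / (x^2 + y^2)\<close> has the mean \<open>1 / y^2\<close> with respect to \<open>|\<phi>|^p dx\<close>, but it
  is smaller than this except at the origin.\<close>

lemma nonzero_on_imaginary_axis:
  "\<phi> (\<i> * of_real y) \<noteq> 0"
proof
  assume z0: "\<phi> (\<i> * of_real y) = 0"
  then have y: "y \<noteq> 0" using at_0 by (cases "y = 0") auto
  define a where "a = \<i> * of_real y"
  have z1: "\<phi> (- a) = 0" using z0 by (simp add: a_def even)
  obtain g1 where g1: "PW_decay (Suc 0) g1" "\<And>z. \<phi> z = (z - a) * g1 z"
    using PW_decay_divide[OF PW_decay_extremal z0[folded a_def]] by blast
  have a0: "a \<noteq> - a" using y by (simp add: a_def complex_eq_iff)
  have a1: "g1 (- a) = 0" using g1(2)[of "- a"] z1 a0 by auto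
  obtain T where T: "PW_decay (Suc (Suc 0)) T" "\<And>z. g1 z = (z - (- a)) * T z"
    using PW_decay_divide[OF g1(1) a1] by blast
  have T2: "PW_decay 2 T" using T(1) by (simp add: numeral_2_eq_2)
  define r where "r = (\<lambda>x. Re (\<phi> (of_real x)))"
  define t where "t = (\<lambda>x. r x / (x\<^sup>2 + y\<^sup>2))"
  have pos: "x\<^sup>2 + y\<^sup>2 > 0" for x using y by (simp add: add_nonneg_pos)
  have Tt: "T (of_real x) = of_real (t x)" for x
  proof -
    have "of_real (r x) = \<phi> (of_real x)" by (simp add: r_def real_on_reals[symmetric])
    also have "\<dots> = (of_real x - a) * ((of_real x + a) * T (of_real x))"
      by (simp add: g1(2)[of "of_real x"] T(2)[of "of_real x"])
    also have "\<dots> = of_real (x\<^sup>2 + y\<^sup>2) * T (of_real x)"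
      by (simp add: a_def power2_eq_square algebra_simps)
    finally have e: "of_real (r x) = of_real (x\<^sup>2 + y\<^sup>2) * T (of_real x)" .
    have nz: "complex_of_real (x\<^sup>2 + y\<^sup>2) \<noteq> 0" using pos[of x] unfolding of_real_eq_0_iff by linarith
    have "T (of_real x) = of_real (r x) / of_real (x\<^sup>2 + y\<^sup>2)"
      unfolding e using nz by (rule nonzero_mult_div_cancel_left[symmetric])
    then show ?thesis by (simp only: t_def of_real_divide)
  qed
  note EL = Euler_Lagrange[OF PW_decay_holomorphic[OF T2] PW_decay_exponential_type[OF T2] Tt PW_decay_2_integrable(2)[OF T2 p1(2)]]
  have eq: "sgn_powr (p - 1) (r x) * t x = \<bar>r x\<bar> powr p / (x\<^sup>2 + y\<^sup>2)" for x
    by (simp add: t_def sgn_powr_times_self)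
  have i1: "integrable lborel (\<lambda>x. \<bar>r x\<bar> powr p / (x\<^sup>2 + y\<^sup>2))"
    using EL(1) unfolding eq[symmetric] by (simp add: r_def)
  have i2: "integrable lborel (\<lambda>x. \<bar>r x\<bar> powr p / y\<^sup>2)"
    using integrable by (simp add: r_def norm_on_reals)
  have "(\<integral>x. \<bar>r x\<bar> powr p / (x\<^sup>2 + y\<^sup>2) \<partial>lborel) = c / y\<^sup>2"
    using EL(2) unfolding eq[symmetric] by (simp add: r_def t_def at_0)
  moreover have "(\<integral>x. \<bar>r x\<bar> powr p / y\<^sup>2 \<partial>lborel) = c / y\<^sup>2"
    by (simp add: c_def r_def norm_on_reals)
  ultimately have "(\<integral>x. \<bar>r x\<bar> powr p / y\<^sup>2 - \<bar>r x\<bar> powr p / (x\<^sup>2 + y\<^sup>2) \<partial>lborel) = 0"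
    by (subst Bochner_Integration.integral_diff[OF i2 i1]) simp
  moreover have le: "0 \<le> \<bar>r x\<bar> powr p / y\<^sup>2 - \<bar>r x\<bar> powr p / (x\<^sup>2 + y\<^sup>2)" for x
    using y pos[of x] by (simp add: divide_left_mono)
  ultimately have "AE x in lborel. \<bar>r x\<bar> powr p / y\<^sup>2 - \<bar>r x\<bar> powr p / (x\<^sup>2 + y\<^sup>2) = 0"
    using integral_nonneg_eq_0_iff_AE[OF Bochner_Integration.integrable_diff[OF i2 i1]] by simp
  then have "AE x in lborel. r x = 0"
    using AE_neq_lborel[of 0]
  proof eventually_elim
    case (elim x)
    have "1 / (x\<^sup>2 + y\<^sup>2) < 1 / y\<^sup>2"
      using y pos[of x] elim(2) by (intro divide_strict_left_mono) auto
    moreover have "\<bar>r x\<bar> powr p * (1 / y\<^sup>2 - 1 / (x\<^sup>2 + y\<^sup>2)) = 0"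
      using elim(1) by (simp add: right_diff_distrib)
    ultimately show ?case using elim(2) by auto
  qed
  from AE_eq_continuous_imp_eq[OF this _ continuous_on_const, of 0] continuous_extremal show False
    by (simp add: r_def at_0)
qed

end

lemma cos_pi_nonzero_off_real:
  assumes "Im z \<noteq> 0"
  shows "cos (of_real pi * z) \<noteq> 0"
proof
  assume "cos (of_real pi * z) = 0"
  then obtain n :: int where "of_real pi * z = of_real (real_of_int n * pi) + of_real pi / 2"
    unfolding cos_eq_0 by auto
  then have "Im (of_real pi * z) = Im (of_real (real_of_int n * pi) + of_real pi / 2)" by simp
  then show False using assms by simp
qed

lemma cos_pi_pos_half:
  assumes "\<bar>v\<bar> < 1/2"
  shows "cos (pi * v) > 0"
  using assms mult_strict_left_mono[of "-1/2" v pi] mult_strict_left_mono[of v "1/2" pi]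
  by (intro cos_gt_zero_pi) auto

lemma cos_pi_nonzero_strip:
  fixes k :: int and x :: real
  assumes "\<bar>x - k\<bar> < 1/2"
  shows "cos (pi * x) \<noteq> 0"
proof -
  have "cos (pi * x) = cos (pi * (x - k) + pi * k)" by (simp add: algebra_simps)
  also have "\<dots> = cos (pi * (x - k)) * cos (pi * k)" by (simp add: cos_add sin_npi_int mult.commute)
  finally show ?thesis using cos_pi_pos_half[OF assms] by (simp add: cos_npi_int mult.commute)
qed

context extremal
begin

definition quot :: "complex \<Rightarrow> complex" where
  "quot z = \<phi> z / cos (of_real pi * z)"

definition quot_real :: "real \<Rightarrow> real" where
  "quot_real x = Re (\<phi> (of_real x)) / cos (pi * x)"

lemma quot_on_reals: "quot (of_real x) = of_real (quot_real x)"
  unfolding quot_def quot_real_def by (subst real_on_reals) (simp add: cos_of_real[symmetric])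

lemma quot_reflect: "quot (- cnj z) = cnj (quot z)"
  by (simp add: quot_def real even cnj_cos)

lemma quot_holomorphic: "quot holomorphic_on {z. cos (of_real pi * z) \<noteq> 0}"
  unfolding quot_def[abs_def] by (intro holomorphic_intros holomorphic_on_subset[OF hol]) auto

lemma quot_Im_nonzero:
  assumes "Re z > 0" "Im z > 0"
  shows "Im (quot z) \<noteq> 0"
proof
  assume "Im (quot z) = 0"
  then have "quot z = of_real (Re (quot z))" by (simp add: complex_eq_iff)
  then have "\<phi> z = of_real (Re (quot z)) * cos (of_real pi * z)"
    using cos_pi_nonzero_off_real[of z] assms by (simp add: quot_def field_simps)
  then have "level (Re (quot z)) z = 0" by (simp add: level_def)
  then show False using level_nonzero_in_quadrant[OF assms] by blast
qed

text \<open>The imaginary part has no zeros in the quadrant, so its sign can be read off near the origin, where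
  the quotient is \<open>1 + \<tau> z^2 + \<dots>\<close> with \<open>\<tau> > 0\<close>. The diagonal \<open>z = r (1 + \<i>)\<close> makes \<open>z^2\<close> purely
  imaginary.\<close>

lemma quot_Im_pos:
  assumes z: "Re z > 0" "Im z > 0"
  shows "Im (quot z) > 0"
proof -
  obtain T \<tau> where T: "T holomorphic_on UNIV" "\<And>z. \<phi> z = cos (of_real pi * z) + z\<^sup>2 * T z" "T 0 = of_real \<tau>" "\<tau> > 0"
    using second_order_at_0 by blast
  define U where "U = {z. Re z > 0 \<and> Im z > 0}"
  define d where "d = (\<lambda>r::real. Complex r r)"
  have "isCont (\<lambda>z. T z / cos (of_real pi * z)) 0"
    using holomorphic_on_imp_continuous_on[OF T(1)] by (auto intro!: continuous_intros simp: continuous_on_eq_continuous_at)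
  moreover have "(d \<longlongrightarrow> Complex 0 0) (at_right 0)" unfolding d_def by (intro tendsto_intros)
  then have "(d \<longlongrightarrow> 0) (at_right 0)" by (simp only: Complex_eq of_real_0 mult_zero_right add_0_left)
  ultimately have "((\<lambda>r. T (d r) / cos (of_real pi * d r)) \<longlongrightarrow> T 0 / cos (of_real pi * 0)) (at_right 0)"
    by (intro isCont_tendsto_compose[of _ "\<lambda>z. T z / cos (of_real pi * z)"]) auto
  then have "((\<lambda>r. Re (T (d r) / cos (of_real pi * d r))) \<longlongrightarrow> Re (of_real \<tau>)) (at_right 0)"
    using T(3) by (intro tendsto_intros) simp
  then have "((\<lambda>r. Re (T (d r) / cos (of_real pi * d r))) \<longlongrightarrow> \<tau>) (at_right 0)" by simp
  from order_tendstoD(1)[OF this T(4)]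
  have "\<forall>\<^sub>F r in at_right 0. 0 < Re (T (d r) / cos (of_real pi * d r)) \<and> r > 0"
    by (intro eventually_conj eventually_at_right_less)
  then obtain r where r: "0 < Re (T (d r) / cos (of_real pi * d r))" "r > 0"
    using eventually_happens'[OF trivial_limit_at_right_real] by blast
  have dU: "d r \<in> U" using r by (simp add: U_def d_def)
  have "cos (of_real pi * d r) \<noteq> 0" using r by (intro cos_pi_nonzero_off_real) (simp add: d_def)
  then have "quot (d r) = 1 + (d r)\<^sup>2 * (T (d r) / cos (of_real pi * d r))"
    by (simp add: quot_def T(2)[of "d r"] add_divide_distrib)
  moreover have "(d r)\<^sup>2 = \<i> * of_real (2 * r\<^sup>2)" by (simp add: d_def complex_eq_iff power2_eq_square)
  moreover have "Im (1 + \<i> * of_real a * W) = a * Re W" for a W by simp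
  ultimately have "Im (quot (d r)) = 2 * r\<^sup>2 * Re (T (d r) / cos (of_real pi * d r))" by (simp only:)
  then have pos: "Im (quot (d r)) > 0" using r by simp
  have "U = {z. Re z > 0} \<inter> {z. Im z > 0}" by (auto simp: U_def)
  then have "convex U" by (simp add: convex_Int convex_halfspace_Re_gt convex_halfspace_Im_gt)
  then have cU: "connected U" by (rule convex_connected)
  have "continuous_on U (\<lambda>z. Im (quot z))"
    by (intro continuous_intros holomorphic_on_imp_continuous_on holomorphic_on_subset[OF quot_holomorphic])
       (auto simp: U_def cos_pi_nonzero_off_real)
  then have con: "connected ((\<lambda>z. Im (quot z)) ` U)" using cU by (rule connected_continuous_image)
  show ?thesis
  proof (rule ccontr)
    assume "\<not> Im (quot z) > 0"
    then have "Im (quot z) \<le> 0" by simp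
    moreover have "z \<in> U" using z by (simp add: U_def)
    ultimately have "0 \<in> (\<lambda>z. Im (quot z)) ` U"
      using connectedD_interval[OF con, of "Im (quot z)" "Im (quot (d r))" 0] dU pos by auto
    then show False using quot_Im_nonzero by (auto simp: U_def)
  qed
qed

lemma quot_pos_on_imaginary_axis:
  assumes "y \<ge> 0"
  shows "quot (\<i> * of_real y) = of_real (Re (quot (\<i> * of_real y)))" and "Re (quot (\<i> * of_real y)) > 0"
proof -
  have im\<phi>: "Im (\<phi> (\<i> * of_real y)) = 0" for y
  proof -
    have "cnj (\<phi> (\<i> * of_real y)) = \<phi> (- (\<i> * of_real y))" by (simp add: real[symmetric])
    then have "Im (cnj (\<phi> (\<i> * of_real y))) = Im (\<phi> (\<i> * of_real y))" by (simp only: even)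
    then show ?thesis by simp
  qed
  have c: "cos (of_real pi * (\<i> * of_real y)) = of_real (cosh (pi * y))" for y
  proof -
    have e: "\<i> * (of_real pi * (\<i> * of_real y)) = of_real (- (pi * y))" by (simp add: complex_eq_iff)
    have "cos (of_real pi * (\<i> * of_real y)) = (exp (of_real (- (pi * y))) + exp (- of_real (- (pi * y)))) / 2"
      unfolding cos_exp_eq e by (rule refl)
    also have "\<dots> = of_real ((exp (- (pi * y)) + exp (pi * y)) / 2)"
      by (simp only: exp_of_real of_real_minus[symmetric] minus_minus of_real_add of_real_divide of_real_numeral)
    finally show ?thesis by (simp add: cosh_field_def add.commute)
  qed
  define u where "u = (\<lambda>y. Re (\<phi> (\<i> * of_real y)))"
  have \<phi>u: "\<phi> (\<i> * of_real y) = of_real (u y)" for y using im\<phi>[of y] by (simp add: u_def complex_eq_iff)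
  have nz: "u y \<noteq> 0" for y using nonzero_on_imaginary_axis[of y] by (simp add: \<phi>u)
  have cu: "continuous_on {0..y} u" unfolding u_def
    by (intro continuous_intros continuous_on_compose2[OF holomorphic_on_imp_continuous_on[OF hol]]) auto
  have "u y > 0"
  proof (rule ccontr)
    assume "\<not> u y > 0"
    then have "\<exists>x\<ge>0. x \<le> y \<and> u x = 0" using cu assms by (intro IVT2') (auto simp: u_def at_0)
    then show False using nz by blast
  qed
  then show "quot (\<i> * of_real y) = of_real (Re (quot (\<i> * of_real y)))" and "Re (quot (\<i> * of_real y)) > 0"
    unfolding quot_def c \<phi>u by (simp_all add: cosh_real_pos)
qed

text \<open>On the imaginary axis the quotient is real, starts from \<open>1\<close> and has no zeros; off the axis it is
  never real. So the principal logarithm of the quotient is available in the whole upper half-plane.\<close>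

lemma quot_slit:
  assumes "Im z > 0"
  shows "quot z \<notin> \<real>\<^sub>\<le>\<^sub>0"
proof -
  consider "Re z > 0" | "Re z < 0" | "Re z = 0" by linarith
  then show ?thesis
  proof cases
    case 1
    then show ?thesis using quot_Im_pos[OF 1 assms] by (simp add: complex_nonpos_Reals_iff)
  next
    case 2
    then have "Im (quot (- cnj z)) > 0" using assms by (intro quot_Im_pos) auto
    then show ?thesis by (simp add: quot_reflect complex_nonpos_Reals_iff)
  next
    case 3
    then have "z = \<i> * of_real (Im z)" by (simp add: complex_eq_iff)
    then have "Re (quot z) > 0" using quot_pos_on_imaginary_axis(2)[of "Im z"] assms by (metis less_imp_le)
    then show ?thesis by (simp add: complex_nonpos_Reals_iff)
  qed
qed

text \<open>A function that is real on the real axis and maps the points just above it into the upper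
  half-plane increases along it.\<close>

lemma quot_real_deriv_nonneg:
  assumes x: "x \<ge> 0" and c: "cos (pi * x) \<noteq> 0"
  shows "\<exists>D. (quot_real has_real_derivative D) (at x) \<and> D \<ge> 0"
proof -
  have c': "cos (of_real pi * of_real x) \<noteq> (0::complex)" using c
    by (metis cos_of_real of_real_eq_0_iff of_real_mult)
  have op: "open {z. cos (of_real pi * z) \<noteq> (0::complex)}"
    by (intro open_Collect_neq continuous_intros)
  obtain D where D: "(quot has_field_derivative D) (at (of_real x))"
    using holomorphic_on_imp_differentiable_at[OF quot_holomorphic op] c' by (auto simp: field_differentiable_def)
  have "((\<lambda>t. quot (of_real t)) has_vector_derivative D) (at x)"
    using has_vector_derivative_real_field[OF D] .
  then have "((\<lambda>t. Re (quot (of_real t))) has_vector_derivative Re D) (at x)"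
    by (rule bounded_linear.has_vector_derivative[OF bounded_linear_Re])
  then have dr: "(quot_real has_real_derivative Re D) (at x)"
    by (simp add: quot_on_reals has_real_derivative_iff_has_vector_derivative)
  have "((\<lambda>h. (quot (of_real x + h) - quot (of_real x)) / h) \<longlongrightarrow> D) (at 0)"
    using D by (simp add: DERIV_def)
  moreover have "filterlim (\<lambda>e. \<i> * complex_of_real e) (at 0) (at_right 0)"
  proof -
    have "((\<lambda>e. \<i> * complex_of_real e) \<longlongrightarrow> \<i> * of_real 0) (at_right 0)" by (intro tendsto_intros)
    then show ?thesis by (auto simp: filterlim_at eventually_at_filter)
  qed
  ultimately have "((\<lambda>e. (quot (of_real x + \<i> * of_real e) - quot (of_real x)) / (\<i> * of_real e)) \<longlongrightarrow> D) (at_right 0)"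
    by (rule filterlim_compose)
  then have lim: "((\<lambda>e. Re ((quot (of_real x + \<i> * of_real e) - quot (of_real x)) / (\<i> * of_real e))) \<longlongrightarrow> Re D) (at_right 0)"
    by (intro tendsto_intros)
  have "0 \<le> Re ((quot (of_real x + \<i> * of_real e) - quot (of_real x)) / (\<i> * of_real e))" if e: "e > 0" for e
  proof -
    have "Im (quot (of_real x + \<i> * of_real e)) \<ge> 0"
    proof (cases "x = 0")
      case True
      have "Im (quot (\<i> * of_real e)) = Im (of_real (Re (quot (\<i> * of_real e))))"
        using quot_pos_on_imaginary_axis(1)[of e] e by (metis less_imp_le)
      then show ?thesis using True by simp
    next
      case False
      then have "Im (quot (of_real x + \<i> * of_real e)) > 0" using x e by (intro quot_Im_pos) auto
      then show ?thesis by simp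
    qed
    moreover have "(quot (of_real x + \<i> * of_real e) - quot (of_real x)) / (\<i> * of_real e)
       = - \<i> * (quot (of_real x + \<i> * of_real e) - of_real (quot_real x)) / of_real e"
      using e by (simp add: quot_on_reals divide_simps)
    ultimately show ?thesis using e by (simp add: Re_divide_of_real)
  qed
  then have "Re D \<ge> 0"
    by (intro tendsto_lowerbound[OF lim]) (auto simp: eventually_at_filter)
  then show ?thesis using dr by blast
qed

lemma quot_real_mono:
  fixes k :: int
  assumes "0 \<le> x" "x \<le> y" "k - 1/2 < x" "y < k + 1/2"
  shows "quot_real x \<le> quot_real y"
proof (rule DERIV_nonneg_imp_nondecreasing[OF assms(2)])
  fix t assume t: "x \<le> t" "t \<le> y"
  have "\<bar>t - k\<bar> < 1/2" using t assms by (simp add: abs_if)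
  from quot_real_deriv_nonneg[OF _ cos_pi_nonzero_strip[OF this]] t assms(1)
  show "\<exists>D. (quot_real has_real_derivative D) (at t) \<and> D \<ge> 0" by force
qed

section \<open>A branch of the power p/2 in the upper half-plane\<close>

text \<open>The function \<open>cos (pi z) * exp (\<i> pi z)\<close>, written in a form that shows its positive real part in
  the upper half-plane.\<close>

definition cos_times_exp :: "complex \<Rightarrow> complex" where
  "cos_times_exp z = (1 + exp (2 * \<i> * of_real pi * z)) / 2"

lemma quot_times_cos_times_exp:
  assumes "cos (of_real pi * z) \<noteq> 0"
  shows "quot z * cos_times_exp z = \<phi> z * exp (\<i> * of_real pi * z)"
proof -
  have "cos_times_exp z = cos (of_real pi * z) * exp (\<i> * of_real pi * z)"
    by (simp add: cos_times_exp_def cos_exp_eq add_divide_distrib distrib_right exp_add[symmetric] algebra_simps)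
  then show ?thesis using assms by (simp add: quot_def)
qed

lemma Re_cos_times_exp:
  assumes "Im z > 0"
  shows "Re (cos_times_exp z) > 0"
proof -
  have "norm (exp (2 * \<i> * of_real pi * z)) < 1" using assms by simp
  then have "\<bar>Re (exp (2 * \<i> * of_real pi * z))\<bar> < 1" using abs_Re_le_cmod le_less_trans by blast
  then show ?thesis unfolding cos_times_exp_def by (simp add: abs_if split: if_splits)
qed

lemma cos_times_exp_on_reals:
  fixes k :: int and x :: real
  assumes "\<bar>x - k\<bar> < 1/2"
  shows "Ln (cos_times_exp (of_real x)) = of_real (ln (cos (pi * (x - k)))) + \<i> * of_real (pi * (x - k))"
    and "Re (cos_times_exp (of_real x)) > 0"
proof -
  define v where "v = x - k"
  have v: "\<bar>v\<bar> < 1/2" using assms by (simp add: v_def)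
  have c: "cos (pi * v) > 0" by (rule cos_pi_pos_half[OF v])
  have e: "exp (2 * \<i> * of_real pi * of_real x) = exp (2 * \<i> * of_real pi * of_real v)"
  proof -
    have "2 * \<i> * of_real pi * of_real x = 2 * \<i> * of_real pi * of_real v + 2 * of_int k * of_real pi * \<i>"
      by (simp add: v_def algebra_simps)
    then show ?thesis by (simp add: exp_add exp_integer_2pi[of "of_int k"] mult_ac)
  qed
  have h: "cos_times_exp (of_real x) = of_real (cos (pi * v)) * exp (\<i> * of_real (pi * v))"
    unfolding cos_times_exp_def e
    by (simp add: cos_of_real[symmetric] cos_exp_eq add_divide_distrib distrib_right exp_add[symmetric] algebra_simps)
  show "Re (cos_times_exp (of_real x)) > 0" unfolding h using c by (simp add: Re_exp)
  have "exp (of_real (ln (cos (pi * v))) + \<i> * of_real (pi * v)) = cos_times_exp (of_real x)"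
    unfolding h exp_add using c by (simp add: exp_of_real)
  moreover have "\<bar>pi * v\<bar> < pi / 2" using mult_strict_left_mono[OF v pi_gt_zero] by (simp add: abs_mult)
  then have "- pi < pi * v" "pi * v \<le> pi" using pi_gt_zero unfolding abs_less_iff by linarith+
  ultimately show "Ln (cos_times_exp (of_real x)) = of_real (ln (cos (pi * (x - k)))) + \<i> * of_real (pi * (x - k))"
    unfolding v_def[symmetric] by (intro Ln_unique) (simp_all del: of_real_mult)
qed

text \<open>The power \<open>(\<phi> z * exp (\<i> pi z)) powr (p / 2)\<close>. Splitting the base into two factors that avoid the
  branch cut makes the principal logarithm usable and the boundary phase explicit.\<close>

definition branch :: "complex \<Rightarrow> complex" where
  "branch z = exp (of_real (p / 2) * (Ln (quot z) + Ln (cos_times_exp z)))"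

lemma branch_holomorphic: "branch holomorphic_on {z. Im z > 0}"
proof -
  have q: "quot holomorphic_on {z. Im z > 0}"
    by (rule holomorphic_on_subset[OF quot_holomorphic]) (auto simp: cos_pi_nonzero_off_real)
  have h: "cos_times_exp holomorphic_on {z. Im z > 0}" unfolding cos_times_exp_def[abs_def] by (intro holomorphic_intros) auto
  have nh: "cos_times_exp z \<notin> \<real>\<^sub>\<le>\<^sub>0" if "Im z > 0" for z using Re_cos_times_exp[OF that] by (simp add: complex_nonpos_Reals_iff)
  show ?thesis unfolding branch_def[abs_def]
    by (intro holomorphic_intros q h) (use quot_slit nh in auto)
qed

lemma norm_branch:
  assumes "Im z > 0"
  shows "norm (branch z) = norm (\<phi> z * exp (\<i> * of_real pi * z)) powr (p / 2)"
proof -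
  have q: "quot z \<noteq> 0" using quot_slit[OF assms] by auto
  have h: "cos_times_exp z \<noteq> 0" using Re_cos_times_exp[OF assms] by auto
  have "norm (branch z) = exp (p / 2 * (ln (norm (quot z)) + ln (norm (cos_times_exp z))))"
    using q h by (simp add: branch_def)
  also have "\<dots> = exp (p / 2 * ln (norm (quot z * cos_times_exp z)))" using q h by (simp add: norm_mult ln_mult)
  also have "quot z * cos_times_exp z = \<phi> z * exp (\<i> * of_real pi * z)"
    using quot_times_cos_times_exp[OF cos_pi_nonzero_off_real[of z]] assms by simp
  finally show ?thesis using q h quot_times_cos_times_exp[OF cos_pi_nonzero_off_real[of z]] assms
    by (auto simp: powr_def)
qed

lemma branch_bounded:
  obtains M where "M \<ge> 0" "\<And>z. Im z > 0 \<Longrightarrow> norm (branch z) \<le> M"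
proof -
  obtain K where K: "\<And>z. norm (\<phi> z) \<le> K * exp (pi * \<bar>Im z\<bar>)" using growth by blast
  have "norm (branch z) \<le> K powr (p / 2)" if z: "Im z > 0" for z
  proof -
    have "norm (\<phi> z * exp (\<i> * of_real pi * z)) \<le> (K * exp (pi * Im z)) * exp (- (pi * Im z))"
      using K[of z] z by (simp add: norm_mult)
    also have "\<dots> = K" by (simp add: mult.assoc exp_add[symmetric])
    finally show ?thesis unfolding norm_branch[OF z] using p2 by (intro powr_mono2) auto
  qed
  then show ?thesis using that[of "K powr (p / 2)"] by simp
qed

lemma branch_reflect:
  assumes "Im z > 0"
  shows "branch (- cnj z) = cnj (branch z)"
proof -
  have h: "cos_times_exp (- cnj z) = cnj (cos_times_exp z)" by (simp add: cos_times_exp_def exp_cnj)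
  have nh: "cos_times_exp z \<notin> \<real>\<^sub>\<le>\<^sub>0" using Re_cos_times_exp[OF assms] by (simp add: complex_nonpos_Reals_iff)
  show ?thesis unfolding branch_def h quot_reflect
    using cnj_Ln[OF quot_slit[OF assms]] cnj_Ln[OF nh] by (simp add: exp_cnj)
qed

lemma branch_on_imaginary_axis:
  assumes "y > 0"
  shows "branch (\<i> * of_real y) = of_real ((norm (\<phi> (\<i> * of_real y)) * exp (- (pi * y))) powr (p / 2))"
proof -
  define q where "q = Re (quot (\<i> * of_real y))"
  have q: "quot (\<i> * of_real y) = of_real q" "q > 0"
    using quot_pos_on_imaginary_axis[of y] assms by (auto simp: q_def)
  define h where "h = (1 + exp (- 2 * pi * y)) / 2"
  have e: "2 * \<i> * of_real pi * (\<i> * of_real y) = of_real (- 2 * pi * y)"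
    by (simp add: complex_eq_iff)
  have h: "cos_times_exp (\<i> * of_real y) = of_real h" "h > 0"
    unfolding cos_times_exp_def h_def e exp_of_real by (auto simp: add_pos_pos)
  have "branch (\<i> * of_real y) = of_real (exp (p / 2 * (ln q + ln h)))"
    using q h by (simp add: branch_def Ln_of_real exp_of_real[symmetric])
  then have "branch (\<i> * of_real y) = of_real (norm (branch (\<i> * of_real y)))" by simp
  then show ?thesis using norm_branch[of "\<i> * of_real y"] assms by (simp add: norm_mult)
qed

lemma branch_at_0:
  "((\<lambda>y. (norm (\<phi> (\<i> * of_real y)) * exp (- (pi * y))) powr (p / 2)) \<longlongrightarrow> 1) (at_right 0)"
proof -
  have "isCont \<phi> 0" by (rule isCont_entire[OF hol])
  moreover have "((\<lambda>y. \<i> * complex_of_real y) \<longlongrightarrow> \<i> * of_real 0) (at_right 0)" by (intro tendsto_intros)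
  ultimately have "((\<lambda>y. \<phi> (\<i> * of_real y)) \<longlongrightarrow> \<phi> 0) (at_right 0)" by (intro isCont_tendsto_compose[of _ \<phi>]) auto
  then have "((\<lambda>y. (norm (\<phi> (\<i> * of_real y)) * exp (- (pi * y))) powr (p / 2)) \<longlongrightarrow> (norm (\<phi> 0) * exp (- (pi * 0))) powr (p / 2)) (at_right 0)"
    by (intro tendsto_intros) (auto simp: at_0)
  then show ?thesis by (simp add: at_0)
qed

text \<open>The boundary phase of the branch at \<open>x > 0\<close>. With \<open>k = round x\<close> the factor \<open>cos_times_exp\<close>
  contributes \<open>pi (x - k)\<close>, and the quotient contributes \<open>0\<close> or \<open>pi\<close> according to its sign, since it is
  approached from the upper half-plane.\<close>

definition phase :: "real \<Rightarrow> real" where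
  "phase x = p / 2 * (pi * (x - of_int (round x)) + (if quot_real x < 0 then pi else 0))"

text \<open>Boundary values on the negative axis follow from the symmetry \<open>z \<mapsto> - cnj z\<close>.\<close>

definition bdry_branch :: "real \<Rightarrow> complex" where
  "bdry_branch x = (if x > 0 then of_real (norm (\<phi> (of_real x)) powr (p / 2)) * exp (\<i> * of_real (phase x))
     else cnj (of_real (norm (\<phi> (of_real (- x))) powr (p / 2)) * exp (\<i> * of_real (phase (- x)))))"

lemma bdry_branch_limit_pos:
  assumes x: "x > 0" and \<phi>: "\<phi> (of_real x) \<noteq> 0" and xk: "\<bar>x - of_int k\<bar> < 1/2"
  shows "((\<lambda>e. branch (Complex x e)) \<longlongrightarrow> bdry_branch x) (at_right 0)"
proof -
  have k: "k = round x" using xk by (simp add: round_unique' abs_minus_commute)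
  define v where "v = x - of_int k"
  have v: "\<bar>v\<bar> < 1/2" using xk by (simp add: v_def)
  have cnz: "cos (pi * x) \<noteq> 0" by (rule cos_pi_nonzero_strip[OF xk])
  define Q where "Q = quot_real x"
  have Q0: "Q \<noteq> 0" using \<phi> cnz real_on_reals[of x] by (auto simp: Q_def quot_real_def)
  note tz = tendsto_Complex_of_real[of x]
  have c': "cos (of_real pi * of_real x) \<noteq> (0::complex)" using cnz
    by (metis cos_of_real of_real_eq_0_iff of_real_mult)
  have "open {z. cos (of_real pi * z) \<noteq> (0::complex)}" by (intro open_Collect_neq continuous_intros)
  then have "isCont quot (of_real x)"
    using holomorphic_on_imp_continuous_on[OF quot_holomorphic] c' by (simp add: continuous_on_eq_continuous_at)
  then have tq: "((\<lambda>e. quot (Complex x e)) \<longlongrightarrow> of_real Q) (at_right 0)"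
    using isCont_tendsto_compose[OF _ tz, of quot] by (simp add: quot_on_reals Q_def)
  have "isCont cos_times_exp (of_real x)" unfolding cos_times_exp_def[abs_def] by (intro continuous_intros) auto
  then have th: "((\<lambda>e. cos_times_exp (Complex x e)) \<longlongrightarrow> cos_times_exp (of_real x)) (at_right 0)"
    using isCont_tendsto_compose[OF _ tz, of cos_times_exp] by simp
  note hx = cos_times_exp_on_reals[OF xk]
  have tLh: "((\<lambda>e. Ln (cos_times_exp (Complex x e))) \<longlongrightarrow> of_real (ln (cos (pi * v))) + \<i> * of_real (pi * v)) (at_right 0)"
    unfolding v_def hx(1)[symmetric] using hx(2) by (intro tendsto_Ln th) (auto simp: complex_nonpos_Reals_iff)
  have tLq: "((\<lambda>e. Ln (quot (Complex x e))) \<longlongrightarrow> of_real (ln \<bar>Q\<bar>) + \<i> * of_real (if Q < 0 then pi else 0)) (at_right 0)"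
  proof (cases "Q < 0")
    case False
    then have Qp: "Q > 0" using Q0 by simp
    then have "((\<lambda>e. Ln (quot (Complex x e))) \<longlongrightarrow> Ln (of_real Q)) (at_right 0)"
      by (intro tendsto_Ln tq) (auto simp: complex_nonpos_Reals_iff)
    then show ?thesis using Qp by (simp add: Ln_of_real)
  next
    case True
    have "((\<lambda>e. Ln (- quot (Complex x e)) + \<i> * of_real pi) \<longlongrightarrow> Ln (- of_real Q) + \<i> * of_real pi) (at_right 0)"
      using True by (intro tendsto_intros tendsto_Ln tq) (auto simp: complex_nonpos_Reals_iff)
    moreover have "Ln (- of_real Q) = of_real (ln \<bar>Q\<bar>)"
      using True Ln_of_real[of "- Q"] by simp
    moreover have "\<forall>\<^sub>F e in at_right 0. Ln (- quot (Complex x e)) + \<i> * of_real pi = Ln (quot (Complex x e))"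
      using eventually_at_right_less[of 0]
    proof eventually_elim
      case (elim e)
      then have im: "Im (quot (Complex x e)) > 0" using x by (intro quot_Im_pos) auto
      then have "quot (Complex x e) \<noteq> 0" by auto
      then show ?case using Ln_minus[of "quot (Complex x e)"] im by simp
    qed
    ultimately show ?thesis using True by (simp add: filterlim_cong)
  qed
  have lim: "((\<lambda>e. branch (Complex x e)) \<longlongrightarrow> exp (of_real (p / 2) * ((of_real (ln \<bar>Q\<bar>) + \<i> * of_real (if Q < 0 then pi else 0))
       + (of_real (ln (cos (pi * v))) + \<i> * of_real (pi * v))))) (at_right 0)"
    unfolding branch_def by (intro tendsto_intros tLq tLh)
  have cp: "cos (pi * v) > 0" by (rule cos_pi_pos_half[OF v])
  have ph: "phase x = p / 2 * (pi * v + (if Q < 0 then pi else 0))"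
    by (simp add: phase_def k[symmetric] v_def Q_def)
  have nrm: "norm (\<phi> (of_real x)) = \<bar>Q\<bar> * cos (pi * v)"
  proof -
    have "\<bar>cos (pi * x)\<bar> = cos (pi * v)"
    proof -
      have "cos (pi * x) = cos (pi * v + pi * k)" by (simp add: v_def algebra_simps)
      also have "\<dots> = cos (pi * v) * cos (pi * k)" by (simp add: cos_add sin_npi_int mult.commute)
      finally show ?thesis using cp by (simp add: abs_mult cos_npi_int mult.commute)
    qed
    then show ?thesis using cnz by (simp add: norm_on_reals Q_def quot_real_def abs_divide)
  qed
  have "of_real (p / 2) * ((of_real (ln \<bar>Q\<bar>) + \<i> * of_real (if Q < 0 then pi else 0))
       + (of_real (ln (cos (pi * v))) + \<i> * of_real (pi * v)))
     = of_real (p / 2 * (ln \<bar>Q\<bar> + ln (cos (pi * v)))) + \<i> * of_real (phase x)"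
    unfolding ph by (simp add: algebra_simps)
  moreover have "exp (p / 2 * (ln \<bar>Q\<bar> + ln (cos (pi * v)))) = norm (\<phi> (of_real x)) powr (p / 2)"
    unfolding nrm using Q0 cp by (simp add: powr_def ln_mult)
  ultimately have "exp (of_real (p / 2) * ((of_real (ln \<bar>Q\<bar>) + \<i> * of_real (if Q < 0 then pi else 0))
       + (of_real (ln (cos (pi * v))) + \<i> * of_real (pi * v)))) = bdry_branch x"
    using x by (simp only: bdry_branch_def if_True exp_add exp_of_real)
  then show ?thesis using lim by simp
qed


section \<open>The integral inequality for the extremal function\<close>

lemma branch_limit_at_zero:
  assumes "\<phi> (of_real x) = 0"
  shows "((\<lambda>e. branch (Complex x e)) \<longlongrightarrow> 0) (at_right 0)"
proof -
  have "isCont \<phi> (of_real x)" by (rule isCont_entire[OF hol])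
  then have c: "isCont (\<lambda>z. \<phi> z * exp (\<i> * of_real pi * z)) (of_real x)" by (intro continuous_intros)
  note tz = tendsto_Complex_of_real[of x]
  have "((\<lambda>e. norm (\<phi> (Complex x e) * exp (\<i> * of_real pi * Complex x e)) powr (p / 2)) \<longlongrightarrow>
      norm (\<phi> (of_real x) * exp (\<i> * of_real pi * of_real x)) powr (p / 2)) (at_right 0)"
    using p2 by (intro tendsto_powr2 tendsto_norm isCont_tendsto_compose[OF c tz] tendsto_const) auto
  then have l: "((\<lambda>e. norm (\<phi> (Complex x e) * exp (\<i> * of_real pi * Complex x e)) powr (p / 2)) \<longlongrightarrow> 0) (at_right 0)"
    by (simp add: assms)
  show ?thesis
  proof (rule Lim_null_comparison[OF _ l])
    show "\<forall>\<^sub>F e in at_right 0. norm (branch (Complex x e)) \<le> norm (\<phi> (Complex x e) * exp (\<i> * of_real pi * Complex x e)) powr (p / 2)"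
      using eventually_at_right_less[of 0] by eventually_elim (simp add: norm_branch)
  qed
qed

lemma bdry_branch_reflect: "x > 0 \<Longrightarrow> bdry_branch (- x) = cnj (bdry_branch x)"
  by (simp add: bdry_branch_def)

lemma bdry_branch_limit:
  assumes x: "x \<noteq> 0" and half: "\<And>k::int. x \<noteq> k + 1/2"
  shows "((\<lambda>e. branch (Complex x e)) \<longlongrightarrow> bdry_branch x) (at_right 0)"
proof -
  have *: "((\<lambda>e. branch (Complex x e)) \<longlongrightarrow> bdry_branch x) (at_right 0)" if x: "x > 0" and half: "\<And>k::int. x \<noteq> k + 1/2" for x
  proof (cases "\<phi> (of_real x) = 0")
    case True
    then show ?thesis using branch_limit_at_zero[OF True] x p2 by (simp add: bdry_branch_def)
  next
    case False
    have "\<bar>of_int (round x) - x\<bar> \<le> 1/2" by (rule of_int_round_abs_le)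
    moreover have "x \<noteq> of_int (round x) + 1/2" "x \<noteq> of_int (round x) - 1/2"
      using half[of "round x"] half[of "round x - 1"] by auto
    ultimately have "\<bar>x - of_int (round x)\<bar> < 1/2" by (auto simp: abs_if split: if_splits)
    from bdry_branch_limit_pos[OF x False this] show ?thesis .
  qed
  show ?thesis
  proof (cases "x > 0")
    case True
    then show ?thesis using *[OF True half] by blast
  next
    case False
    then have x': "- x > 0" using x by simp
    have half': "- x \<noteq> k + 1/2" for k :: int using half[of "- k - 1"] by auto
    have "((\<lambda>e. cnj (branch (Complex (- x) e))) \<longlongrightarrow> cnj (bdry_branch (- x))) (at_right 0)"
      by (intro tendsto_intros *[OF x' half'])
    moreover have "cnj (bdry_branch (- x)) = bdry_branch x" using bdry_branch_reflect[OF x'] by simp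
    moreover have "\<forall>\<^sub>F e in at_right 0. cnj (branch (Complex (- x) e)) = branch (Complex x e)"
      using eventually_at_right_less[of 0]
    proof eventually_elim
      case (elim e)
      have "- cnj (Complex (- x) e) = Complex x e" by (simp add: complex_eq_iff)
      then show ?case using branch_reflect[of "Complex (- x) e"] elim by simp
    qed
    ultimately show ?thesis by (simp add: filterlim_cong)
  qed
qed

lemma bdry_branch_limit_AE: "AE x in lborel. ((\<lambda>e. branch (Complex x e)) \<longlongrightarrow> bdry_branch x) (at_right 0)"
proof -
  have "countable (insert 0 (range (\<lambda>k::int. real_of_int k + 1/2)))" by simp
  then have "insert 0 (range (\<lambda>k::int. real_of_int k + 1/2)) \<in> null_sets lborel"
    by (rule countable_imp_null_set_lborel)
  from AE_not_in[OF this] show ?thesis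
    by eventually_elim (auto intro!: bdry_branch_limit)
qed

lemma measurable_quot_real[measurable]: "quot_real \<in> borel_measurable borel"
proof -
  have [measurable]: "(\<lambda>x. \<phi> (complex_of_real x)) \<in> borel_measurable borel" by (rule measurable_real_axis[OF hol])
  show ?thesis unfolding quot_real_def[abs_def] by measurable
qed

lemma measurable_phase[measurable]: "phase \<in> borel_measurable borel"
  unfolding phase_def[abs_def] round_def by measurable

lemma measurable_bdry_branch[measurable]: "bdry_branch \<in> borel_measurable borel"
proof -
  have m1[measurable]: "(\<lambda>x. \<phi> (complex_of_real x)) \<in> borel_measurable borel" by (rule measurable_real_axis[OF hol])
  have [measurable]: "cnj \<in> borel_measurable borel" by (intro borel_measurable_continuous_onI continuous_intros)
  have [measurable]: "(\<lambda>t. exp (\<i> * complex_of_real t)) \<in> borel_measurable borel" by (intro borel_measurable_continuous_onI continuous_intros)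
  have m2[measurable]: "(\<lambda>x. of_real (norm (\<phi> (of_real x)) powr (p / 2)) * exp (\<i> * of_real (phase x))) \<in> borel_measurable borel"
    by measurable
  show ?thesis unfolding bdry_branch_def[abs_def] by measurable
qed

text \<open>Cauchy's formula at \<open>\<i> \<eta>\<close> for the branch times \<open>z / ((z + \<i> \<eta>) (1 - \<i> \<eta> z))\<close>. As \<open>\<eta>\<close> tends to
  \<open>0\<close> the resulting kernel \<open>z / ((z^2 + \<eta>^2) (1 - \<i> \<eta> z))\<close> tends to \<open>1/z\<close>; the last factor provides
  the decay at infinity that the bounded branch lacks.\<close>

lemma boundary_identity:
  assumes \<eta>: "\<eta> > 0"
  shows "(\<integral>x. bdry_branch x * (of_real x / ((of_real x + \<i> * of_real \<eta>) * (1 - \<i> * of_real (\<eta> * x)))) / (of_real x - \<i> * of_real \<eta>) \<partial>lborel)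
    = of_real (pi * (norm (\<phi> (\<i> * of_real \<eta>)) * exp (- (pi * \<eta>))) powr (p / 2) / (1 + \<eta>\<^sup>2)) * \<i>"
proof -
  obtain M where M: "M \<ge> 0" "\<And>z. Im z > 0 \<Longrightarrow> norm (branch z) \<le> M" using branch_bounded by blast
  define k where "k = (\<lambda>z. z / ((z + \<i> * of_real \<eta>) * (1 - \<i> * of_real \<eta> * z)))"
  have nz1: "z + \<i> * of_real \<eta> \<noteq> 0" if "Im z \<ge> 0" for z
  proof
    assume "z + \<i> * of_real \<eta> = 0"
    then have "Im (z + \<i> * of_real \<eta>) = 0" by simp
    then show False using that \<eta> by simp
  qed
  have nz2: "1 - \<i> * of_real \<eta> * z \<noteq> 0" if "Im z \<ge> 0" for z
  proof
    assume "1 - \<i> * of_real \<eta> * z = 0"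
    then have "Re (1 - \<i> * of_real \<eta> * z) = 0" by simp
    then have "1 + \<eta> * Im z = 0" by simp
    moreover have "0 \<le> \<eta> * Im z" using that \<eta> by simp
    ultimately show False by linarith
  qed
  define G where "G = (\<lambda>z. branch z * k z)"
  define g where "g = (\<lambda>x. bdry_branch x * k (of_real x))"
  have kc: "isCont k (of_real x)" for x
    unfolding k_def using nz1[of "of_real x"] nz2[of "of_real x"] by (intro continuous_intros) auto
  have "(\<integral>x. g x / (of_real x - \<i> * of_real \<eta>) \<partial>lborel) = 2 * pi * \<i> * G (\<i> * of_real \<eta>)"
  proof (rule Cauchy_formula_boundary)
    show "G holomorphic_on {z. Im z > 0}" unfolding G_def k_def
      using nz1 nz2 by (intro holomorphic_intros branch_holomorphic) (auto intro: less_imp_le)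
    show "norm (G z) \<le> M * (1 + 1 / \<eta>) / (1 + norm z)" if z: "Im z > 0" for z
    proof -
      have "(norm z)\<^sup>2 \<le> (norm (z + \<i> * of_real \<eta>))\<^sup>2"
        unfolding cmod_power2 using z \<eta> by (simp add: power_mono)
      then have a: "norm z \<le> norm (z + \<i> * of_real \<eta>)" by (rule power2_le_imp_le) simp
      have e: "(norm (1 - \<i> * of_real \<eta> * z))\<^sup>2 = 1 + 2*\<eta>*Im z + \<eta>\<^sup>2 * (norm z)\<^sup>2"
        unfolding cmod_power2 by (simp add: power2_eq_square algebra_simps)
      have "1\<^sup>2 \<le> (norm (1 - \<i> * of_real \<eta> * z))\<^sup>2" unfolding e using \<eta> z by simp
      then have b1: "1 \<le> norm (1 - \<i> * of_real \<eta> * z)" by (rule power2_le_imp_le) simp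
      have "(\<eta> * norm z)\<^sup>2 \<le> (norm (1 - \<i> * of_real \<eta> * z))\<^sup>2" unfolding e using \<eta> z by (simp add: power_mult_distrib)
      then have b2: "\<eta> * norm z \<le> norm (1 - \<i> * of_real \<eta> * z)" by (rule power2_le_imp_le) simp
      have b: "1 + norm z \<le> (1 + 1 / \<eta>) * norm (1 - \<i> * of_real \<eta> * z)"
      proof -
        have "norm z \<le> norm (1 - \<i> * of_real \<eta> * z) / \<eta>" using b2 \<eta> by (simp only: pos_le_divide_eq mult.commute)
        then show ?thesis using b1 by (simp add: distrib_right)
      qed
      have "norm (k z) = norm z / norm (z + \<i> * of_real \<eta>) / norm (1 - \<i> * of_real \<eta> * z)"
        by (simp add: k_def norm_divide norm_mult)
      also have "\<dots> \<le> 1 / norm (1 - \<i> * of_real \<eta> * z)"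
        using a by (intro divide_right_mono) (auto simp: divide_le_eq_1)
      also have "\<dots> \<le> 1 / ((1 + norm z) / (1 + 1 / \<eta>))"
      proof (rule divide_left_mono)
        have "1 + 1 / \<eta> > 0" using \<eta> by (simp add: add_pos_pos)
        then show "(1 + norm z) / (1 + 1 / \<eta>) \<le> norm (1 - \<i> * of_real \<eta> * z)" using b by (simp add: divide_le_eq mult.commute)
        show "0 < norm (1 - \<i> * of_real \<eta> * z) * ((1 + norm z) / (1 + 1 / \<eta>))"
          using b1 \<open>1 + 1 / \<eta> > 0\<close> by (intro mult_pos_pos divide_pos_pos) (auto simp: add_pos_nonneg)
      qed simp
      also have "\<dots> = (1 + 1 / \<eta>) / (1 + norm z)" by simp
      finally have kb: "norm (k z) \<le> (1 + 1 / \<eta>) / (1 + norm z)" .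
      have "norm (G z) \<le> M * ((1 + 1 / \<eta>) / (1 + norm z))"
        unfolding G_def norm_mult using M(2)[OF z] kb M(1) by (intro mult_mono) auto
      then show ?thesis by simp
    qed
    show "AE x in lborel. ((\<lambda>e. G (Complex x e)) \<longlongrightarrow> g x) (at_right 0)"
      using bdry_branch_limit_AE
    proof eventually_elim
      case (elim x)
      note tz = tendsto_Complex_of_real[of x]
      show ?case unfolding G_def g_def by (intro tendsto_intros elim isCont_tendsto_compose[OF kc tz])
    qed
    have "continuous_on UNIV (\<lambda>x. k (of_real x))"
      unfolding k_def using nz1[of "of_real _"] nz2[of "of_real _"] by (intro continuous_intros) auto
    then have [measurable]: "(\<lambda>x. k (of_real x)) \<in> borel_measurable borel" by (rule borel_measurable_continuous_onI)
    show "g \<in> borel_measurable borel" unfolding g_def by measurable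
    show "Im (\<i> * of_real \<eta>) > 0" using \<eta> by simp
  qed
  moreover have "k (\<i> * of_real \<eta>) = 1 / (1 + of_real (\<eta>\<^sup>2)) / 2"
  proof -
    have e1: "\<i> * of_real \<eta> + \<i> * of_real \<eta> = 2 * (\<i> * of_real \<eta>)" by simp
    have e2: "1 - \<i> * of_real \<eta> * (\<i> * of_real \<eta>) = 1 + of_real (\<eta>\<^sup>2)"
      unfolding complex_eq_iff by (simp add: power2_eq_square)
    have "k (\<i> * of_real \<eta>) = \<i> * of_real \<eta> / (2 * (\<i> * of_real \<eta>) * (1 + of_real (\<eta>\<^sup>2)))"
      by (simp only: k_def e1 e2)
    also have "\<dots> = 1 / (1 + of_real (\<eta>\<^sup>2)) / 2" using \<eta> by (simp del: of_real_power)
    finally show ?thesis .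
  qed
  moreover have gen: "complex_of_real (2 * pi) * \<i> * (b * (X / 2)) = of_real pi * b * X * \<i>" for b X :: complex by simp
  ultimately have "(\<integral>x. g x / (of_real x - \<i> * of_real \<eta>) \<partial>lborel)
      = of_real pi * branch (\<i> * of_real \<eta>) * (1 / (1 + of_real (\<eta>\<^sup>2))) * \<i>"
    by (simp only: G_def)
  also have "\<dots> = of_real (pi * (norm (\<phi> (\<i> * of_real \<eta>)) * exp (- (pi * \<eta>))) powr (p / 2) / (1 + \<eta>\<^sup>2)) * \<i>"
    unfolding branch_on_imaginary_axis[OF \<eta>] by simp
  finally show ?thesis unfolding g_def by (simp add: k_def mult_ac)
qed

text \<open>In the imaginary part only the sine survives as \<open>\<eta>\<close> tends to \<open>0\<close>. Its negative part may be dropped,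
  because the modulus of the boundary values is nonnegative.\<close>

lemma boundary_kernel_Im_le:
  fixes h \<theta> \<eta> x :: real
  assumes "h \<ge> 0" "x > 0" "\<eta> > 0"
  shows "Im (of_real h * exp (\<i> * of_real \<theta>) * (of_real x / ((of_real x + \<i> * of_real \<eta>) * (1 - \<i> * of_real (\<eta> * x)))) / (of_real x - \<i> * of_real \<eta>))
    \<le> h * (max 0 (sin \<theta>) / x + \<eta> / (1 + \<eta>\<^sup>2 * x\<^sup>2))"
proof -
  define A where "A = x\<^sup>2 + \<eta>\<^sup>2"
  define B where "B = 1 + \<eta>\<^sup>2 * x\<^sup>2"
  have A: "A > 0" "A \<ge> x\<^sup>2" using assms by (auto simp: A_def add_pos_pos)
  have B: "B \<ge> 1" by (simp add: B_def)
  have n1: "of_real x + \<i> * of_real \<eta> \<noteq> 0" "of_real x - \<i> * of_real \<eta> \<noteq> 0" "1 - \<i> * of_real (\<eta> * x) \<noteq> 0"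
    using assms by (auto simp: complex_eq_iff)
  have eA: "(of_real x + \<i> * of_real \<eta>) * (of_real x - \<i> * of_real \<eta>) = of_real A"
    by (simp add: A_def power2_eq_square algebra_simps)
  have eB: "(1 - \<i> * of_real (\<eta> * x)) * (1 + \<i> * of_real (\<eta> * x)) = of_real B"
    by (simp add: B_def power2_eq_square algebra_simps)
  have "of_real x / ((of_real x + \<i> * of_real \<eta>) * (1 - \<i> * of_real (\<eta> * x))) / (of_real x - \<i> * of_real \<eta>)
     = of_real x / (of_real A * (1 - \<i> * of_real (\<eta> * x)))"
    unfolding eA[symmetric] by (simp add: mult_ac)
  also have "\<dots> = of_real x * (1 + \<i> * of_real (\<eta> * x)) / (of_real A * ((1 - \<i> * of_real (\<eta> * x)) * (1 + \<i> * of_real (\<eta> * x))))"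
  proof -
    have "1 + \<i> * of_real (\<eta> * x) \<noteq> 0" by (simp add: complex_eq_iff)
    then show ?thesis by (simp add: divide_simps)
  qed
  also have "\<dots> = (1 + \<i> * of_real (\<eta> * x)) * of_real (x / (A * B))"
    unfolding eB by simp
  finally have ker: "of_real x / ((of_real x + \<i> * of_real \<eta>) * (1 - \<i> * of_real (\<eta> * x))) / (of_real x - \<i> * of_real \<eta>)
     = (1 + \<i> * of_real (\<eta> * x)) * of_real (x / (A * B))" .
  have "Im (of_real h * exp (\<i> * of_real \<theta>) * (of_real x / ((of_real x + \<i> * of_real \<eta>) * (1 - \<i> * of_real (\<eta> * x)))) / (of_real x - \<i> * of_real \<eta>))
    = Im (of_real h * exp (\<i> * of_real \<theta>) * ((1 + \<i> * of_real (\<eta> * x)) * of_real (x / (A * B))))"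
    unfolding ker[symmetric] by (simp add: mult.assoc)
  also have "\<dots> = h * ((sin \<theta> + \<eta> * x * cos \<theta>) * (x / (A * B)))"
    by (simp add: Re_exp Im_exp algebra_simps)
  also have "\<dots> \<le> h * (max 0 (sin \<theta>) / x + \<eta> / (1 + \<eta>\<^sup>2 * x\<^sup>2))"
  proof (rule mult_left_mono[OF _ assms(1)])
    have x2: "x / (A * B) \<le> 1 / x"
    proof -
      have "x * x \<le> A * B" using A B mult_mono[of "x\<^sup>2" A 1 B] assms by (simp add: power2_eq_square)
      then show ?thesis using assms A B by (simp add: divide_simps)
    qed
    have x0: "0 \<le> x / (A * B)" using assms A B by simp
    have "sin \<theta> * (x / (A * B)) \<le> max 0 (sin \<theta>) * (x / (A * B))" using x0 by (intro mult_right_mono) auto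
    also have "\<dots> \<le> max 0 (sin \<theta>) * (1 / x)" using x2 by (intro mult_left_mono) auto
    finally have 1: "sin \<theta> * (x / (A * B)) \<le> max 0 (sin \<theta>) / x" by simp
    have "\<eta> * x * cos \<theta> * (x / (A * B)) \<le> \<eta> * x * 1 * (x / (A * B))"
      using x0 assms by (intro mult_right_mono mult_left_mono) auto
    also have "\<dots> = \<eta> / B * (x\<^sup>2 / A)" by (simp add: power2_eq_square mult_ac)
    also have "\<dots> \<le> \<eta> / B * 1" using A B assms by (intro mult_left_mono) auto
    finally have 2: "\<eta> * x * cos \<theta> * (x / (A * B)) \<le> \<eta> / (1 + \<eta>\<^sup>2 * x\<^sup>2)" by (simp add: B_def)
    show "(sin \<theta> + \<eta> * x * cos \<theta>) * (x / (A * B)) \<le> max 0 (sin \<theta>) / x + \<eta> / (1 + \<eta>\<^sup>2 * x\<^sup>2)"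
      using add_mono[OF 1 2] by (simp only: distrib_right)
  qed
  finally show ?thesis .
qed

definition pos_sin :: "real \<Rightarrow> real" where
  "pos_sin x = max 0 (sin (phase \<bar>x\<bar>))"

lemma boundary_integrand_Im_le:
  assumes x: "x \<noteq> 0" and \<eta>: "\<eta> > 0"
  shows "Im (bdry_branch x * (of_real x / ((of_real x + \<i> * of_real \<eta>) * (1 - \<i> * of_real (\<eta> * x)))) / (of_real x - \<i> * of_real \<eta>))
    \<le> norm (\<phi> (of_real x)) powr (p / 2) * (pos_sin x / \<bar>x\<bar> + \<eta> / (1 + \<eta>\<^sup>2 * x\<^sup>2))"
proof -
  define k where "k = (\<lambda>x. of_real x / ((of_real x + \<i> * of_real \<eta>) * (1 - \<i> * of_real (\<eta> * x))) / (of_real x - \<i> * of_real \<eta>))"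
  have pos: "Im (bdry_branch x * k x) \<le> norm (\<phi> (of_real x)) powr (p / 2) * (pos_sin x / \<bar>x\<bar> + \<eta> / (1 + \<eta>\<^sup>2 * x\<^sup>2))" if "x > 0" for x
    using boundary_kernel_Im_le[of "norm (\<phi> (of_real x)) powr (p / 2)" x \<eta> "phase x"] that \<eta>
    unfolding bdry_branch_def k_def pos_sin_def by (simp add: mult.assoc)
  have "Im (bdry_branch x * k x) \<le> norm (\<phi> (of_real x)) powr (p / 2) * (pos_sin x / \<bar>x\<bar> + \<eta> / (1 + \<eta>\<^sup>2 * x\<^sup>2))"
  proof (cases "x > 0")
    case True
    then show ?thesis by (rule pos)
  next
    case False
    then have y: "- x > 0" using x by simp
    have b: "bdry_branch x = cnj (bdry_branch (- x))" using bdry_branch_reflect[OF y] by simp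
    have kk: "k x = - cnj (k (- x))"
    proof -
      have "cnj (k (- x)) = of_real (- x) / ((of_real (- x) - \<i> * of_real \<eta>) * (1 + \<i> * of_real (\<eta> * (- x)))) / (of_real (- x) + \<i> * of_real \<eta>)"
        unfolding k_def by simp
      also have "\<dots> = - (of_real x / ((- (of_real x + \<i> * of_real \<eta>)) * (1 - \<i> * of_real (\<eta> * x))) / (- (of_real x - \<i> * of_real \<eta>)))"
        by simp
      also have "\<dots> = - k x" unfolding k_def by (simp only: mult_minus_left minus_divide_left minus_divide_right minus_minus divide_minus_right)
      finally show ?thesis by simp
    qed
    have "Im (bdry_branch x * k x) = Im (- cnj (bdry_branch (- x) * k (- x)))" unfolding b kk by simp
    also have "\<dots> = Im (bdry_branch (- x) * k (- x))" by simp
    also have "\<dots> \<le> norm (\<phi> (of_real (- x))) powr (p / 2) * (pos_sin (- x) / \<bar>- x\<bar> + \<eta> / (1 + \<eta>\<^sup>2 * (- x)\<^sup>2))"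
      by (rule pos[OF y])
    finally show ?thesis by (simp add: even pos_sin_def)
  qed
  then show ?thesis by (simp add: k_def mult.assoc)
qed

text \<open>In the limit \<open>\<eta> = 0\<close> the boundary identity gives \<open>pi \<le> \<integral>|\<phi>| powr (p/2) * pos_sin x / |x| dx\<close>, and
  the Cauchy--Schwarz inequality finishes the proof. It is used in the form
  \<open>2 u w \<le> t u^2 + w^2 / t\<close>, which avoids products of integrable functions; the weight
  \<open>t = pi / c\<close> is optimal.\<close>

lemma lower_bound_c:
  assumes \<sigma>: "integrable lborel (\<lambda>x. (pos_sin x)\<^sup>2 / x\<^sup>2)"
  shows "pi\<^sup>2 \<le> c * (\<integral>x. (pos_sin x)\<^sup>2 / x\<^sup>2 \<partial>lborel)"
proof -
  define S where "S = (\<integral>x. (pos_sin x)\<^sup>2 / x\<^sup>2 \<partial>lborel)"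
  define P where "P = integral\<^sup>L lborel (\<lambda>x::real. 1 / (1 + x\<^sup>2))"
  define l where "l = pi / c"
  have l: "l > 0" using c_pos by (simp add: l_def)
  define v where "v = (\<lambda>\<eta>. (norm (\<phi> (\<i> * of_real \<eta>)) * exp (- (pi * \<eta>))) powr (p / 2))"
  have main: "pi * v (e\<^sup>2) / (1 + (e\<^sup>2)\<^sup>2) \<le> (l * c + S / l) / 2 + e * (c + P) / 2" if e: "e > 0" for e
  proof -
    \<comment> \<open>With \<open>\<eta> = e\<^sup>2\<close> the error term \<open>\<eta> / (1 + \<eta>\<^sup>2 x\<^sup>2)\<close> has \<open>L\<^sup>2\<close> norm of order \<open>e\<close>.\<close>
    define \<eta> where "\<eta> = e\<^sup>2"
    have \<eta>: "\<eta> > 0" using e by (simp add: \<eta>_def)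
    define K where "K = (\<lambda>x. bdry_branch x * (of_real x / ((of_real x + \<i> * of_real \<eta>) * (1 - \<i> * of_real (\<eta> * x)))) / (of_real x - \<i> * of_real \<eta>))"
    have vpos: "v \<eta> > 0" using nonzero_on_imaginary_axis[of \<eta>] by (simp add: v_def)
    have KI: "(\<integral>x. K x \<partial>lborel) = of_real (pi * v \<eta> / (1 + \<eta>\<^sup>2)) * \<i>"
      using boundary_identity[OF \<eta>] by (simp add: K_def v_def)
    have q: "1 + \<eta>\<^sup>2 > 0" by (simp add: add_pos_nonneg)
    have Ki: "integrable lborel K"
    proof (rule ccontr)
      assume "\<not> integrable lborel K"
      then have "(\<integral>x. K x \<partial>lborel) = 0" by (rule not_integrable_integral_eq)
      then have "pi * v \<eta> / (1 + \<eta>\<^sup>2) = 0" unfolding KI by (simp only: mult_eq_0_iff of_real_eq_0_iff complex_i_not_zero simp_thms)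
      then show False using vpos q by simp
    qed
    have "Im (\<integral>x. K x \<partial>lborel) = pi * v \<eta> / (1 + \<eta>\<^sup>2)" unfolding KI by simp
    then have eq: "pi * v \<eta> / (1 + \<eta>\<^sup>2) = (\<integral>x. Im (K x) \<partial>lborel)" using integral_Im[OF Ki] by simp
    define D where "D = (\<lambda>x. (l * norm (\<phi> (of_real x)) powr p + (pos_sin x)\<^sup>2 / x\<^sup>2 / l) / 2
        + (e * norm (\<phi> (of_real x)) powr p + e ^ 3 * (1 / (1 + (\<eta> * x)\<^sup>2))) / 2)"
    have P1: "integrable lborel (\<lambda>x. 1 / (1 + (\<eta> * x)\<^sup>2))"
      using lborel_integrable_real_affine[OF integrable_inverse_1_plus_sq, of \<eta> 0] \<eta> by simp
    have P2: "(\<integral>x. 1 / (1 + (\<eta> * x)\<^sup>2) \<partial>lborel) = P / \<eta>"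
      using lborel_integral_real_affine[of \<eta> "\<lambda>x. 1 / (1 + x\<^sup>2)" 0] \<eta> by (simp add: P_def)
    have Di: "integrable lborel D" unfolding D_def
      using integrable \<sigma> P1 by (intro Bochner_Integration.integrable_add integrable_divide integrable_mult_right)
    have "(\<integral>x. Im (K x) \<partial>lborel) \<le> (\<integral>x. D x \<partial>lborel)"
    proof (rule integral_mono_AE[OF _ Di])
      show "integrable lborel (\<lambda>x. Im (K x))" using Ki by (rule integrable_Im)
      show "AE x in lborel. Im (K x) \<le> D x"
        using AE_neq_lborel[of 0]
      proof eventually_elim
        case (elim x)
        define h where "h = norm (\<phi> (of_real x)) powr (p / 2)"
        have h2: "h * h = norm (\<phi> (of_real x)) powr p" by (simp add: h_def powr_add[symmetric])
        define s where "s = pos_sin x / \<bar>x\<bar>"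
        have s2: "s * s = (pos_sin x)\<^sup>2 / x\<^sup>2" by (simp add: s_def power2_eq_square)
        define a where "a = \<eta> / (1 + \<eta>\<^sup>2 * x\<^sup>2)"
        have B: "1 + \<eta>\<^sup>2 * x\<^sup>2 \<ge> 1" by simp
        have a2: "a * a \<le> e ^ 4 * (1 / (1 + (\<eta> * x)\<^sup>2))"
        proof -
          have "a * a = e ^ 4 * (1 / (1 + (\<eta> * x)\<^sup>2)) * (1 / (1 + \<eta>\<^sup>2 * x\<^sup>2))"
          proof -
            have e4: "e ^ 4 = \<eta> * \<eta>" by (simp add: \<eta>_def power4_eq_xxxx power2_eq_square)
            show ?thesis unfolding e4 power_mult_distrib a_def by simp
          qed
          also have "\<dots> \<le> e ^ 4 * (1 / (1 + (\<eta> * x)\<^sup>2)) * 1"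
          proof (rule mult_left_mono)
            have "1 / (1 + \<eta>\<^sup>2 * x\<^sup>2) \<le> 1 / 1" by (rule frac_le) (use B in auto)
            then show "1 / (1 + \<eta>\<^sup>2 * x\<^sup>2) \<le> 1" by (simp only: div_by_1)
          qed simp
          finally show ?thesis by simp
        qed
        have am: "u * w \<le> (t * (u * u) + w * w / t) / 2" if "t > 0" for u w t :: real
        proof -
          have "0 \<le> (t * u - w)\<^sup>2 / t" using that by simp
          also have "\<dots> = t * (u * u) + w * w / t - 2 * (u * w)" using that by (simp add: power2_eq_square field_simps)
          finally show ?thesis by simp
        qed
        have "Im (K x) \<le> h * (s + a)"
          using boundary_integrand_Im_le[OF elim \<eta>] by (simp add: K_def h_def s_def a_def)
        also have "\<dots> = h * s + h * a" by (simp add: distrib_left)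
        also have "\<dots> \<le> (l * (h * h) + s * s / l) / 2 + (e * (h * h) + a * a / e) / 2"
          by (intro add_mono am l e)
        also have "a * a / e \<le> e ^ 3 * (1 / (1 + (\<eta> * x)\<^sup>2))"
        proof -
          have "a * a / e \<le> e ^ 4 * (1 / (1 + (\<eta> * x)\<^sup>2)) / e" using a2 e by (intro divide_right_mono) auto
          also have "\<dots> = e ^ 3 * (1 / (1 + (\<eta> * x)\<^sup>2))" using e by (simp add: power4_eq_xxxx power3_eq_cube)
          finally show ?thesis .
        qed
        finally show ?case unfolding D_def h2 s2 by simp
      qed
    qed
    also have "(\<integral>x. D x \<partial>lborel) = (l * c + S / l) / 2 + (e * c + e ^ 3 * (P / \<eta>)) / 2"
    proof -
      have J1: "integrable lborel (\<lambda>x. l * norm (\<phi> (of_real x)) powr p)" using integrable by (rule integrable_mult_right)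
      have J2: "integrable lborel (\<lambda>x. (pos_sin x)\<^sup>2 / x\<^sup>2 / l)" using \<sigma> by (rule integrable_divide)
      have J3: "integrable lborel (\<lambda>x. e * norm (\<phi> (of_real x)) powr p)" using integrable by (rule integrable_mult_right)
      have J4: "integrable lborel (\<lambda>x. e ^ 3 * (1 / (1 + (\<eta> * x)\<^sup>2)))" using P1 by (rule integrable_mult_right)
      have "(\<integral>x. D x \<partial>lborel) = (\<integral>x. (l * norm (\<phi> (of_real x)) powr p + (pos_sin x)\<^sup>2 / x\<^sup>2 / l) / 2 \<partial>lborel)
          + (\<integral>x. (e * norm (\<phi> (of_real x)) powr p + e ^ 3 * (1 / (1 + (\<eta> * x)\<^sup>2))) / 2 \<partial>lborel)"
        unfolding D_def
        by (intro Bochner_Integration.integral_add integrable_divide Bochner_Integration.integrable_add J1 J2 J3 J4)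
      also have "(\<integral>x. (l * norm (\<phi> (of_real x)) powr p + (pos_sin x)\<^sup>2 / x\<^sup>2 / l) / 2 \<partial>lborel) = (l * c + S / l) / 2"
        unfolding integral_divide_zero Bochner_Integration.integral_add[OF J1 J2] integral_mult_right_zero
        by (simp only: c_def S_def)
      also have "(\<integral>x. (e * norm (\<phi> (of_real x)) powr p + e ^ 3 * (1 / (1 + (\<eta> * x)\<^sup>2))) / 2 \<partial>lborel) = (e * c + e ^ 3 * (P / \<eta>)) / 2"
        unfolding integral_divide_zero Bochner_Integration.integral_add[OF J3 J4] integral_mult_right_zero P2
        by (simp only: c_def)
      finally show ?thesis .
    qed
    also have "e ^ 3 * (P / \<eta>) = e * P" using e by (simp add: \<eta>_def power2_eq_square power3_eq_cube)
    finally show ?thesis unfolding eq[symmetric] \<eta>_def[symmetric] by (simp add: distrib_left)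
  qed
  have "filterlim (\<lambda>e::real. e\<^sup>2) (at_right 0) (at_right 0)"
  proof -
    have "((\<lambda>e::real. e\<^sup>2) \<longlongrightarrow> 0\<^sup>2) (at_right 0)" by (intro tendsto_intros)
    then show ?thesis by (auto simp: filterlim_at eventually_at_filter)
  qed
  then have "((\<lambda>e. v (e\<^sup>2)) \<longlongrightarrow> 1) (at_right 0)"
    using branch_at_0 unfolding v_def[symmetric] by (rule filterlim_compose[rotated])
  then have lhs: "((\<lambda>e. pi * v (e\<^sup>2) / (1 + (e\<^sup>2)\<^sup>2)) \<longlongrightarrow> pi * 1 / (1 + (0\<^sup>2)\<^sup>2)) (at_right 0)"
    by (intro tendsto_intros) auto
  have rhs: "((\<lambda>e. (l * c + S / l) / 2 + e * (c + P) / 2) \<longlongrightarrow> (l * c + S / l) / 2 + 0 * (c + P) / 2) (at_right 0)"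
    by (intro tendsto_intros) auto
  have "pi * 1 / (1 + (0\<^sup>2)\<^sup>2) \<le> (l * c + S / l) / 2 + 0 * (c + P) / 2"
    by (rule tendsto_le[OF _ rhs lhs]) (use main in \<open>auto simp: eventually_at_filter\<close>)
  then have "2 * pi \<le> l * c + S / l" by simp
  also have "l * c = pi" using c_pos by (simp add: l_def)
  also have "S / l = S * c / pi" by (simp add: l_def)
  finally have "pi \<le> S * c / pi" by simp
  then show ?thesis unfolding S_def[symmetric] by (simp add: pos_le_divide_eq power2_eq_square mult.commute)
qed

end

section \<open>Comparison with the integrands of the bound\<close>

lemma nn_integral_le_suminf_unit_intervals:
  fixes g :: "real \<Rightarrow> ennreal"
  assumes [measurable]: "g \<in> borel_measurable borel"
  shows "(\<integral>\<^sup>+x. g x * indicator {0<..} x \<partial>lborel) \<le> (\<Sum>n. \<integral>\<^sup>+x. g x * indicator {real n<..<real n + 1} x \<partial>lborel)"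
proof -
  have ae: "AE x in lborel. x \<notin> range real"
    by (rule AE_not_in[OF countable_imp_null_set_lborel]) simp
  have "(\<integral>\<^sup>+x. g x * indicator {0<..} x \<partial>lborel) \<le> (\<integral>\<^sup>+x. (\<Sum>n. g x * indicator {real n<..<real n + 1} x) \<partial>lborel)"
  proof (rule nn_integral_mono_AE, use ae in eventually_elim)
    case (elim x)
    show "g x * indicator {0<..} x \<le> (\<Sum>n. g x * indicator {real n<..<real n + 1} x)"
    proof (cases "x > 0")
      case True
      define m where "m = nat \<lfloor>x\<rfloor>"
      have m: "real m \<le> x" "x < real m + 1" using True by (auto simp: m_def)
      moreover have "real m \<noteq> x" using elim by auto
      ultimately have "x \<in> {real m<..<real m + 1}" by auto
      then have "g x * indicator {0<..} x = (\<Sum>n\<in>{m}. g x * indicator {real n<..<real n + 1} x)" using True by simp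
      also have "\<dots> \<le> (\<Sum>n. g x * indicator {real n<..<real n + 1} x)"
        by (rule sum_le_suminf) auto
      finally show ?thesis .
    qed simp
  qed
  also have "\<dots> = (\<Sum>n. \<integral>\<^sup>+x. g x * indicator {real n<..<real n + 1} x \<partial>lborel)"
    by (rule nn_integral_suminf) measurable
  finally show ?thesis .
qed

context extremal
begin

text \<open>The \<open>n\<close>-th integrand of the bound is \<open>bump (x - n) / (pi^2 x^2)\<close>.\<close>

definition bump :: "real \<Rightarrow> real" where
  "bump w = (if 0 \<le> w \<and> w \<le> 2 / p then (sin (p / 2 * pi * w))\<^sup>2 else 0)"

lemma bump_nonneg: "bump w \<ge> 0"
  by (simp add: bump_def)

lemma measurable_bump[measurable]: "bump \<in> borel_measurable borel"
  unfolding bump_def[abs_def] by measurable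

lemma measurable_pos_sin[measurable]: "pos_sin \<in> borel_measurable borel"
  unfolding pos_sin_def[abs_def] by measurable

lemma max_0_sin_sq_le: "(max 0 (sin t))\<^sup>2 \<le> (sin t)\<^sup>2" for t :: real
  by (simp add: max_def)

text \<open>Here \<open>x\<close> rounds to \<open>n + 1\<close>. If the quotient is positive, the phase lies in \<open>[- pi, 0]\<close> and the
  positive part of the sine vanishes; otherwise the phase is \<open>p/2 * pi * (x - n)\<close>, which lies in
  \<open>(pi, 2 pi)\<close> beyond the support of the bump.\<close>

lemma pos_sin_right_half:
  fixes n :: nat
  assumes p4: "p \<le> 4" and x: "real n + 1/2 < x" "x < real n + 1"
  shows "(pos_sin x)\<^sup>2 \<le> bump (x - real n)"
proof -
  have r: "round x = int n + 1" by (rule round_unique') (use x in \<open>auto simp: abs_if\<close>)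
  define u where "u = x - real n"
  have u: "1/2 < u" "u < 1" using x by (auto simp: u_def)
  have ax: "\<bar>x\<bar> = x" using x by simp
  have ph: "phase x = p / 2 * (pi * (u - 1) + (if quot_real x < 0 then pi else 0))"
    by (simp add: phase_def r u_def algebra_simps)
  show ?thesis
  proof (cases "quot_real x < 0")
    case False
    have pu: "0 \<le> p / 2 * (1 - u)" "p / 2 * (1 - u) \<le> 1"
    proof -
      show "0 \<le> p / 2 * (1 - u)" using p2 u by simp
      have "p / 2 * (1 - u) \<le> 2 * (1/2)" using p4 p2 u by (intro mult_mono) auto
      then show "p / 2 * (1 - u) \<le> 1" by simp
    qed
    have "a * (b * (u - 1)) = - (b * (a * (1 - u)))" for a b :: real by (simp add: algebra_simps)
    then have "phase x = - (pi * (p / 2 * (1 - u)))" using False unfolding ph by (simp only: if_False add_0_right)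
    moreover have "sin (pi * (p / 2 * (1 - u))) \<ge> 0"
      using pu mult_left_mono[OF pu(2), of pi] by (intro sin_ge_zero) auto
    ultimately have "pos_sin x = 0" unfolding pos_sin_def ax by simp
    then show ?thesis using bump_nonneg by simp
  next
    case True
    then have ph': "phase x = p / 2 * pi * u" by (simp add: ph algebra_simps)
    show ?thesis
    proof (cases "u \<le> 2 / p")
      case True
      then show ?thesis unfolding pos_sin_def ax ph' u_def[symmetric] using u max_0_sin_sq_le by (simp add: bump_def)
    next
      case False
      then have "1 < p / 2 * u" using p2 by (simp add: field_simps)
      moreover have "p / 2 * u < 2"
      proof -
        have "p / 2 * u \<le> 2 * u" using p4 u by (intro mult_right_mono) auto
        then show ?thesis using u by linarith
      qed
      ultimately have "pi < p / 2 * pi * u" "p / 2 * pi * u < 2 * pi"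
        using mult_strict_left_mono[of 1 "p / 2 * u" pi] mult_strict_left_mono[of "p / 2 * u" 2 pi] by (simp_all add: mult_ac)
      then have "sin (p / 2 * pi * u) < 0" by (rule sin_lt_zero)
      then have "pos_sin x = 0" unfolding pos_sin_def ax ph' by simp
      then show ?thesis using bump_nonneg by simp
    qed
  qed
qed

text \<open>Here \<open>x\<close> rounds to \<open>n\<close>. A negative quotient adds \<open>p/2 * pi\<close> to the phase, and modulo \<open>2 pi\<close> this
  amounts to shifting the bump to the right by \<open>4/p - 1\<close>.\<close>

lemma pos_sin_left_half:
  fixes n :: nat
  assumes p4: "p \<le> 4" and x: "real n < x" "x < real n + 1/2"
  shows "(pos_sin x)\<^sup>2 \<le> (if quot_real x < 0 then bump (x - (4 / p - 1) - real n) else bump (x - real n))"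
proof -
  have r: "round x = int n" by (rule round_unique') (use x in \<open>auto simp: abs_if\<close>)
  define u where "u = x - real n"
  have u: "0 < u" "u < 1/2" using x by (auto simp: u_def)
  have ax: "\<bar>x\<bar> = x" using x by simp
  have ph: "phase x = p / 2 * (pi * u + (if quot_real x < 0 then pi else 0))"
    by (simp add: phase_def r u_def)
  have "1/2 \<le> 2 / p" using p4 p2 by (simp add: field_simps)
  then have up: "u \<le> 2 / p" using u by simp
  show ?thesis
  proof (cases "quot_real x < 0")
    case False
    then have ph': "phase x = p / 2 * pi * u" unfolding ph by simp
    have "(pos_sin x)\<^sup>2 \<le> bump u" unfolding pos_sin_def ax ph' using u up max_0_sin_sq_le by (simp add: bump_def)
    then show ?thesis using False by (simp add: u_def)
  next
    case True
    define w where "w = u - (4 / p - 1)"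
    have d: "4 / p - 1 \<ge> 0" using p4 p2 by (auto simp: field_simps)
    have wp: "p / 2 * pi * w = p / 2 * pi * (u + 1) - 2 * pi" using p2 by (simp add: w_def field_simps)
    have "phase x = p / 2 * pi * w + 2 * pi" using True unfolding wp by (simp add: ph algebra_simps)
    then have s: "sin (phase x) = sin (p / 2 * pi * w)" by simp
    show ?thesis
    proof (cases "w \<ge> 0")
      case True2: True
      have "w \<le> 2 / p" using up d by (simp add: w_def)
      then have "(pos_sin x)\<^sup>2 \<le> bump w" unfolding pos_sin_def ax s using True2 max_0_sin_sq_le by (simp add: bump_def)
      then show ?thesis using True by (simp add: w_def u_def algebra_simps)
    next
      case False
      have "p / 2 * w \<ge> -1"
      proof -
        have "p / 2 * w = p / 2 * (u + 1) - 2" using p2 by (simp add: w_def field_simps)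
        moreover have "p / 2 * (u + 1) \<ge> 1 * 1" using p2 u by (intro mult_mono) auto
        ultimately show ?thesis by simp
      qed
      then have "p / 2 * (- w) \<le> 1" by simp
      then have "p / 2 * pi * (- w) \<le> pi" using mult_left_mono[of "p / 2 * (- w)" 1 pi] by (simp add: mult_ac)
      moreover have "0 \<le> p / 2 * pi * (- w)" using False p2 by (intro mult_nonneg_nonneg) auto
      ultimately have "sin (p / 2 * pi * (- w)) \<ge> 0" by (rule sin_ge_zero[rotated])
      then have "pos_sin x = 0" unfolding pos_sin_def ax s by simp
      then show ?thesis using bump_nonneg by simp
    qed
  qed
qed

text \<open>Since the quotient is nondecreasing, it is negative exactly on an initial part of the interval. The
  bump is shifted to the right there, by \<open>4/p - 1 \<ge> 0\<close>, where the weight \<open>1/x^2\<close> is smaller; so undoing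
  the shift increases the integral and keeps the bump inside the initial part.\<close>

lemma left_half_integral_le:
  fixes n :: nat
  assumes p4: "p \<le> 4"
  shows "(\<integral>\<^sup>+x. ennreal ((pos_sin x)\<^sup>2 / (pi\<^sup>2 * x\<^sup>2)) * indicator {real n<..<real n + 1/2} x \<partial>lborel)
     \<le> (\<integral>\<^sup>+x. ennreal (bump (x - real n) / (pi\<^sup>2 * x\<^sup>2)) * indicator {real n<..<real n + 1/2} x \<partial>lborel)"
proof -
  define d where "d = 4 / p - 1"
  have d: "d \<ge> 0" using p4 p2 by (simp add: d_def field_simps)
  define N where "N = {x. real n < x \<and> x < real n + 1/2 \<and> quot_real x < 0}"
  \<comment> \<open>the point where the quotient changes sign\<close>
  define V where "V = (if N = {} then real n else Sup N)"
  have bdd: "bdd_above N" by (rule bdd_aboveI[of _ "real n + 1/2"]) (auto simp: N_def)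
  have below: "quot_real y < 0" if "real n < y" "y < V" for y
  proof -
    have ne: "N \<noteq> {}" using that by (auto simp: V_def)
    then have "y < Sup N" using that by (simp add: V_def)
    then obtain x where x: "x \<in> N" "y < x" using less_cSup_iff[OF ne bdd] by blast
    have "quot_real y \<le> quot_real x"
      by (rule quot_real_mono[of _ _ "int n"]) (use x that in \<open>auto simp: N_def\<close>)
    then show ?thesis using x by (auto simp: N_def)
  qed
  have above: "\<not> quot_real y < 0" if "y < real n + 1/2" "V < y" "real n < y" for y
  proof
    assume "quot_real y < 0"
    then have yN: "y \<in> N" using that by (simp add: N_def)
    then have "y \<le> Sup N" using bdd by (rule cSup_upper)
    moreover have "V = Sup N" using yN by (auto simp: V_def)
    ultimately show False using that by simp
  qed
  define k where "k = (\<lambda>w x. ennreal (bump w / (pi\<^sup>2 * x\<^sup>2)))"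
  have [measurable]: "(\<lambda>x. k (f x) (g x)) \<in> borel_measurable borel" if "f \<in> borel_measurable borel" "g \<in> borel_measurable borel" for f g :: "real \<Rightarrow> real"
    using that unfolding k_def by measurable
  let ?I = "{real n<..<real n + 1/2}"
  let ?A = "?I \<inter> {..<V}"
  let ?B = "?I \<inter> {V<..}"
  have "(\<integral>\<^sup>+x. ennreal ((pos_sin x)\<^sup>2 / (pi\<^sup>2 * x\<^sup>2)) * indicator ?I x \<partial>lborel)
     \<le> (\<integral>\<^sup>+x. k (x - d - real n) x * indicator ?A x + k (x - real n) x * indicator ?B x \<partial>lborel)"
  proof (rule nn_integral_mono_AE)
    show "AE x in lborel. ennreal ((pos_sin x)\<^sup>2 / (pi\<^sup>2 * x\<^sup>2)) * indicator ?I x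
       \<le> k (x - d - real n) x * indicator ?A x + k (x - real n) x * indicator ?B x"
      using AE_neq_lborel[of V]
    proof eventually_elim
      case (elim x)
      show ?case
      proof (cases "x \<in> ?I")
        case True
        note b = pos_sin_left_half[OF p4, of n x]
        show ?thesis
        proof (cases "x < V")
          case lt: True
          then have "(pos_sin x)\<^sup>2 \<le> bump (x - d - real n)" using b below[of x] True by (simp add: d_def)
          then have "ennreal ((pos_sin x)\<^sup>2 / (pi\<^sup>2 * x\<^sup>2)) \<le> k (x - d - real n) x"
            unfolding k_def by (intro ennreal_leI divide_right_mono) auto
          then show ?thesis using True lt by simp
        next
          case False
          then have gt: "V < x" using elim by simp
          then have "(pos_sin x)\<^sup>2 \<le> bump (x - real n)" using b above[of x] True by simp
          then have "ennreal ((pos_sin x)\<^sup>2 / (pi\<^sup>2 * x\<^sup>2)) \<le> k (x - real n) x"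
            unfolding k_def by (intro ennreal_leI divide_right_mono) auto
          then show ?thesis using True gt by simp
        qed
      qed simp
    qed
  qed
  also have "\<dots> = (\<integral>\<^sup>+x. k (x - d - real n) x * indicator ?A x \<partial>lborel) + (\<integral>\<^sup>+x. k (x - real n) x * indicator ?B x \<partial>lborel)"
    by (rule nn_integral_add) measurable
  also have "(\<integral>\<^sup>+x. k (x - d - real n) x * indicator ?A x \<partial>lborel)
     = (\<integral>\<^sup>+x. k (d + 1 * x - d - real n) (d + 1 * x) * indicator ?A (d + 1 * x) \<partial>lborel)"
  proof -
    have m: "(\<lambda>x. k (x - d - real n) x * indicator ?A x) \<in> borel_measurable borel" by measurable
    show ?thesis using nn_integral_real_affine[OF m, of 1 d] by simp
  qed
  also have "\<dots> \<le> (\<integral>\<^sup>+x. k (x - real n) x * indicator ?A x \<partial>lborel)"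
  proof (rule nn_integral_mono_AE)
    show "AE x in lborel. k (d + 1 * x - d - real n) (d + 1 * x) * indicator ?A (d + 1 * x) \<le> k (x - real n) x * indicator ?A x"
      using AE_neq_lborel[of "real n"]
    proof eventually_elim
      case (elim x)
      show ?case
      proof (cases "d + x \<in> ?A \<and> x \<ge> real n")
        case True
        then have xn: "x > real n" using elim by simp
        then have xA: "x \<in> ?A" using True d by auto
        have "x > 0" using xn by (meson of_nat_0_le_iff le_less_trans)
        then have "bump (x - real n) / (pi\<^sup>2 * (d + x)\<^sup>2) \<le> bump (x - real n) / (pi\<^sup>2 * x\<^sup>2)"
          using d bump_nonneg by (intro divide_left_mono mult_left_mono power_mono mult_pos_pos) auto
        then have "k (x - real n) (d + x) \<le> k (x - real n) x" unfolding k_def by (rule ennreal_leI)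
        then show ?thesis using True xA by simp
      next
        case False
        then show ?thesis by (auto simp: k_def bump_def indicator_def)
      qed
    qed
  qed
  also have "(\<integral>\<^sup>+x. k (x - real n) x * indicator ?A x \<partial>lborel) + (\<integral>\<^sup>+x. k (x - real n) x * indicator ?B x \<partial>lborel)
     = (\<integral>\<^sup>+x. k (x - real n) x * indicator ?A x + k (x - real n) x * indicator ?B x \<partial>lborel)"
    by (rule nn_integral_add[symmetric]) measurable
  also have "\<dots> \<le> (\<integral>\<^sup>+x. k (x - real n) x * indicator ?I x \<partial>lborel)"
    by (rule nn_integral_mono) (auto simp: indicator_def)
  finally show ?thesis by (simp add: k_def add_right_mono)
qed

lemma unit_interval_integral_le:
  fixes n :: nat
  assumes p4: "p \<le> 4"
  shows "(\<integral>\<^sup>+x. ennreal ((pos_sin x)\<^sup>2 / (pi\<^sup>2 * x\<^sup>2)) * indicator {real n<..<real n + 1} x \<partial>lborel)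
     \<le> (\<integral>\<^sup>+x. ennreal (bump (x - real n) / (pi\<^sup>2 * x\<^sup>2)) \<partial>lborel)"
proof -
  let ?g = "\<lambda>x. ennreal ((pos_sin x)\<^sup>2 / (pi\<^sup>2 * x\<^sup>2))"
  let ?b = "\<lambda>x. ennreal (bump (x - real n) / (pi\<^sup>2 * x\<^sup>2))"
  let ?L = "{real n<..<real n + 1/2}" and ?R = "{real n + 1/2<..<real n + 1}"
  have "(\<integral>\<^sup>+x. ?g x * indicator {real n<..<real n + 1} x \<partial>lborel) \<le> (\<integral>\<^sup>+x. ?g x * indicator ?L x + ?b x * indicator ?R x \<partial>lborel)"
  proof (rule nn_integral_mono_AE)
    show "AE x in lborel. ?g x * indicator {real n<..<real n + 1} x \<le> ?g x * indicator ?L x + ?b x * indicator ?R x"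
      using AE_neq_lborel[of "real n + 1/2"]
    proof eventually_elim
      case (elim x)
      show ?case
      proof (cases "x \<in> ?R")
        case True
        then have "?g x \<le> ?b x" using pos_sin_right_half[OF p4, of n x]
          by (intro ennreal_leI divide_right_mono) auto
        then show ?thesis using True by simp
      next
        case False
        then show ?thesis using elim by (auto simp: indicator_def)
      qed
    qed
  qed
  also have "\<dots> = (\<integral>\<^sup>+x. ?g x * indicator ?L x \<partial>lborel) + (\<integral>\<^sup>+x. ?b x * indicator ?R x \<partial>lborel)"
    by (rule nn_integral_add) measurable
  also have "\<dots> \<le> (\<integral>\<^sup>+x. ?b x * indicator ?L x \<partial>lborel) + (\<integral>\<^sup>+x. ?b x * indicator ?R x \<partial>lborel)"
    by (intro add_right_mono left_half_integral_le p4)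
  also have "\<dots> = (\<integral>\<^sup>+x. ?b x * indicator ?L x + ?b x * indicator ?R x \<partial>lborel)"
    by (rule nn_integral_add[symmetric]) measurable
  also have "\<dots> \<le> (\<integral>\<^sup>+x. ?b x \<partial>lborel)"
    by (rule nn_integral_mono) (auto simp: indicator_def)
  finally show ?thesis .
qed

lemma pos_sin_integral_le:
  assumes p4: "p \<le> 4"
  shows "(\<integral>\<^sup>+x. ennreal ((pos_sin x)\<^sup>2 / (pi\<^sup>2 * x\<^sup>2)) \<partial>lborel)
     \<le> 2 * (\<Sum>n. \<integral>\<^sup>+x. ennreal (bump (x - real n) / (pi\<^sup>2 * x\<^sup>2)) \<partial>lborel)"
proof -
  let ?g = "\<lambda>x. ennreal ((pos_sin x)\<^sup>2 / (pi\<^sup>2 * x\<^sup>2))"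
  have "(\<integral>\<^sup>+x. ?g x \<partial>lborel) \<le> (\<integral>\<^sup>+x. ?g x * indicator {0<..} x + ?g x * indicator {..<0} x \<partial>lborel)"
    by (rule nn_integral_mono_AE, use AE_neq_lborel[of 0] in eventually_elim) (auto simp: indicator_def)
  also have "\<dots> = (\<integral>\<^sup>+x. ?g x * indicator {0<..} x \<partial>lborel) + (\<integral>\<^sup>+x. ?g x * indicator {..<0} x \<partial>lborel)"
    by (rule nn_integral_add) measurable
  also have "(\<integral>\<^sup>+x. ?g x * indicator {..<0} x \<partial>lborel) = (\<integral>\<^sup>+x. ?g (0 + -1 * x) * indicator {..<0} (0 + -1 * x) \<partial>lborel)"
  proof -
    have m: "(\<lambda>x. ?g x * indicator {..<0} x) \<in> borel_measurable borel" by measurable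
    show ?thesis using nn_integral_real_affine[OF m, of "-1" 0] by simp
  qed
  also have "\<dots> = (\<integral>\<^sup>+x. ?g x * indicator {0<..} x \<partial>lborel)"
    by (rule nn_integral_cong) (simp add: pos_sin_def indicator_def)
  also have "(\<integral>\<^sup>+x. ?g x * indicator {0<..} x \<partial>lborel) + (\<integral>\<^sup>+x. ?g x * indicator {0<..} x \<partial>lborel)
     = 2 * (\<integral>\<^sup>+x. ?g x * indicator {0<..} x \<partial>lborel)" by (simp add: mult_2)
  also have "\<dots> \<le> 2 * (\<Sum>n. \<integral>\<^sup>+x. ?g x * indicator {real n<..<real n + 1} x \<partial>lborel)"
  proof -
    have m: "?g \<in> borel_measurable borel" by measurable
    show ?thesis by (intro mult_left_mono nn_integral_le_suminf_unit_intervals m) simp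
  qed
  also have "\<dots> \<le> 2 * (\<Sum>n. \<integral>\<^sup>+x. ennreal (bump (x - real n) / (pi\<^sup>2 * x\<^sup>2)) \<partial>lborel)"
    by (intro mult_left_mono suminf_le unit_interval_integral_le p4) auto
  finally show ?thesis .
qed


lemma bump_integral:
  fixes n :: nat
  defines "I \<equiv> LINT x:{real n..real n + 2 / p}|lborel. (sin (p / 2 * pi * (x - real n)))\<^sup>2 / (pi\<^sup>2 * x\<^sup>2)"
  shows "(\<integral>\<^sup>+x. ennreal (bump (x - real n) / (pi\<^sup>2 * x\<^sup>2)) \<partial>lborel) = ennreal I"
    and "I \<ge> 0" and "n > 0 \<Longrightarrow> I \<le> 1 / (real n)\<^sup>2"
proof -
  define f where "f = (\<lambda>x. bump (x - real n) / (pi\<^sup>2 * x\<^sup>2))"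
  have fe: "indicator {real n..real n + 2 / p} x *\<^sub>R ((sin (p / 2 * pi * (x - real n)))\<^sup>2 / (pi\<^sup>2 * x\<^sup>2)) = f x" for x
    by (auto simp: f_def bump_def indicator_def)
  have I: "I = (\<integral>x. f x \<partial>lborel)" unfolding I_def set_lebesgue_integral_def fe ..
  have f0: "f x \<ge> 0" for x by (simp add: f_def bump_nonneg)
  have mf[measurable]: "f \<in> borel_measurable borel" unfolding f_def by measurable
  have ind: "integrable lborel (\<lambda>x. D * indicator {real n..real n + 2 / p} x :: real)" for D
    using p2 by (intro integrable_mult_right integrable_real_indicator) (auto simp: emeasure_lborel_Icc_eq)
  have dom: "f x \<le> (if n > 0 then 1 / (real n)\<^sup>2 / pi\<^sup>2 else p\<^sup>2 / 4) * indicator {real n..real n + 2 / p} x" for x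
  proof (cases "x \<in> {real n..real n + 2 / p}")
    case True
    show ?thesis
    proof (cases "n > 0")
      case n: True
      have "(sin (p / 2 * pi * (x - real n)))\<^sup>2 / (pi\<^sup>2 * x\<^sup>2) \<le> 1 / (pi\<^sup>2 * (real n)\<^sup>2)"
        using n True by (intro frac_le mult_left_mono power_mono) (auto simp: abs_square_le_1)
      then show ?thesis using True n by (simp add: fe[symmetric] mult.commute)
    next
      case False
      then have n0: "n = 0" by simp
      have "(sin (p / 2 * pi * x))\<^sup>2 / (pi\<^sup>2 * x\<^sup>2) \<le> p\<^sup>2 / 4"
      proof (cases "x = 0")
        case False
        have "\<bar>sin (p / 2 * pi * x)\<bar> \<le> \<bar>p / 2 * pi * x\<bar>" by (rule abs_sin_x_le_abs_x)
        then have "(sin (p / 2 * pi * x))\<^sup>2 \<le> (p / 2 * pi * x)\<^sup>2" by (rule abs_le_square_iff[THEN iffD1])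
        also have "\<dots> = p\<^sup>2 / 4 * (pi\<^sup>2 * x\<^sup>2)" by (simp add: power_mult_distrib power_divide)
        finally show ?thesis using False by (simp add: pos_divide_le_eq)
      qed simp
      then show ?thesis using True by (simp add: fe[symmetric] n0)
    qed
  qed (simp add: fe[symmetric])
  have fi: "integrable lborel f"
    by (rule Bochner_Integration.integrable_bound[OF ind[of "if n > 0 then 1 / (real n)\<^sup>2 / pi\<^sup>2 else p\<^sup>2 / 4"]]) (use mf f0 order_trans[OF dom abs_ge_self] in \<open>auto intro!: AE_I2\<close>)
  show "(\<integral>\<^sup>+x. ennreal (bump (x - real n) / (pi\<^sup>2 * x\<^sup>2)) \<partial>lborel) = ennreal I"
    using nn_integral_eq_integral[OF fi] f0 unfolding I by (simp add: f_def)
  show "I \<ge> 0" unfolding I using f0 by simp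
  assume n: "n > 0"
  have "I \<le> (\<integral>x. 1 / (real n)\<^sup>2 / pi\<^sup>2 * indicator {real n..real n + 2 / p} x \<partial>lborel)"
    unfolding I by (rule integral_mono[OF fi ind]) (use dom n in auto)
  also have "\<dots> = 1 / (real n)\<^sup>2 * (2 / p / pi\<^sup>2)" using p2 by simp
  also have "\<dots> \<le> 1 / (real n)\<^sup>2 * 1"
  proof (rule mult_left_mono)
    have "2 / p \<le> 1" using p2 by simp
    moreover have "1 \<le> pi\<^sup>2" using pi_ge_two by (simp add: one_le_power)
    ultimately show "2 / p / pi\<^sup>2 \<le> 1" using frac_le[of 1 "2 / p" 1 "pi\<^sup>2"] by simp
  qed simp
  finally show "I \<le> 1 / (real n)\<^sup>2" by simp
qed

lemma one_le_c_times_sum: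
  assumes p4: "p \<le> 4"
  shows "1 \<le> c * (2 * (\<Sum>n::nat. LINT x:{real n..real n + 2 / p}|lborel.
             (sin (p / 2 * pi * (x - real n)))\<^sup>2 / (pi\<^sup>2 * x\<^sup>2)))"
proof -
  define I where "I = (\<lambda>n::nat. LINT x:{real n..real n + 2 / p}|lborel. (sin (p / 2 * pi * (x - real n)))\<^sup>2 / (pi\<^sup>2 * x\<^sup>2))"
  have I0: "I n \<ge> 0" for n unfolding I_def by (rule bump_integral(2))
  have sI: "summable I"
  proof (rule summable_comparison_test_ev)
    show "summable (\<lambda>n. 1 / (real n)\<^sup>2)" using inverse_power_summable[of 2, where 'a=real] by (simp add: inverse_eq_divide)
    show "\<forall>\<^sub>F n in sequentially. norm (I n) \<le> 1 / (real n)\<^sup>2"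
      using eventually_gt_at_top[of 0]
    proof eventually_elim
      case (elim n)
      then show ?case using I0[of n] bump_integral(3)[of n] by (simp add: I_def)
    qed
  qed
  have "(\<integral>\<^sup>+x. ennreal ((pos_sin x)\<^sup>2 / (pi\<^sup>2 * x\<^sup>2)) \<partial>lborel) \<le> 2 * (\<Sum>n. ennreal (I n))"
    using pos_sin_integral_le[OF p4] unfolding bump_integral(1) I_def .
  also have "\<dots> = ennreal (2 * (\<Sum>n. I n))"
    using suminf_ennreal2[OF I0 sI] suminf_nonneg[OF sI I0] by (simp add: ennreal_mult)
  finally have nn: "(\<integral>\<^sup>+x. ennreal ((pos_sin x)\<^sup>2 / (pi\<^sup>2 * x\<^sup>2)) \<partial>lborel) \<le> ennreal (2 * (\<Sum>n. I n))" .
  have gi: "integrable lborel (\<lambda>x. (pos_sin x)\<^sup>2 / (pi\<^sup>2 * x\<^sup>2))"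
    by (rule integrableI_nonneg) (use le_less_trans[OF nn] in auto)
  have le: "(\<integral>x. (pos_sin x)\<^sup>2 / (pi\<^sup>2 * x\<^sup>2) \<partial>lborel) \<le> 2 * (\<Sum>n. I n)"
    using nn suminf_nonneg[OF sI I0] by (subst (asm) nn_integral_eq_integral[OF gi]) auto
  have eq: "(pos_sin x)\<^sup>2 / x\<^sup>2 = pi\<^sup>2 * ((pos_sin x)\<^sup>2 / (pi\<^sup>2 * x\<^sup>2))" for x by simp
  have gi2: "integrable lborel (\<lambda>x. (pos_sin x)\<^sup>2 / x\<^sup>2)" unfolding eq using gi by (rule integrable_mult_right)
  have "pi\<^sup>2 \<le> c * (\<integral>x. (pos_sin x)\<^sup>2 / x\<^sup>2 \<partial>lborel)" by (rule lower_bound_c[OF gi2])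
  also have "(\<integral>x. (pos_sin x)\<^sup>2 / x\<^sup>2 \<partial>lborel) = pi\<^sup>2 * (\<integral>x. (pos_sin x)\<^sup>2 / (pi\<^sup>2 * x\<^sup>2) \<partial>lborel)"
    unfolding eq by (rule integral_mult_right_zero)
  also have "c * (pi\<^sup>2 * (\<integral>x. (pos_sin x)\<^sup>2 / (pi\<^sup>2 * x\<^sup>2) \<partial>lborel)) \<le> c * (pi\<^sup>2 * (2 * (\<Sum>n. I n)))"
    using le c_pos by (intro mult_left_mono) auto
  finally have "pi\<^sup>2 * 1 \<le> pi\<^sup>2 * (c * (2 * (\<Sum>n. I n)))" by (simp add: mult_ac)
  then show ?thesis unfolding I_def by (subst (asm) mult_le_cancel_left_pos) auto
qed

end

theorem corollary1p4:
  fixes p :: real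
  assumes "2 \<le> p" and "p \<le> 4"
  shows "point_eval_const p \<le> ennreal (2 * (\<Sum>n::nat.
           LINT x:{real n..real n + 2 / p}|lborel.
             (sin (p / 2 * pi * (x - real n)))\<^sup>2 / (pi\<^sup>2 * x\<^sup>2)))"
proof -
  define B where "B = 2 * (\<Sum>n::nat. LINT x:{real n..real n + 2 / p}|lborel.
             (sin (p / 2 * pi * (x - real n)))\<^sup>2 / (pi\<^sup>2 * x\<^sup>2))"
  have "ennreal (norm (f 0) powr p) \<le> ennreal B * Lp_norm_pow p f" if f: "f \<in> Paley_Wiener p" for f
  proof (cases "f 0 = 0")
    case True
    then show ?thesis by simp
  next
    case False
    obtain F where F: "F holomorphic_on UNIV" "exponential_type_le F pi" "\<And>x. F (of_real x) = f x"
      using f by (auto simp: Paley_Wiener_def)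
    have fm: "f \<in> borel_measurable lborel" "Lp_norm_pow p f < \<infinity>" using f by (auto simp: Paley_Wiener_def Lp_fun_def)
    have fi: "integrable lborel (\<lambda>x. norm (f x) powr p)"
      by (rule integrableI_nonneg) (use fm in \<open>auto simp: Lp_norm_pow_def\<close>)
    define a where "a = f 0"
    define J where "J = (\<integral>x. norm (f x) powr p \<partial>lborel)"
    have Lp: "Lp_norm_pow p f = ennreal J"
      unfolding Lp_norm_pow_def J_def by (rule nn_integral_eq_integral[OF fi]) simp
    define G where "G = (\<lambda>z. F z / a)"
    have G1: "G holomorphic_on UNIV" unfolding G_def using False by (intro holomorphic_intros F) (auto simp: a_def)
    have G2: "exponential_type_le G pi"
      unfolding exponential_type_le_def
    proof (intro allI impI)
      fix e :: real assume "e > 0"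
      then obtain A where A: "\<And>z. norm (F z) \<le> A * exp ((pi + e) * norm z)"
        using F(2) unfolding exponential_type_le_def by blast
      have "norm (G z) \<le> A / norm a * exp ((pi + e) * norm z)" for z
        using divide_right_mono[OF A[of z] norm_ge_zero[of a]] by (simp add: G_def norm_divide)
      then show "\<exists>A. \<forall>z. norm (G z) \<le> A * exp ((pi + e) * norm z)" by blast
    qed
    have G3: "G 0 = 1" using F(3)[of 0] False by (simp add: G_def a_def)
    have Gn: "norm (G (of_real x)) powr p = norm (f x) powr p / norm a powr p" for x
      by (simp add: G_def F(3) norm_divide powr_divide)
    have G4: "integrable lborel (\<lambda>x. norm (G (of_real x)) powr p)" unfolding Gn using fi by (rule integrable_divide)
    obtain c \<phi> where ext: "extremal p c \<phi>" using extremal_exists[OF assms(1) G1 G2 G3 G4] by blast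
    have "c \<le> (\<integral>x. norm (G (of_real x)) powr p \<partial>lborel)" by (rule extremal.minimal[OF ext G1 G2 G3 G4])
    also have "\<dots> = J / norm a powr p" unfolding Gn J_def by (rule integral_divide_zero)
    finally have cJ: "c \<le> J / norm a powr p" .
    have an: "norm a powr p > 0" using False by (simp add: a_def)
    have cB: "1 \<le> c * B" unfolding B_def by (rule extremal.one_le_c_times_sum[OF ext assms(2)])
    have c0: "c > 0" by (rule extremal.c_pos[OF ext])
    have B0: "B \<ge> 0" using cB c0 by (smt (verit) mult_nonneg_nonpos)
    have "norm a powr p * 1 \<le> norm a powr p * (c * B)" using cB by (intro mult_left_mono) auto
    also have "\<dots> = (c * norm a powr p) * B" by simp
    also have "\<dots> \<le> J * B" using cJ an B0 by (intro mult_right_mono) (auto simp: pos_le_divide_eq)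
    finally have "norm (f 0) powr p \<le> B * J" by (simp add: a_def mult.commute)
    then have "ennreal (norm (f 0) powr p) \<le> ennreal (B * J)" by (rule ennreal_leI)
    also have "\<dots> = ennreal B * ennreal J" using B0 by (intro ennreal_mult) (auto simp: J_def)
    finally show ?thesis by (simp add: Lp)
  qed
  then show ?thesis unfolding point_eval_const_def B_def[symmetric] by (intro Inf_lower) auto
qed

end
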